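(* Let $U$ be a steady self-similar entropy solution, without stagnation points, of the two-dimensional full Euler equations for a polytropic gas with exponent $\gamma>1$ (values in $\mathcal P_K$). Suppose $I_i=[\theta_i,\theta_{i+1}]$ is a forward sector. Then on $]\theta_i,\overline\theta_i]$ exactly one of the following is true: (i) $U$ is constant on either side of a forward facing shock: there is $\theta_0\in\,]\theta_i,\overline\theta_i[$ at which $U$ has a forward facing shock, and $U$ is constant on $]\theta_i,\theta_0[$ and on $]\theta_0,\overline\theta_i]$; (ii) $U$ is constant on either side of a forward expansion wave: there is a forward expansion wave $[\alpha,\beta]$ with $\theta_i<\alpha<\beta<\overline\theta_i$, and $U$ is constant on $]\theta_i,\alpha[$ and on $]\beta,\overline\theta_i]$; (iii) $U$ has a forward expansion wave on $[\alpha,\overline\theta_i]$ for some $\alpha\in\,]\theta_i,\overline\theta_i[$ and is constant on $]\theta_i,\alpha[$; (iv) $U$ has a normal shock (that is, a shock with $L=0$) at $\overline\theta_i$ and is constant on $]\theta_i,\overline\theta_i[$; (v) $U$ is constant on $]\theta_i,\overline\theta_i]$. Suppose instead $I_i=[\theta_i,\theta_{i+1}]$ is a backward sector. Then on $[\overline\theta_i,\theta_{i+1}[$ exactly one of the following is true: (i) there is $\theta_0\in\,]\overline\theta_i,\theta_{i+1}[$ at which $U$ has a backward facing shock, and $U$ is constant on $[\overline\theta_i,\theta_0[$ and on $]\theta_0,\theta_{i+1}[$; (ii) there is a backward expansion wave $[\alpha,\beta]$ with $\overline\theta_i<\alpha<\beta<\theta_{i+1}$, and $U$ is constant on $[\overline\theta_i,\alpha[$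 and on $]\beta,\theta_{i+1}[$; (iii) $U$ has a backward expansion wave on $[\overline\theta_i,\beta]$ for some $\beta\in\,]\overline\theta_i,\theta_{i+1}[$ and is constant on $]\beta,\theta_{i+1}[$; (iv) $U$ has a normal shock at $\overline\theta_i$ and is constant on $]\overline\theta_i,\theta_{i+1}[$; (v) $U$ has no shock at $\overline\theta_i$ and is constant on $[\overline\theta_i,\theta_{i+1}[$.
   Context: Notation: $\rho$ density, $\vec u=(u,v)$ velocity, $p$ pressure, $e$ specific internal energy, $S$ specific entropy, $E=\rho\left(\frac{u^2+v^2}{2}+e\right)$, $U=(\rho,\rho u,\rho v,E)^T$. Polytropic gas: $e=\frac{p}{(\gamma-1)\rho}$, sound speed $c=\sqrt{\gamma p/\rho}$, $S=c_v\ln(p\rho^{-\gamma})+\text{const}$, $c_v>0$. Phase space: for a constant $K>1$, $\mathcal P_K$ is the set of $U$ with $K^{-1}\le\rho\le K$, $K^{-1}\le e\le K$, $|U|\le K$. Fluxes: $f^x(U)=(\rho u,\rho u^2+p,\rho uv,u(E+p))^T$, $f^y(U)=(\rho v,\rho uv,\rho v^2+p,v(E+p))^T$, $\psi^x=\rho uS$, $\psi^y=\rho vS$. A steady self-similar entropy solution is a $2\pi$-periodic function $\theta\mapsto U(\theta)\in\mathcal P_K$ in $L^\infty$ ($\theta$ is the polar angle), in a version such that for all $\theta_1<\theta_2$ $$(\sin\theta f^x(U)-\cos\theta f^y(U))\big|_{\theta_1}^{\theta_2}=\int_{\theta_1}^{\theta_2}\cos\eta f^x(U(\eta))+\sin\eta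 f^y(U(\eta))\,d\eta,$$ $$(\sin\theta\psi^x(U)-\cos\theta\psi^y(U))\big|_{\theta_1}^{\theta_2}\le\int_{\theta_1}^{\theta_2}\cos\eta\psi^x(U(\eta))+\sin\eta\psi^y(U(\eta))\,d\eta.$$ No stagnation points means $\vec u(\theta)\ne0$ for every $\theta$; then $U$ has one-sided limits at every discontinuity and is normalised to be right-continuous. Normal and tangential velocities: $N=u\sin\theta-v\cos\theta$, $L=u\cos\theta+v\sin\theta$. If $U$ is discontinuous at $\theta_0$, it has a forward (resp. backward) facing shock there if $N>0$ (resp. $N<0$) on a neighborhood of $\theta_0$; a shock is either of these. ($L$ is continuous at shocks.) Sectors: the set $\{\theta\in[0,2\pi[:N(\theta)=0\}$ is finite; write it as $\theta_1<\dots<\theta_m$ and $\theta_{m+1}=\theta_1$ (mod $2\pi$, i.e. $\theta_1+2\pi$). The sectors are $I_i=[\theta_i,\theta_{i+1}]$; $I_i$ is forward if $N\ge0$ on $I_i$ and backward if $N\le0$ on $I_i$ (each sector is one or the other, with $N\neq0$ in its interior). In each sector, $\overline\theta_i$ denotes the unique point of $]\theta_i,\theta_{i+1}[$ with $L(\overline\theta_i)=0$ (it exists; $L$ is strictly monotone on $]\theta_i,\theta_{i+1}[$, decreasing in a forward sector and increasing in a backward one). Waves: in sector $I_i$, a forward expansion wave is an interval $[\alpha,\beta]$ with $\alpha<\beta\le\overline\theta_i$, $N=c$ and $L\ge0$ on $[\alpha,\beta]$; a backward expansion wave is an interval $[\alpha,\beta]$ with $\overline\theta_i\le\alpha<\beta$,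 $N=-c$ and $L\ge0$ on $[\alpha,\beta]$. *)

theory Defs
  imports "HOL-Analysis.Analysis"
begin

text \<open>A state is the vector of conserved variables
  \<open>(\<rho>, \<rho>u, \<rho>v, E)\<close>; all other quantities are functions of it.\<close>

type_synonym state = "real ^ 4"

definition density :: "state \<Rightarrow> real" where
  "density w = w $ 1"

definition velx :: "state \<Rightarrow> real" where
  "velx w = w $ 2 / w $ 1"

definition vely :: "state \<Rightarrow> real" where
  "vely w = w $ 3 / w $ 1"

definition energy :: "state \<Rightarrow> real" where
  "energy w = w $ 4"

text \<open>Solved from \<open>E = \<rho> ((u\<^sup>2 + v\<^sup>2) / 2 + e)\<close>.\<close>

definition internal_energy :: "state \<Rightarrow> real" where
  "internal_energy w = energy w / density w - ((velx w)\<^sup>2 + (vely w)\<^sup>2) / 2"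

text \<open>Solved from the polytropic law \<open>e = p / ((\<gamma> - 1) \<rho>)\<close>.\<close>

definition pressure :: "real \<Rightarrow> state \<Rightarrow> real" where
  "pressure \<gamma> w = (\<gamma> - 1) * density w * internal_energy w"

definition sound_speed :: "real \<Rightarrow> state \<Rightarrow> real" where
  "sound_speed \<gamma> w = sqrt (\<gamma> * pressure \<gamma> w / density w)"

text \<open>\<open>S\<^sub>0\<close> is the additive constant in the specific entropy.\<close>

definition entropy :: "real \<Rightarrow> real \<Rightarrow> real \<Rightarrow> state \<Rightarrow> real" where
  "entropy \<gamma> c\<^sub>v S\<^sub>0 w = c\<^sub>v * ln (pressure \<gamma> w * density w powr (- \<gamma>)) + S\<^sub>0"

definition phase_space :: "real \<Rightarrow> state set" where
  "phase_space K = {w. 1 / K \<le> density w \<and> density w \<le> K \<and>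
     1 / K \<le> internal_energy w \<and> internal_energy w \<le> K \<and> norm w \<le> K}"

lemma vector_4_nth [simp]:
  "(vector [a, b, c, d] :: real ^ 4) $ 1 = a"
  "(vector [a, b, c, d] :: real ^ 4) $ 2 = b"
  "(vector [a, b, c, d] :: real ^ 4) $ 3 = c"
  "(vector [a, b, c, d] :: real ^ 4) $ 4 = d"
  by (simp_all add: vector_def)

definition flux_x :: "real \<Rightarrow> state \<Rightarrow> real ^ 4" where
  "flux_x \<gamma> w =
     (let \<rho> = density w; u = velx w; v = vely w; p = pressure \<gamma> w; E = energy w
      in vector [\<rho> * u, \<rho> * u\<^sup>2 + p, \<rho> * u * v, u * (E + p)])"

definition flux_y :: "real \<Rightarrow> state \<Rightarrow> real ^ 4" where
  "flux_y \<gamma> w =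
     (let \<rho> = density w; u = velx w; v = vely w; p = pressure \<gamma> w; E = energy w
      in vector [\<rho> * v, \<rho> * u * v, \<rho> * v\<^sup>2 + p, v * (E + p)])"

definition entropy_flux_x :: "real \<Rightarrow> real \<Rightarrow> real \<Rightarrow> state \<Rightarrow> real" where
  "entropy_flux_x \<gamma> c\<^sub>v S\<^sub>0 w = density w * velx w * entropy \<gamma> c\<^sub>v S\<^sub>0 w"

definition entropy_flux_y :: "real \<Rightarrow> real \<Rightarrow> real \<Rightarrow> state \<Rightarrow> real" where
  "entropy_flux_y \<gamma> c\<^sub>v S\<^sub>0 w = density w * vely w * entropy \<gamma> c\<^sub>v S\<^sub>0 w"

text \<open>The solution is a genuine function (the chosen version of the \<open>L\<^sup>\<infinity>\<close> class), for
  which the integrated relations hold for all \<open>\<theta>\<^sub>1 < \<theta>\<^sub>2\<close>, not just for almost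
  all.  Essential boundedness is implied by taking values in \<open>phase_space K\<close>.\<close>

definition steady_entropy_solution ::
    "real \<Rightarrow> real \<Rightarrow> real \<Rightarrow> real \<Rightarrow> (real \<Rightarrow> state) \<Rightarrow> bool" where
  "steady_entropy_solution \<gamma> c\<^sub>v S\<^sub>0 K U \<longleftrightarrow>
     U \<in> borel_measurable lebesgue \<and>
     (\<forall>\<theta>. U (\<theta> + 2 * pi) = U \<theta>) \<and>
     (\<forall>\<theta>. U \<theta> \<in> phase_space K) \<and>
     (\<forall>\<theta>\<^sub>1 \<theta>\<^sub>2. \<theta>\<^sub>1 < \<theta>\<^sub>2 \<longrightarrow>
        (sin \<theta>\<^sub>2 *\<^sub>R flux_x \<gamma> (U \<theta>\<^sub>2) - cos \<theta>\<^sub>2 *\<^sub>R flux_y \<gamma> (U \<theta>\<^sub>2))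
          - (sin \<theta>\<^sub>1 *\<^sub>R flux_x \<gamma> (U \<theta>\<^sub>1) - cos \<theta>\<^sub>1 *\<^sub>R flux_y \<gamma> (U \<theta>\<^sub>1))
        = (LINT \<eta>:{\<theta>\<^sub>1..\<theta>\<^sub>2}|lebesgue.
             cos \<eta> *\<^sub>R flux_x \<gamma> (U \<eta>) + sin \<eta> *\<^sub>R flux_y \<gamma> (U \<eta>))) \<and>
     (\<forall>\<theta>\<^sub>1 \<theta>\<^sub>2. \<theta>\<^sub>1 < \<theta>\<^sub>2 \<longrightarrow>
        (sin \<theta>\<^sub>2 * entropy_flux_x \<gamma> c\<^sub>v S\<^sub>0 (U \<theta>\<^sub>2)
            - cos \<theta>\<^sub>2 * entropy_flux_y \<gamma> c\<^sub>v S\<^sub>0 (U \<theta>\<^sub>2))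
          - (sin \<theta>\<^sub>1 * entropy_flux_x \<gamma> c\<^sub>v S\<^sub>0 (U \<theta>\<^sub>1)
            - cos \<theta>\<^sub>1 * entropy_flux_y \<gamma> c\<^sub>v S\<^sub>0 (U \<theta>\<^sub>1))
        \<le> (LINT \<eta>:{\<theta>\<^sub>1..\<theta>\<^sub>2}|lebesgue.
             cos \<eta> * entropy_flux_x \<gamma> c\<^sub>v S\<^sub>0 (U \<eta>)
             + sin \<eta> * entropy_flux_y \<gamma> c\<^sub>v S\<^sub>0 (U \<eta>)))"

definition no_stagnation_points :: "(real \<Rightarrow> state) \<Rightarrow> bool" where
  "no_stagnation_points U \<longleftrightarrow> (\<forall>\<theta>. (velx (U \<theta>), vely (U \<theta>)) \<noteq> (0, 0))"

definition right_continuous :: "(real \<Rightarrow> state) \<Rightarrow> bool" where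
  "right_continuous U \<longleftrightarrow> (\<forall>\<theta>. continuous (at_right \<theta>) U)"

definition normal_vel :: "(real \<Rightarrow> state) \<Rightarrow> real \<Rightarrow> real" where
  "normal_vel U \<theta> = velx (U \<theta>) * sin \<theta> - vely (U \<theta>) * cos \<theta>"

definition tang_vel :: "(real \<Rightarrow> state) \<Rightarrow> real \<Rightarrow> real" where
  "tang_vel U \<theta> = velx (U \<theta>) * cos \<theta> + vely (U \<theta>) * sin \<theta>"

definition forward_shock :: "(real \<Rightarrow> state) \<Rightarrow> real \<Rightarrow> bool" where
  "forward_shock U \<theta>\<^sub>0 \<longleftrightarrow>
     \<not> isCont U \<theta>\<^sub>0 \<and> (\<forall>\<^sub>F \<theta> in nhds \<theta>\<^sub>0. normal_vel U \<theta> > 0)"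

definition backward_shock :: "(real \<Rightarrow> state) \<Rightarrow> real \<Rightarrow> bool" where
  "backward_shock U \<theta>\<^sub>0 \<longleftrightarrow>
     \<not> isCont U \<theta>\<^sub>0 \<and> (\<forall>\<^sub>F \<theta> in nhds \<theta>\<^sub>0. normal_vel U \<theta> < 0)"

definition shock :: "(real \<Rightarrow> state) \<Rightarrow> real \<Rightarrow> bool" where
  "shock U \<theta>\<^sub>0 \<longleftrightarrow> forward_shock U \<theta>\<^sub>0 \<or> backward_shock U \<theta>\<^sub>0"

definition normal_shock :: "(real \<Rightarrow> state) \<Rightarrow> real \<Rightarrow> bool" where
  "normal_shock U \<theta>\<^sub>0 \<longleftrightarrow> shock U \<theta>\<^sub>0 \<and> tang_vel U \<theta>\<^sub>0 = 0"

text \<open>\<open>[a, b]\<close> is one of the intervals \<open>[\<theta>\<^sub>i, \<theta>\<^sub>i\<^sub>+\<^sub>1]\<close> between consecutive zeros of the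
  \<open>2\<pi>\<close>-periodic function \<open>normal_vel U\<close>, with left end point in \<open>[0, 2\<pi>[\<close>.  For the
  last zero in \<open>[0, 2\<pi>[\<close> the right end point is the first one shifted by \<open>2\<pi>\<close>,
  so \<open>b\<close> may exceed \<open>2\<pi>\<close>.\<close>

definition sector :: "(real \<Rightarrow> state) \<Rightarrow> real \<Rightarrow> real \<Rightarrow> bool" where
  "sector U a b \<longleftrightarrow> a \<in> {0..<2 * pi} \<and> a < b \<and>
     normal_vel U a = 0 \<and> normal_vel U b = 0 \<and> (\<forall>\<theta>\<in>{a<..<b}. normal_vel U \<theta> \<noteq> 0)"

definition forward_sector :: "(real \<Rightarrow> state) \<Rightarrow> real \<Rightarrow> real \<Rightarrow> bool" where
  "forward_sector U a b \<longleftrightarrow> sector U a b \<and> (\<forall>\<theta>\<in>{a..b}. normal_vel U \<theta> \<ge> 0)"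

definition backward_sector :: "(real \<Rightarrow> state) \<Rightarrow> real \<Rightarrow> real \<Rightarrow> bool" where
  "backward_sector U a b \<longleftrightarrow> sector U a b \<and> (\<forall>\<theta>\<in>{a..b}. normal_vel U \<theta> \<le> 0)"

text \<open>The point \<open>\<theta>\<close> with an overline: the zero of \<open>L\<close> inside the sector \<open>[a, b]\<close>.
  That it exists and is unique is a property of entropy solutions; it is not assumed.\<close>

definition theta_bar :: "(real \<Rightarrow> state) \<Rightarrow> real \<Rightarrow> real \<Rightarrow> real" where
  "theta_bar U a b = (THE \<theta>. \<theta> \<in> {a<..<b} \<and> tang_vel U \<theta> = 0)"

text \<open>Expansion waves \<open>[\<alpha>, \<beta>]\<close> in the sector \<open>[a, b]\<close>.\<close>

definition forward_expansion_wave ::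
    "real \<Rightarrow> (real \<Rightarrow> state) \<Rightarrow> real \<Rightarrow> real \<Rightarrow> real \<Rightarrow> real \<Rightarrow> bool" where
  "forward_expansion_wave \<gamma> U a b \<alpha> \<beta> \<longleftrightarrow>
     a \<le> \<alpha> \<and> \<alpha> < \<beta> \<and> \<beta> \<le> theta_bar U a b \<and>
     (\<forall>\<theta>\<in>{\<alpha>..\<beta>}. normal_vel U \<theta> = sound_speed \<gamma> (U \<theta>) \<and> tang_vel U \<theta> \<ge> 0)"

definition backward_expansion_wave ::
    "real \<Rightarrow> (real \<Rightarrow> state) \<Rightarrow> real \<Rightarrow> real \<Rightarrow> real \<Rightarrow> real \<Rightarrow> bool" where
  "backward_expansion_wave \<gamma> U a b \<alpha> \<beta> \<longleftrightarrow>
     theta_bar U a b \<le> \<alpha> \<and> \<alpha> < \<beta> \<and> \<beta> \<le> b \<and>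
     (\<forall>\<theta>\<in>{\<alpha>..\<beta>}. normal_vel U \<theta> = - sound_speed \<gamma> (U \<theta>) \<and> tang_vel U \<theta> \<ge> 0)"

definition exactly_one :: "bool list \<Rightarrow> bool" where
  "exactly_one Ps \<longleftrightarrow> (\<exists>!i. i < length Ps \<and> Ps ! i)"

end

theory Submission
  imports Defs
begin

text \<open>Write \<open>N\<close> and \<open>L\<close> for the velocity components normal and tangential to the ray at
  angle \<open>\<theta>\<close>, and suppose \<open>N > 0\<close> between two consecutive zeros \<open>a < b\<close> of \<open>N\<close>.  The conservation
  laws make the mass, momentum and energy fluxes through the ray Lipschitz in \<open>\<theta>\<close>.  Dividing by
  the mass flux, the tangential balance becomes \<open>L' = - N\<close> and the energy balance says that the
  total enthalpy is constant.  What is left is the balance of normal momentum, which is a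
  quadratic equation \<open>N\<^sup>2 - M N + P = 0\<close> with continuous coefficients
  (\<open>nsum\<close> and \<open>crit\<close>).  So at every angle \<open>N\<close> is one of two continuous roots, the
  smaller one being subsonic and the larger one supersonic; they coincide exactly when \<open>N = c\<close>.
  A discontinuity of \<open>U\<close> is a switch from one root to the other.

  As long as \<open>N\<close> stays on one of the roots and \<open>N \<noteq> c\<close>, differentiating the quadratic equation
  gives \<open>N' = L\<close>.  Together with \<open>L' = - N\<close> this says that the Cartesian velocity is constant, and
  then density and pressure are constant too (\<open>constant_between\<close>).  Hence \<open>U\<close> can only vary
  at jumps and where \<open>N = c\<close>.

  The remaining question is in which order the subsonic, sonic and supersonic angles occur on
  \<open>]a, m]\<close>, where \<open>m\<close> is the zero of \<open>L\<close>.  Near \<open>a\<close> the flow is subsonic because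
  \<open>N\<close> tends to zero.  Since \<open>L > 0\<close> to the left of \<open>m\<close>, the quantity \<open>N\<^sup>2 - P\<close> is strictly
  increasing along every constant state (\<open>excess_increasing\<close>): supersonic flow moves
  away from the sonic line as \<open>\<theta>\<close> grows, and subsonic flow moves away from it as \<open>\<theta>\<close> decreases.
  Supersonic flow could therefore only end in a jump down to the subsonic root.  But the
  entropy inequality makes the specific entropy nonincreasing in \<open>\<theta>\<close> wherever \<open>L \<ge> 0\<close>
  (\<open>entropy_antimono\<close>), whereas at equal fluxes the subsonic root has the larger
  entropy (\<open>branch_entropy_less\<close>).  So the subsonic angles form an initial segment of
  \<open>]a, m]\<close>, the supersonic ones a final segment, and the flow is sonic in between.  If the two
  roots differ where the subsonic segment ends, there is a shock, inside or at \<open>m\<close>; if they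
  agree there, an expansion wave follows, or a single sonic point which the constant state
  crosses smoothly (\<open>alternatives_exhaustive\<close>).  The alternatives exclude each other
  because \<open>N - c\<close> vanishes on an expansion wave, while in a constant state \<open>c\<close> is constant and
  \<open>N' = L > 0\<close>.

  A backward sector is turned into a forward one by reflection in the horizontal axis.  The
  reflection turns right-continuous functions into left-continuous ones, so the result for
  forward flow is first proved for either choice of the values at the jumps, in a form in which the
  last alternative excludes a shock at \<open>m\<close>.  Right continuity then shows that in a forward sector this exclusion
  is automatic.

  None of the functions involved is known to be differentiable at the outset, since \<open>U\<close> may
  jump; the fluxes are merely primitives of bounded measurable functions.  The product and
  quotient rules for such primitives come from one remark: a function whose increments are
  bounded by the square of the step is constant.\<close>

section \<open>Primitives of bounded measurable functions\<close>

definition bounded_primitive_on :: "real \<Rightarrow> real \<Rightarrow> (real \<Rightarrow> real) \<Rightarrow> (real \<Rightarrow> real) \<Rightarrow> bool" where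
  "bounded_primitive_on x y A f \<longleftrightarrow>
     f \<in> borel_measurable (lebesgue_on {x..y}) \<and> bounded (f ` {x..y}) \<and>
     (\<forall>s t. x \<le> s \<longrightarrow> s \<le> t \<longrightarrow> t \<le> y \<longrightarrow> (f has_integral A t - A s) {s..t})"

text \<open>Cutting \<open>[x, y]\<close> into \<open>n\<close> equal pieces bounds the total increment by \<open>C (y - x)\<^sup>2 / n\<close>.  All rules of
  calculus for bounded primitives, and the monotonicity of the entropy, rest on this.\<close>

lemma quadratic_defect_imp_antimono:
  fixes f :: "real \<Rightarrow> real"
  assumes "\<And>s t. x \<le> s \<Longrightarrow> s \<le> t \<Longrightarrow> t \<le> y \<Longrightarrow> f t - f s \<le> C * (t - s)\<^sup>2"
    and "x \<le> y"
  shows "f y \<le> f x"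
proof (rule ccontr)
  assume "\<not> f y \<le> f x"
  then have pos: "f y - f x > 0" by simp
  have step: "f y - f x \<le> C * (y - x)\<^sup>2 / real (Suc n)" for n
  proof -
    define h where "h = (y - x) / real (Suc n)"
    have h: "h \<ge> 0" "real (Suc n) * h = y - x" using assms(2) by (auto simp: h_def)
    have "f (x + real k * h) - f x \<le> real k * (C * h\<^sup>2)" if "k \<le> Suc n" for k
      using that
    proof (induction k)
      case (Suc k)
      have "real (Suc k) * h \<le> real (Suc n) * h"
        using Suc.prems h(1) by (intro mult_right_mono) auto
      then have "x + real (Suc k) * h \<le> y" using h(2) by linarith
      then have "f (x + real (Suc k) * h) - f (x + real k * h)
          \<le> C * ((x + real (Suc k) * h) - (x + real k * h))\<^sup>2"
        using h(1) by (intro assms(1)) (auto simp: algebra_simps)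
      then have "f (x + real (Suc k) * h) - f (x + real k * h) \<le> C * h\<^sup>2"
        by (simp add: algebra_simps)
      then show ?case using Suc by (simp add: algebra_simps)
    qed simp
    from this[of "Suc n"] h(2) have "f y - f x \<le> real (Suc n) * (C * h\<^sup>2)" by simp
    also have "\<dots> = C * (real (Suc n) * h)\<^sup>2 / real (Suc n)"
      by (simp add: power2_eq_square divide_simps del: of_nat_Suc)
    finally show ?thesis using h(2) by simp
  qed
  have "(\<lambda>n. C * (y - x)\<^sup>2 * inverse (real (Suc n))) \<longlonglongrightarrow> C * (y - x)\<^sup>2 * 0"
    by (intro tendsto_mult_left LIMSEQ_inverse_real_of_nat)
  then have "f y - f x \<le> C * (y - x)\<^sup>2 * 0"
    by (rule tendsto_lowerbound) (use step in \<open>auto simp: divide_inverse\<close>)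
  then show False using pos by simp
qed

lemma bounded_primitive_on_has_integral:
  "bounded_primitive_on x y A f \<Longrightarrow> x \<le> s \<Longrightarrow> s \<le> t \<Longrightarrow> t \<le> y \<Longrightarrow>
     (f has_integral A t - A s) {s..t}"
  by (simp add: bounded_primitive_on_def)

lemma bounded_measurable_integrable_on:
  fixes f :: "real \<Rightarrow> real"
  assumes "f \<in> borel_measurable (lebesgue_on {x..y})" "bounded (f ` {x..y})" "x \<le> s" "t \<le> y"
  shows "f integrable_on {s..t}"
proof -
  obtain C where C: "\<And>z. z \<in> {x..y} \<Longrightarrow> \<bar>f z\<bar> \<le> C"
    using assms(2) by (fastforce simp: bounded_iff)
  have "f integrable_on {x..y}"
    by (rule measurable_bounded_by_integrable_imp_integrable[where g = "\<lambda>_. C"])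
      (use assms(1) C in \<open>auto simp: integrable_const_ivl\<close>)
  then show ?thesis
    by (rule integrable_on_subinterval) (use assms(3,4) in auto)
qed

lemma has_integral_abs_le:
  fixes f :: "real \<Rightarrow> real"
  assumes "(f has_integral I) {s..t}" "s \<le> t" "\<And>z. z \<in> {s..t} \<Longrightarrow> \<bar>f z\<bar> \<le> B"
  shows "\<bar>I\<bar> \<le> B * (t - s)"
proof -
  have "0 \<le> B" using assms(2) assms(3)[of s] by auto
  then show ?thesis
    using has_integral_bound_real[OF _ finite.emptyI assms(1), of B] assms(2,3) by auto
qed

lemma bounded_primitive_on_lipschitz:
  assumes "bounded_primitive_on x y A f"
  obtains C where "C \<ge> 0" "\<And>s t. s \<in> {x..y} \<Longrightarrow> t \<in> {x..y} \<Longrightarrow> \<bar>A t - A s\<bar> \<le> C * \<bar>t - s\<bar>"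
    "\<And>s. s \<in> {x..y} \<Longrightarrow> \<bar>f s\<bar> \<le> C"
proof -
  obtain C where C: "C > 0" "\<And>z. z \<in> {x..y} \<Longrightarrow> \<bar>f z\<bar> \<le> C"
    using assms by (auto simp: bounded_primitive_on_def bounded_pos)
  have *: "\<bar>A t - A s\<bar> \<le> C * (t - s)" if "x \<le> s" "s \<le> t" "t \<le> y" for s t
    using has_integral_abs_le[OF bounded_primitive_on_has_integral[OF assms that]] that C(2) by auto
  have "\<bar>A t - A s\<bar> \<le> C * \<bar>t - s\<bar>" if "s \<in> {x..y}" "t \<in> {x..y}" for s t
    using *[of s t] *[of t s] that by (cases "s \<le> t") (auto simp: abs_minus_commute)
  with C show ?thesis by (intro that[of C]) auto
qed

lemma bounded_primitive_on_continuous: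
  assumes "bounded_primitive_on x y A f"
  shows "continuous_on {x..y} A"
proof -
  obtain C where C: "C \<ge> 0" "\<And>s t. s \<in> {x..y} \<Longrightarrow> t \<in> {x..y} \<Longrightarrow> \<bar>A t - A s\<bar> \<le> C * \<bar>t - s\<bar>"
    using bounded_primitive_on_lipschitz[OF assms] by metis
  then have "C-lipschitz_on {x..y} A"
    by (auto simp: lipschitz_on_def dist_real_def)
  then show ?thesis by (rule lipschitz_on_continuous_on)
qed

lemma bounded_primitive_on_borel:
  assumes "bounded_primitive_on x y A f"
  shows "A \<in> borel_measurable (lebesgue_on {x..y})" "bounded (A ` {x..y})"
  using bounded_primitive_on_continuous[OF assms]
  by (auto intro: continuous_imp_measurable_on_sets_lebesgue compact_imp_bounded compact_continuous_image)

text \<open>It suffices to match the integral up to a quadratic error, for then the difference of \<open>A\<close> and the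
  indefinite integral of \<open>f\<close> has quadratic increments in both directions.\<close>

lemma bounded_primitive_onI:
  assumes f: "f \<in> borel_measurable (lebesgue_on {x..y})" "bounded (f ` {x..y})"
    and C: "\<And>s t. x \<le> s \<Longrightarrow> s \<le> t \<Longrightarrow> t \<le> y \<Longrightarrow>
      \<exists>D. (f has_integral D) {s..t} \<and> \<bar>A t - A s - D\<bar> \<le> C * (t - s)\<^sup>2"
  shows "bounded_primitive_on x y A f"
proof -
  have int: "f integrable_on {s..t}" if "x \<le> s" "t \<le> y" for s t
    using bounded_measurable_integrable_on[OF f that] .
  define B where "B t = A t - integral {x..t} f" for t
  have B: "\<bar>B t - B s\<bar> \<le> C * (t - s)\<^sup>2" if st: "x \<le> s" "s \<le> t" "t \<le> y" for s t
  proof -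
    have "integral {x..s} f + integral {s..t} f = integral {x..t} f"
      using st by (intro Henstock_Kurzweil_Integration.integral_combine int) auto
    moreover obtain D where "(f has_integral D) {s..t}" "\<bar>A t - A s - D\<bar> \<le> C * (t - s)\<^sup>2"
      using C[OF st] by blast
    ultimately show ?thesis by (auto simp: B_def integral_unique algebra_simps)
  qed
  have "A t - A s = integral {s..t} f" if st: "x \<le> s" "s \<le> t" "t \<le> y" for s t
  proof -
    have d: "B v - B u \<le> C * (v - u)\<^sup>2" "- B v - - B u \<le> C * (v - u)\<^sup>2"
      if "s \<le> u" "u \<le> v" "v \<le> t" for u v
      using B[of u v] that st by linarith+
    have "B t \<le> B s" by (rule quadratic_defect_imp_antimono[OF d(1) st(2)])
    moreover have "- B t \<le> - B s" by (rule quadratic_defect_imp_antimono[OF d(2) st(2)])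
    moreover have "integral {x..s} f + integral {s..t} f = integral {x..t} f"
      using st by (intro Henstock_Kurzweil_Integration.integral_combine int) auto
    ultimately show ?thesis by (simp add: B_def)
  qed
  with f int show ?thesis
    unfolding bounded_primitive_on_def by (auto simp: has_integral_integral[symmetric] )
qed

lemma bounded_primitive_on_cong:
  assumes "bounded_primitive_on x y A f" "\<And>z. z \<in> {x..y} \<Longrightarrow> A z = B z" "\<And>z. z \<in> {x..y} \<Longrightarrow> f z = g z"
  shows "bounded_primitive_on x y B g"
proof -
  have "g \<in> borel_measurable (lebesgue_on {x..y})"
    using assms(1,3) by (subst measurable_cong[of _ g f]) (auto simp: bounded_primitive_on_def)
  moreover have "g ` {x..y} = f ` {x..y}" using assms(3) by auto
  moreover have "(g has_integral B t - B s) {s..t}" if "x \<le> s" "s \<le> t" "t \<le> y" for s t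
    using bounded_primitive_on_has_integral[OF assms(1) that] assms(2)[of s] assms(2)[of t] that
    by (subst has_integral_cong[of _ g f]) (auto simp: assms(3))
  ultimately show ?thesis using assms(1) by (auto simp: bounded_primitive_on_def)
qed

lemma bounded_primitive_on_C1:
  assumes "\<And>z. z \<in> {x..y} \<Longrightarrow> (A has_real_derivative f z) (at z)" "continuous_on {x..y} f"
  shows "bounded_primitive_on x y A f"
proof -
  have "(f has_integral A t - A s) {s..t}" if "x \<le> s" "s \<le> t" "t \<le> y" for s t
    using that assms(1)
    by (intro fundamental_theorem_of_calculus)
      (auto simp flip: has_real_derivative_iff_has_vector_derivative intro: has_field_derivative_at_within)
  then show ?thesis using assms(2)
    by (auto simp: bounded_primitive_on_def intro: continuous_imp_measurable_on_sets_lebesgue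
        compact_imp_bounded compact_continuous_image)
qed

lemma bounded_times:
  fixes f g :: "real \<Rightarrow> real"
  assumes "bounded (f ` S)" "bounded (g ` S)"
  shows "bounded ((\<lambda>z. f z * g z) ` S)"
proof -
  obtain c d where "\<And>z. z \<in> S \<Longrightarrow> \<bar>f z\<bar> \<le> c" "\<And>z. z \<in> S \<Longrightarrow> \<bar>g z\<bar> \<le> d"
    using assms by (auto simp: bounded_iff)
  then have "\<bar>f z * g z\<bar> \<le> c * d" if "z \<in> S" for z
    using that by (auto simp: abs_mult intro!: mult_mono order_trans[OF abs_ge_zero])
  then show ?thesis by (auto simp: bounded_iff)
qed

lemma bounded_primitive_on_add:
  assumes "bounded_primitive_on x y A f" "bounded_primitive_on x y B g"
  shows "bounded_primitive_on x y (\<lambda>z. A z + B z) (\<lambda>z. f z + g z)"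
proof -
  have "((\<lambda>z. f z + g z) has_integral (A t + B t) - (A s + B s)) {s..t}"
    if "x \<le> s" "s \<le> t" "t \<le> y" for s t
    using has_integral_add[OF bounded_primitive_on_has_integral[OF assms(1) that]
        bounded_primitive_on_has_integral[OF assms(2) that]] by (simp add: algebra_simps)
  then show ?thesis using assms
    by (auto simp: bounded_primitive_on_def intro: bounded_plus_comp)
qed

text \<open>Freezing \<open>B\<close> at the right and \<open>A\<close> at the left end point gives an exact formula for the increment of
  the product; as \<open>A\<close> and \<open>B\<close> are Lipschitz, unfreezing them costs only a quadratic error.\<close>

lemma bounded_primitive_on_mult:
  assumes "bounded_primitive_on x y A f" "bounded_primitive_on x y B g"
  shows "bounded_primitive_on x y (\<lambda>z. A z * B z) (\<lambda>z. f z * B z + A z * g z)"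
proof -
  obtain a where a: "a \<ge> 0" "\<And>s t. s \<in> {x..y} \<Longrightarrow> t \<in> {x..y} \<Longrightarrow> \<bar>A t - A s\<bar> \<le> a * \<bar>t - s\<bar>"
    "\<And>s. s \<in> {x..y} \<Longrightarrow> \<bar>f s\<bar> \<le> a"
    using bounded_primitive_on_lipschitz[OF assms(1)] by metis
  obtain b where b: "b \<ge> 0" "\<And>s t. s \<in> {x..y} \<Longrightarrow> t \<in> {x..y} \<Longrightarrow> \<bar>B t - B s\<bar> \<le> b * \<bar>t - s\<bar>"
    "\<And>s. s \<in> {x..y} \<Longrightarrow> \<bar>g s\<bar> \<le> b"
    using bounded_primitive_on_lipschitz[OF assms(2)] by metis
  let ?h = "\<lambda>z. f z * B z + A z * g z"
  have h: "?h \<in> borel_measurable (lebesgue_on {x..y})" "bounded (?h ` {x..y})"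
    using assms bounded_primitive_on_borel[OF assms(1)] bounded_primitive_on_borel[OF assms(2)]
    by (auto simp: bounded_primitive_on_def intro!: bounded_plus_comp bounded_times)
  show ?thesis
  proof (rule bounded_primitive_onI[OF h, where C = "2 * a * b"])
    fix s t assume st: "x \<le> s" "s \<le> t" "t \<le> y"
    obtain D where D: "(?h has_integral D) {s..t}"
      using bounded_measurable_integrable_on[OF h st(1,3)] by blast
    have int: "((\<lambda>z. f z * B t + A s * g z - ?h z) has_integral
        (A t - A s) * B t + A s * (B t - B s) - D) {s..t}"
      using bounded_primitive_on_has_integral[OF assms(1) st] bounded_primitive_on_has_integral[OF assms(2) st]
      by (intro has_integral_diff has_integral_add has_integral_mult_left has_integral_mult_right D)
    moreover have "(A t - A s) * B t + A s * (B t - B s) - D = A t * B t - A s * B s - D"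
      by (simp add: algebra_simps)
    moreover have bd: "\<bar>f z * B t + A s * g z - ?h z\<bar> \<le> 2 * a * b * (t - s)" if z: "z \<in> {s..t}" for z
    proof -
      have "\<bar>f z * (B t - B z)\<bar> \<le> a * (b * (t - s))"
        unfolding abs_mult
      proof (rule mult_mono)
        have "b * \<bar>t - z\<bar> \<le> b * (t - s)" using z b(1) by (intro mult_left_mono) auto
        then show "\<bar>B t - B z\<bar> \<le> b * (t - s)" using b(2)[of z t] st z by auto
      qed (use a b st z in auto)
      moreover have "\<bar>(A s - A z) * g z\<bar> \<le> a * (t - s) * b"
        unfolding abs_mult
      proof (rule mult_mono)
        have "a * \<bar>s - z\<bar> \<le> a * (t - s)" using z a(1) by (intro mult_left_mono) auto
        then show "\<bar>A s - A z\<bar> \<le> a * (t - s)" using a(2)[of z s] st z by auto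
      qed (use a b st z in auto)
      ultimately have "\<bar>f z * (B t - B z) + (A s - A z) * g z\<bar> \<le> a * (b * (t - s)) + a * (t - s) * b"
        by (rule order_trans[OF abs_triangle_ineq add_mono])
      also have "\<dots> = 2 * a * b * (t - s)" by (simp add: algebra_simps)
      also have "f z * (B t - B z) + (A s - A z) * g z = f z * B t + A s * g z - ?h z"
        by (simp add: algebra_simps)
      finally show ?thesis .
    qed
    ultimately have "\<bar>A t * B t - A s * B s - D\<bar> \<le> 2 * a * b * (t - s) * (t - s)"
      using has_integral_abs_le[OF int st(2) bd] by simp
    with D show "\<exists>D. (?h has_integral D) {s..t} \<and> \<bar>A t * B t - A s * B s - D\<bar> \<le> 2 * a * b * (t - s)\<^sup>2"
      by (auto simp: power2_eq_square algebra_simps)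
  qed
qed

lemma bounded_primitive_on_const: "bounded_primitive_on x y (\<lambda>_. c) (\<lambda>_. 0)"
  by (rule bounded_primitive_on_C1) auto

lemma bounded_primitive_on_cmult:
  assumes "bounded_primitive_on x y A f"
  shows "bounded_primitive_on x y (\<lambda>z. c * A z) (\<lambda>z. c * f z)"
  by (rule bounded_primitive_on_cong[OF bounded_primitive_on_mult[OF bounded_primitive_on_const[of x y c] assms]]) auto

lemma bounded_primitive_on_diff:
  assumes "bounded_primitive_on x y A f" "bounded_primitive_on x y B g"
  shows "bounded_primitive_on x y (\<lambda>z. A z - B z) (\<lambda>z. f z - g z)"
  by (rule bounded_primitive_on_cong[OF bounded_primitive_on_add[OF assms(1)
        bounded_primitive_on_cmult[OF assms(2), of "-1"]]]) auto

text \<open>The increment of \<open>1 / B\<close> over \<open>[s, t]\<close> is the integral of \<open>- g / (B s B t)\<close>, which differs from that of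
  \<open>- g / B\<^sup>2\<close> by a quadratic error.\<close>

lemma bounded_primitive_on_divide:
  assumes "bounded_primitive_on x y A f" "bounded_primitive_on x y B g"
    and nz: "\<And>z. z \<in> {x..y} \<Longrightarrow> B z \<noteq> 0"
  shows "bounded_primitive_on x y (\<lambda>z. A z / B z) (\<lambda>z. (f z * B z - A z * g z) / (B z)\<^sup>2)"
proof -
  have cont: "continuous_on {x..y} (\<lambda>z. inverse (B z))"
    using bounded_primitive_on_continuous[OF assms(2)] nz by (intro continuous_on_inverse) auto
  then have "bounded ((\<lambda>z. inverse (B z)) ` {x..y})"
    by (auto intro: compact_imp_bounded compact_continuous_image)
  then obtain c where c: "c > 0" "\<And>z. z \<in> {x..y} \<Longrightarrow> \<bar>inverse (B z)\<bar> \<le> c"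
    by (auto simp: bounded_pos)
  obtain b where b: "b \<ge> 0" "\<And>s t. s \<in> {x..y} \<Longrightarrow> t \<in> {x..y} \<Longrightarrow> \<bar>B t - B s\<bar> \<le> b * \<bar>t - s\<bar>"
    "\<And>s. s \<in> {x..y} \<Longrightarrow> \<bar>g s\<bar> \<le> b"
    using bounded_primitive_on_lipschitz[OF assms(2)] by metis
  let ?h = "\<lambda>z. - (g z * (inverse (B z) * inverse (B z)))"
  have h: "?h \<in> borel_measurable (lebesgue_on {x..y})" "bounded (?h ` {x..y})"
    using assms(2) continuous_imp_measurable_on_sets_lebesgue[OF cont] \<open>bounded ((\<lambda>z. inverse (B z)) ` {x..y})\<close>
    by (auto simp: bounded_primitive_on_def intro!: bounded_minus_comp bounded_times)
  have "bounded_primitive_on x y (\<lambda>z. inverse (B z)) ?h"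
  proof (rule bounded_primitive_onI[OF h, where C = "2 * b * b * c ^ 3"])
    fix s t assume st: "x \<le> s" "s \<le> t" "t \<le> y"
    obtain D where D: "(?h has_integral D) {s..t}"
      using bounded_measurable_integrable_on[OF h st(1,3)] by blast
    let ?p = "inverse (B s) * inverse (B t)"
    have int: "((\<lambda>z. - ?p * g z - ?h z) has_integral - ?p * (B t - B s) - D) {s..t}"
      using bounded_primitive_on_has_integral[OF assms(2) st]
      by (intro has_integral_diff has_integral_mult_right D)
    moreover have "- ?p * (B t - B s) = inverse (B t) - inverse (B s)"
      using nz[of s] nz[of t] st by (simp add: field_simps)
    moreover have bd: "\<bar>- ?p * g z - ?h z\<bar> \<le> 2 * b * b * c ^ 3 * (t - s)" if z: "z \<in> {s..t}" for z
    proof -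
      have *: "\<bar>inverse (B z) - inverse (B w)\<bar> \<le> c * c * (b * (t - s))" if w: "w \<in> {s..t}" for w
      proof -
        have "inverse (B z) - inverse (B w) = inverse (B z) * inverse (B w) * (B w - B z)"
          using nz[of z] nz[of w] st z w by (simp add: field_simps)
        moreover have "\<bar>w - z\<bar> \<le> t - s" using z w by auto
        then have "\<bar>B w - B z\<bar> \<le> b * (t - s)"
          using b(2)[of z w] mult_left_mono[of "\<bar>w - z\<bar>" "t - s" b] b(1) z w st
          by (auto intro: order_trans)
        moreover have "\<bar>inverse (B z)\<bar> \<le> c" "\<bar>inverse (B w)\<bar> \<le> c" using c(2) z w st by auto
        ultimately show ?thesis
          unfolding \<open>inverse (B z) - inverse (B w) = _\<close> abs_mult using c(1) by (intro mult_mono) auto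
      qed
      let ?X = "inverse (B z) * (inverse (B z) - inverse (B s))"
      let ?Y = "inverse (B s) * (inverse (B z) - inverse (B t))"
      have eq: "- ?p * g z - ?h z = g z * (?X + ?Y)" by (simp add: algebra_simps)
      have "\<bar>?X\<bar> \<le> c * (c * c * (b * (t - s)))"
        unfolding abs_mult using *[of s] c(1) c(2)[of z] z st by (intro mult_mono) auto
      moreover have "\<bar>?Y\<bar> \<le> c * (c * c * (b * (t - s)))"
        unfolding abs_mult using *[of t] c(1) c(2)[of s] z st by (intro mult_mono) auto
      ultimately have "\<bar>?X + ?Y\<bar> \<le> c * (c * c * (b * (t - s))) + c * (c * c * (b * (t - s)))"
        by (rule order_trans[OF abs_triangle_ineq add_mono])
      then have "\<bar>?X + ?Y\<bar> \<le> 2 * (c * (c * c * (b * (t - s))))"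
        by (simp only: mult_2)
      then have "\<bar>- ?p * g z - ?h z\<bar> \<le> b * (2 * (c * (c * c * (b * (t - s)))))"
        unfolding eq abs_mult[of "g z"] using b(1) b(3)[of z] z st by (intro mult_mono) auto
      then show ?thesis by (simp add: power3_eq_cube algebra_simps)
    qed
    ultimately have "\<bar>inverse (B t) - inverse (B s) - D\<bar> \<le> 2 * b * b * c ^ 3 * (t - s) * (t - s)"
      using has_integral_abs_le[OF int st(2) bd] by simp
    with D show "\<exists>D. (?h has_integral D) {s..t} \<and>
        \<bar>inverse (B t) - inverse (B s) - D\<bar> \<le> 2 * b * b * c ^ 3 * (t - s)\<^sup>2"
      by (auto simp: power2_eq_square algebra_simps)
  qed
  from bounded_primitive_on_mult[OF assms(1) this] show ?thesis
    by (rule bounded_primitive_on_cong) (simp_all add: nz divide_inverse power2_eq_square algebra_simps)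
qed

text \<open>Where the integrand happens to be continuous, the primitive has a classical derivative.\<close>

lemma bounded_primitive_on_has_real_derivative:
  assumes "bounded_primitive_on x y A f" "x < z" "z < y" "isCont f z"
  shows "(A has_real_derivative f z) (at z)"
proof -
  have f: "f integrable_on {x..y}"
    using bounded_primitive_on_has_integral[OF assms(1), of x y] assms(2,3)
    by (intro has_integral_integrable) auto
  have "((\<lambda>u. integral {x..u} f) has_vector_derivative f z) (at z within {x..y} - {})"
    by (rule integral_has_vector_derivative_continuous_at[OF f])
      (use assms(2-4) in \<open>auto intro: continuous_at_imp_continuous_at_within\<close>)
  then have "((\<lambda>u. integral {x..u} f) has_vector_derivative f z) (at z within {x..y})" by simp
  moreover have eq: "integral {x..u} f = A u - A x" if "u \<in> {x..y}" for u
    using bounded_primitive_on_has_integral[OF assms(1), of x u] that by (auto simp: integral_unique)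
  ultimately have "((\<lambda>u. A u - A x) has_vector_derivative f z) (at z within {x..y})"
    using assms(2,3) by (intro has_vector_derivative_transform[OF _ eq[symmetric]]) auto
  then have "((\<lambda>u. A u - A x) has_real_derivative f z) (at z within {x..y})"
    by (simp add: has_real_derivative_iff_has_vector_derivative)
  then have "((\<lambda>u. A u - A x) has_real_derivative f z) (at z)"
    using assms(2,3) by (subst (asm) at_within_interior) auto
  from DERIV_add[OF this DERIV_const[of "A x"]] show ?thesis by simp
qed

section \<open>The conservation laws in polar components\<close>

lemma borel_measurable_vec_nth [measurable]:
  "(\<lambda>w :: real ^ 'n. w $ i) \<in> borel_measurable borel"
  by (intro borel_measurable_continuous_onI continuous_intros)

lemma borel_measurable_vecI:
  fixes f :: "'a \<Rightarrow> real ^ 'n"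
  assumes "\<And>i. (\<lambda>x. f x $ i) \<in> borel_measurable M"
  shows "f \<in> borel_measurable M"
  unfolding borel_measurable_euclidean_space[of f]
  using assms by (auto simp: Basis_vec_def inner_axis)

lemma density_borel [measurable]: "density \<in> borel_measurable borel"
  unfolding density_def by measurable

lemma velx_borel [measurable]: "velx \<in> borel_measurable borel"
  unfolding velx_def by measurable

lemma vely_borel [measurable]: "vely \<in> borel_measurable borel"
  unfolding vely_def by measurable

lemma energy_borel [measurable]: "energy \<in> borel_measurable borel"
  unfolding energy_def by measurable

lemma pressure_borel [measurable]: "pressure \<gamma> \<in> borel_measurable borel"
  unfolding pressure_def internal_energy_def by measurable

lemma entropy_borel [measurable]: "entropy \<gamma> c\<^sub>v S\<^sub>0 \<in> borel_measurable borel"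
  unfolding entropy_def by measurable

lemma trig_bounded_measurable:
  "bounded (range (sin :: real \<Rightarrow> real))" "bounded (range (cos :: real \<Rightarrow> real))"
  "(sin :: real \<Rightarrow> real) \<in> borel_measurable lebesgue" "(cos :: real \<Rightarrow> real) \<in> borel_measurable lebesgue"
proof -
  have "continuous_on UNIV (sin :: real \<Rightarrow> real)" "continuous_on UNIV (cos :: real \<Rightarrow> real)"
    by (auto intro: continuous_at_imp_continuous_on)
  then show "(sin :: real \<Rightarrow> real) \<in> borel_measurable lebesgue" "(cos :: real \<Rightarrow> real) \<in> borel_measurable lebesgue"
    by (auto intro: borel_measurable_continuous_onI measurable_completion)
qed (auto simp: bounded_iff intro!: exI[of _ 1])

locale steady_flow =
  fixes \<gamma> c\<^sub>v S\<^sub>0 K :: real and U :: "real \<Rightarrow> state"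
  assumes gamma: "\<gamma> > 1" and cv: "c\<^sub>v > 0" and K: "K > 1"
    and solution: "steady_entropy_solution \<gamma> c\<^sub>v S\<^sub>0 K U"
begin

abbreviation "rho \<theta> \<equiv> density (U \<theta>)"
abbreviation "pr \<theta> \<equiv> pressure \<gamma> (U \<theta>)"
abbreviation "u \<theta> \<equiv> velx (U \<theta>)"
abbreviation "v \<theta> \<equiv> vely (U \<theta>)"
abbreviation "N \<equiv> normal_vel U"
abbreviation "L \<equiv> tang_vel U"
abbreviation "S \<theta> \<equiv> entropy \<gamma> c\<^sub>v S\<^sub>0 (U \<theta>)"

lemma U_measurable [measurable]: "U \<in> borel_measurable lebesgue"
  using solution by (simp add: steady_entropy_solution_def)

lemma in_phase_space: "U \<theta> \<in> phase_space K"
  using solution by (simp add: steady_entropy_solution_def)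

text \<open>The phase space keeps density and pressure away from zero and all quantities bounded; this is
  what makes the fluxes Lipschitz.\<close>

lemma density_bounds: "1 / K \<le> rho \<theta>" "rho \<theta> \<le> K" "rho \<theta> > 0"
  using in_phase_space[of \<theta>] K by (auto simp: phase_space_def intro: less_le_trans[of _ "1 / K"])

lemma pressure_bounds: "(\<gamma> - 1) / K\<^sup>2 \<le> pr \<theta>" "pr \<theta> \<le> (\<gamma> - 1) * K\<^sup>2" "pr \<theta> > 0"
proof -
  have e: "1 / K \<le> internal_energy (U \<theta>)" "internal_energy (U \<theta>) \<le> K"
    using in_phase_space[of \<theta>] by (auto simp: phase_space_def)
  have "1 / K * (1 / K) \<le> rho \<theta> * internal_energy (U \<theta>)"
    using e density_bounds[of \<theta>] K by (intro mult_mono) auto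
  then show 1: "(\<gamma> - 1) / K\<^sup>2 \<le> pr \<theta>"
    using mult_left_mono[of "1 / K * (1 / K)" "rho \<theta> * internal_energy (U \<theta>)" "\<gamma> - 1"] gamma
    by (simp add: pressure_def power2_eq_square mult.assoc)
  have "0 \<le> internal_energy (U \<theta>)" using e K by (auto intro: order_trans[of _ "1 / K"])
  then have "rho \<theta> * internal_energy (U \<theta>) \<le> K * K"
    using e density_bounds[of \<theta>] K by (intro mult_mono) auto
  then show "pr \<theta> \<le> (\<gamma> - 1) * K\<^sup>2"
    using mult_left_mono[of "rho \<theta> * internal_energy (U \<theta>)" "K * K" "\<gamma> - 1"] gamma
    by (simp add: pressure_def power2_eq_square mult.assoc)
  show "pr \<theta> > 0" using 1 gamma K by (auto intro: less_le_trans[of _ "(\<gamma> - 1) / K\<^sup>2"])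
qed

lemma velocity_bounds: "\<bar>u \<theta>\<bar> \<le> K\<^sup>2" "\<bar>v \<theta>\<bar> \<le> K\<^sup>2" "\<bar>energy (U \<theta>)\<bar> \<le> K"
proof -
  have *: "\<bar>U \<theta> $ i\<bar> \<le> K" for i
    using component_le_norm_cart[of "U \<theta>" i] in_phase_space[of \<theta>] by (auto simp: phase_space_def)
  then show "\<bar>energy (U \<theta>)\<bar> \<le> K" by (simp add: energy_def)
  have "\<bar>U \<theta> $ i / rho \<theta>\<bar> \<le> K\<^sup>2" for i
  proof -
    have "\<bar>U \<theta> $ i\<bar> / rho \<theta> \<le> K / (1 / K)"
      using *[of i] density_bounds[of \<theta>] K by (intro frac_le) auto
    then show ?thesis using density_bounds[of \<theta>] by (simp add: power2_eq_square abs_divide)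
  qed
  from this[of 2] this[of 3] show "\<bar>u \<theta>\<bar> \<le> K\<^sup>2" "\<bar>v \<theta>\<bar> \<le> K\<^sup>2"
    by (auto simp: velx_def vely_def density_def)
qed

lemma bounded_velocities: "\<bar>N \<theta>\<bar> \<le> 2 * K\<^sup>2" "\<bar>L \<theta>\<bar> \<le> 2 * K\<^sup>2"
proof -
  have *: "\<bar>u \<theta> * a\<bar> \<le> K\<^sup>2 * 1" "\<bar>v \<theta> * a\<bar> \<le> K\<^sup>2 * 1" if "\<bar>a\<bar> \<le> 1" for a
    unfolding abs_mult using velocity_bounds[of \<theta>] that by (intro mult_mono; simp)+
  show "\<bar>N \<theta>\<bar> \<le> 2 * K\<^sup>2" "\<bar>L \<theta>\<bar> \<le> 2 * K\<^sup>2"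
    using *[of "sin \<theta>"] *[of "cos \<theta>"] unfolding normal_vel_def tang_vel_def by auto
qed

lemma velocity_polar:
  "u \<theta> = N \<theta> * sin \<theta> + L \<theta> * cos \<theta>" "v \<theta> = L \<theta> * sin \<theta> - N \<theta> * cos \<theta>"
proof -
  have sc: "cos \<theta> * cos \<theta> = 1 - sin \<theta> * sin \<theta>"
    using sin_cos_squared_add[of \<theta>] by (simp add: power2_eq_square)
  have "N \<theta> * sin \<theta> + L \<theta> * cos \<theta> = u \<theta> * (sin \<theta> * sin \<theta>) + u \<theta> * (cos \<theta> * cos \<theta>)"
    "L \<theta> * sin \<theta> - N \<theta> * cos \<theta> = v \<theta> * (sin \<theta> * sin \<theta>) + v \<theta> * (cos \<theta> * cos \<theta>)"
    by (simp_all add: normal_vel_def tang_vel_def algebra_simps)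
  then show "u \<theta> = N \<theta> * sin \<theta> + L \<theta> * cos \<theta>" "v \<theta> = L \<theta> * sin \<theta> - N \<theta> * cos \<theta>"
    unfolding sc by (simp_all add: algebra_simps)
qed

lemma speed_polar: "(u \<theta>)\<^sup>2 + (v \<theta>)\<^sup>2 = (N \<theta>)\<^sup>2 + (L \<theta>)\<^sup>2"
proof -
  have "(N \<theta>)\<^sup>2 + (L \<theta>)\<^sup>2 = ((u \<theta>)\<^sup>2 + (v \<theta>)\<^sup>2) * ((sin \<theta>)\<^sup>2 + (cos \<theta>)\<^sup>2)"
    by (simp only: normal_vel_def tang_vel_def) algebra
  then show ?thesis by simp
qed

lemma energy_eq: "energy (U \<theta>) = pr \<theta> / (\<gamma> - 1) + rho \<theta> * ((N \<theta>)\<^sup>2 + (L \<theta>)\<^sup>2) / 2"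
proof -
  have "pr \<theta> / (\<gamma> - 1) = rho \<theta> * internal_energy (U \<theta>)"
    using gamma by (simp add: pressure_def)
  also have "\<dots> = energy (U \<theta>) - rho \<theta> * ((N \<theta>)\<^sup>2 + (L \<theta>)\<^sup>2) / 2"
    using density_bounds(3)[of \<theta>]
    by (simp add: internal_energy_def speed_polar right_diff_distrib)
  finally show ?thesis by simp
qed

lemma entropy_alt: "S \<theta> = c\<^sub>v * (ln (pr \<theta>) - \<gamma> * ln (rho \<theta>)) + S\<^sub>0"
  using density_bounds[of \<theta>] pressure_bounds[of \<theta>] by (simp add: entropy_def ln_mult ln_powr)

lemma entropy_bounded: "bounded (range S)"
proof -
  have "\<bar>ln (pr \<theta>)\<bar> \<le> \<bar>ln ((\<gamma> - 1) / K\<^sup>2)\<bar> + \<bar>ln ((\<gamma> - 1) * K\<^sup>2)\<bar>" for \<theta>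
  proof -
    have "ln ((\<gamma> - 1) / K\<^sup>2) \<le> ln (pr \<theta>)" "ln (pr \<theta>) \<le> ln ((\<gamma> - 1) * K\<^sup>2)"
      using pressure_bounds[of \<theta>] gamma K by simp_all
    then show ?thesis by linarith
  qed
  moreover have "\<bar>ln (rho \<theta>)\<bar> \<le> \<bar>ln (1 / K)\<bar> + \<bar>ln K\<bar>" for \<theta>
  proof -
    have "ln (1 / K) \<le> ln (rho \<theta>)" "ln (rho \<theta>) \<le> ln K"
      using density_bounds[of \<theta>] K by (subst ln_le_cancel_iff; simp)+
    then show ?thesis by linarith
  qed
  ultimately have "bounded (range (\<lambda>\<theta>. ln (pr \<theta>)))" "bounded (range (\<lambda>\<theta>. ln (rho \<theta>)))"
    unfolding bounded_iff by auto
  then show ?thesis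
    unfolding entropy_alt
    by (intro bounded_plus_comp bounded_times bounded_minus_comp) auto
qed

lemma bounded_components:
  "bounded (range rho)" "bounded (range pr)" "bounded (range u)" "bounded (range v)"
  "bounded (range (\<lambda>\<theta>. energy (U \<theta>)))" "bounded (range L)" "bounded (range N)"
proof -
  have "\<bar>rho \<theta>\<bar> \<le> K" "\<bar>pr \<theta>\<bar> \<le> (\<gamma> - 1) * K\<^sup>2" for \<theta>
    using density_bounds[of \<theta>] pressure_bounds[of \<theta>] by auto
  then show "bounded (range rho)" "bounded (range pr)" "bounded (range u)" "bounded (range v)"
    "bounded (range (\<lambda>\<theta>. energy (U \<theta>)))" "bounded (range L)" "bounded (range N)"
    unfolding bounded_iff using velocity_bounds bounded_velocities by (auto intro!: exI)
qed

lemma components_measurable [measurable]: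
  "L \<in> borel_measurable lebesgue" "N \<in> borel_measurable lebesgue"
proof -
  note [measurable] = trig_bounded_measurable(3,4)
  show "L \<in> borel_measurable lebesgue" "N \<in> borel_measurable lebesgue"
    unfolding tang_vel_def normal_vel_def by measurable
qed

abbreviation "crossflux \<theta> \<equiv> sin \<theta> *\<^sub>R flux_x \<gamma> (U \<theta>) - cos \<theta> *\<^sub>R flux_y \<gamma> (U \<theta>)"
abbreviation "alongflux \<theta> \<equiv> cos \<theta> *\<^sub>R flux_x \<gamma> (U \<theta>) + sin \<theta> *\<^sub>R flux_y \<gamma> (U \<theta>)"

lemma alongflux_nth:
  "alongflux \<theta> $ 1 = rho \<theta> * L \<theta>"
  "alongflux \<theta> $ 2 = rho \<theta> * u \<theta> * L \<theta> + pr \<theta> * cos \<theta>"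
  "alongflux \<theta> $ 3 = rho \<theta> * v \<theta> * L \<theta> + pr \<theta> * sin \<theta>"
  "alongflux \<theta> $ 4 = L \<theta> * (energy (U \<theta>) + pr \<theta>)"
  by (simp_all add: flux_x_def flux_y_def tang_vel_def Let_def power2_eq_square algebra_simps)

lemma crossflux_nth:
  "crossflux \<theta> $ 1 = rho \<theta> * N \<theta>"
  "crossflux \<theta> $ 2 = rho \<theta> * u \<theta> * N \<theta> + pr \<theta> * sin \<theta>"
  "crossflux \<theta> $ 3 = rho \<theta> * v \<theta> * N \<theta> - pr \<theta> * cos \<theta>"
  "crossflux \<theta> $ 4 = N \<theta> * (energy (U \<theta>) + pr \<theta>)"
  by (simp_all add: flux_x_def flux_y_def normal_vel_def Let_def power2_eq_square algebra_simps)

lemma alongflux_nth_bounded_measurable: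
  "(\<lambda>\<theta>. alongflux \<theta> $ i) \<in> borel_measurable lebesgue" "bounded (range (\<lambda>\<theta>. alongflux \<theta> $ i))"
proof -
  note [measurable] = trig_bounded_measurable(3,4)
  note b = bounded_components trig_bounded_measurable
  have "(\<lambda>\<theta>. alongflux \<theta> $ 1) \<in> borel_measurable lebesgue"
    "(\<lambda>\<theta>. alongflux \<theta> $ 2) \<in> borel_measurable lebesgue"
    "(\<lambda>\<theta>. alongflux \<theta> $ 3) \<in> borel_measurable lebesgue"
    "(\<lambda>\<theta>. alongflux \<theta> $ 4) \<in> borel_measurable lebesgue"
    unfolding alongflux_nth by measurable
  then show "(\<lambda>\<theta>. alongflux \<theta> $ i) \<in> borel_measurable lebesgue"
    using exhaust_4[of i] by (elim disjE; simp only:)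
  have "bounded (range (\<lambda>\<theta>. alongflux \<theta> $ 1))" "bounded (range (\<lambda>\<theta>. alongflux \<theta> $ 2))"
    "bounded (range (\<lambda>\<theta>. alongflux \<theta> $ 3))" "bounded (range (\<lambda>\<theta>. alongflux \<theta> $ 4))"
    unfolding alongflux_nth by (intro bounded_plus_comp bounded_times b)+
  then show "bounded (range (\<lambda>\<theta>. alongflux \<theta> $ i))"
    using exhaust_4[of i] by (elim disjE; simp only:)
qed

text \<open>The integrated conservation law, one conserved quantity at a time: the flux through the ray at angle
  \<open>\<theta>\<close> is a primitive of the flux along that ray.\<close>

lemma flux_balance:
  "bounded_primitive_on x y (\<lambda>\<theta>. crossflux \<theta> $ i) (\<lambda>\<theta>. alongflux \<theta> $ i)"
proof -
  have meas: "alongflux \<in> borel_measurable lebesgue"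
    by (rule borel_measurable_vecI) (rule alongflux_nth_bounded_measurable)
  have "\<forall>j. \<exists>B. \<forall>\<theta>. \<bar>alongflux \<theta> $ j\<bar> \<le> B"
    using alongflux_nth_bounded_measurable(2) by (auto simp: bounded_iff)
  then obtain B where B: "\<And>j \<theta>. \<bar>alongflux \<theta> $ j\<bar> \<le> B j" by metis
  have bd: "norm (alongflux \<theta>) \<le> (\<Sum>j\<in>UNIV. B j)" for \<theta>
    by (rule order_trans[OF norm_le_l1_cart sum_mono]) (rule B)
  have "((\<lambda>\<theta>. alongflux \<theta> $ i) has_integral crossflux t $ i - crossflux s $ i) {s..t}"
    if "s \<le> t" for s t
  proof (cases "s = t")
    case False
    have "set_integrable lebesgue {s..t} alongflux"
      unfolding set_integrable_def
      by (rule integrableI_bounded_set_indicator[OF _ meas, where B = "\<Sum>j\<in>UNIV. B j"]) (auto simp: bd emeasure_lborel_Icc_eq)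
    then have "(alongflux has_integral (LINT \<eta>:{s..t}|lebesgue. alongflux \<eta>)) {s..t}"
      by (rule has_integral_set_lebesgue)
    moreover have "(LINT \<eta>:{s..t}|lebesgue. alongflux \<eta>) = crossflux t - crossflux s"
      using solution False that by (simp add: steady_entropy_solution_def)
    ultimately have "(alongflux has_integral crossflux t - crossflux s) {s..t}" by simp
    from has_integral_linear[OF this bounded_linear_vec_nth[of i]] show ?thesis
      by (simp add: o_def)
  qed (auto intro: has_integral_refl)
  moreover have "(\<lambda>\<theta>. alongflux \<theta> $ i) \<in> borel_measurable (lebesgue_on {x..y})"
    by (rule measurable_restrict_space1) (rule alongflux_nth_bounded_measurable)
  ultimately show ?thesis
    unfolding bounded_primitive_on_def
    using bounded_subset[OF alongflux_nth_bounded_measurable(2) image_mono[OF subset_UNIV]] by blast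
qed

lemma mass_balance:
  "bounded_primitive_on x y (\<lambda>\<theta>. rho \<theta> * N \<theta>) (\<lambda>\<theta>. rho \<theta> * L \<theta>)"
  using flux_balance[of x y 1] unfolding alongflux_nth crossflux_nth .

lemma momentum_x_balance:
  "bounded_primitive_on x y (\<lambda>\<theta>. rho \<theta> * u \<theta> * N \<theta> + pr \<theta> * sin \<theta>)
     (\<lambda>\<theta>. rho \<theta> * u \<theta> * L \<theta> + pr \<theta> * cos \<theta>)"
  using flux_balance[of x y 2] unfolding alongflux_nth crossflux_nth .

lemma momentum_y_balance:
  "bounded_primitive_on x y (\<lambda>\<theta>. rho \<theta> * v \<theta> * N \<theta> - pr \<theta> * cos \<theta>)
     (\<lambda>\<theta>. rho \<theta> * v \<theta> * L \<theta> + pr \<theta> * sin \<theta>)"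
  using flux_balance[of x y 3] unfolding alongflux_nth crossflux_nth .

lemma energy_balance:
  "bounded_primitive_on x y (\<lambda>\<theta>. N \<theta> * (energy (U \<theta>) + pr \<theta>))
     (\<lambda>\<theta>. L \<theta> * (energy (U \<theta>) + pr \<theta>))"
  using flux_balance[of x y 4] unfolding alongflux_nth crossflux_nth .

lemma entropy_inequality:
  assumes "s \<le> t"
  shows "(\<lambda>\<theta>. rho \<theta> * L \<theta> * S \<theta>) integrable_on {s..t}"
    and "rho t * N t * S t - rho s * N s * S s \<le> integral {s..t} (\<lambda>\<theta>. rho \<theta> * L \<theta> * S \<theta>)"
proof -
  let ?f = "\<lambda>\<theta>. rho \<theta> * L \<theta> * S \<theta>"
  have eq: "cos \<theta> * entropy_flux_x \<gamma> c\<^sub>v S\<^sub>0 (U \<theta>) + sin \<theta> * entropy_flux_y \<gamma> c\<^sub>v S\<^sub>0 (U \<theta>) = ?f \<theta>"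
    "sin \<theta> * entropy_flux_x \<gamma> c\<^sub>v S\<^sub>0 (U \<theta>) - cos \<theta> * entropy_flux_y \<gamma> c\<^sub>v S\<^sub>0 (U \<theta>)
      = rho \<theta> * N \<theta> * S \<theta>" for \<theta>
    by (simp_all add: entropy_flux_x_def entropy_flux_y_def normal_vel_def tang_vel_def algebra_simps)
  have "bounded (range ?f)"
    by (intro bounded_times bounded_components entropy_bounded)
  then obtain B where "\<And>\<theta>. \<bar>?f \<theta>\<bar> \<le> B" by (auto simp: bounded_iff)
  then have si: "set_integrable lebesgue {s..t} ?f"
    unfolding set_integrable_def
    by (intro integrableI_bounded_set_indicator[where B = B]) (auto simp: emeasure_lborel_Icc_eq)
  show "?f integrable_on {s..t}"
    by (rule set_lebesgue_integral_eq_integral[OF si])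
  show "rho t * N t * S t - rho s * N s * S s \<le> integral {s..t} ?f"
  proof (cases "s = t")
    case False
    then have "rho t * N t * S t - rho s * N s * S s \<le> (LINT \<eta>:{s..t}|lebesgue. ?f \<eta>)"
      using solution assms by (simp only: steady_entropy_solution_def eq)
    then show ?thesis by (simp only: set_lebesgue_integral_eq_integral[OF si])
  qed simp
qed

text \<open>\<open>crit\<close> is the product and \<open>nsum\<close> the sum of the two normal velocities that are compatible with the
  fluxes at \<open>\<theta>\<close>.  The first is the square of the critical speed in Prandtl's relation for normal shocks.\<close>

definition crit :: "real \<Rightarrow> real" where
  "crit \<theta> = ((\<gamma> - 1) * (N \<theta>)\<^sup>2 + 2 * \<gamma> * pr \<theta> / rho \<theta>) / (\<gamma> + 1)"

definition nsum :: "real \<Rightarrow> real" where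
  "nsum \<theta> = N \<theta> + crit \<theta> / N \<theta>"

text \<open>The momentum fluxes are projected on the rotating frame \<open>(sin \<theta>, - cos \<theta>)\<close>, \<open>(cos \<theta>, sin \<theta>)\<close>; the rotation
  adds the second half of \<open>2 \<rho> L N\<close>.\<close>

lemma normal_momentum_balance:
  "bounded_primitive_on x y (\<lambda>\<theta>. rho \<theta> * (N \<theta>)\<^sup>2 + pr \<theta>) (\<lambda>\<theta>. 2 * rho \<theta> * L \<theta> * N \<theta>)"
proof -
  have sin: "bounded_primitive_on x y sin cos" and cos: "bounded_primitive_on x y cos (\<lambda>\<theta>. - sin \<theta>)"
    by (auto intro!: bounded_primitive_on_C1 derivative_eq_intros continuous_intros)
  show ?thesis
  proof (rule bounded_primitive_on_cong[OF bounded_primitive_on_diff[OF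
          bounded_primitive_on_mult[OF sin momentum_x_balance]
          bounded_primitive_on_mult[OF cos momentum_y_balance]]])
    fix z
    have "sin z * (rho z * u z * N z + pr z * sin z) - cos z * (rho z * v z * N z - pr z * cos z)
        = rho z * (u z * sin z - v z * cos z) * N z + pr z * ((sin z)\<^sup>2 + (cos z)\<^sup>2)"
      by algebra
    then have "sin z * (rho z * u z * N z + pr z * sin z) - cos z * (rho z * v z * N z - pr z * cos z)
        = rho z * (u z * sin z - v z * cos z) * N z + pr z"
      by (simp only: sin_cos_squared_add mult_1_right)
    then show "sin z * (rho z * u z * N z + pr z * sin z) - cos z * (rho z * v z * N z - pr z * cos z)
        = rho z * (N z)\<^sup>2 + pr z"
      by (simp add: normal_vel_def[symmetric] power2_eq_square)
    have "cos z * (rho z * u z * N z + pr z * sin z) + sin z * (rho z * u z * L z + pr z * cos z)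
          - (- sin z * (rho z * v z * N z - pr z * cos z) + cos z * (rho z * v z * L z + pr z * sin z))
        = rho z * N z * (u z * cos z + v z * sin z) + rho z * L z * (u z * sin z - v z * cos z)"
      by algebra
    then show "cos z * (rho z * u z * N z + pr z * sin z) + sin z * (rho z * u z * L z + pr z * cos z)
          - (- sin z * (rho z * v z * N z - pr z * cos z) + cos z * (rho z * v z * L z + pr z * sin z))
        = 2 * rho z * L z * N z"
      by (simp add: normal_vel_def[symmetric] tang_vel_def[symmetric])
  qed
qed

lemma tangential_momentum_balance:
  "bounded_primitive_on x y (\<lambda>\<theta>. rho \<theta> * L \<theta> * N \<theta>) (\<lambda>\<theta>. rho \<theta> * ((L \<theta>)\<^sup>2 - (N \<theta>)\<^sup>2))"
proof -
  have sin: "bounded_primitive_on x y sin cos" and cos: "bounded_primitive_on x y cos (\<lambda>\<theta>. - sin \<theta>)"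
    by (auto intro!: bounded_primitive_on_C1 derivative_eq_intros continuous_intros)
  show ?thesis
  proof (rule bounded_primitive_on_cong[OF bounded_primitive_on_add[OF
          bounded_primitive_on_mult[OF cos momentum_x_balance]
          bounded_primitive_on_mult[OF sin momentum_y_balance]]])
    fix z
    have "cos z * (rho z * u z * N z + pr z * sin z) + sin z * (rho z * v z * N z - pr z * cos z)
        = rho z * (u z * cos z + v z * sin z) * N z"
      by algebra
    then show "cos z * (rho z * u z * N z + pr z * sin z) + sin z * (rho z * v z * N z - pr z * cos z)
        = rho z * L z * N z"
      by (simp add: tang_vel_def[symmetric])
    have "- sin z * (rho z * u z * N z + pr z * sin z) + cos z * (rho z * u z * L z + pr z * cos z)
          + (cos z * (rho z * v z * N z - pr z * cos z) + sin z * (rho z * v z * L z + pr z * sin z))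
        = rho z * (L z * (u z * cos z + v z * sin z) - N z * (u z * sin z - v z * cos z))"
      by algebra
    then show "- sin z * (rho z * u z * N z + pr z * sin z) + cos z * (rho z * u z * L z + pr z * cos z)
          + (cos z * (rho z * v z * N z - pr z * cos z) + sin z * (rho z * v z * L z + pr z * sin z))
        = rho z * ((L z)\<^sup>2 - (N z)\<^sup>2)"
      by (simp add: normal_vel_def[symmetric] tang_vel_def[symmetric] power2_eq_square)
  qed
qed

lemma crit_pos: "crit \<theta> > 0"
  unfolding crit_def using density_bounds[of \<theta>] pressure_bounds[of \<theta>] gamma
  by (intro divide_pos_pos add_nonneg_pos mult_nonneg_nonneg mult_pos_pos) auto

text \<open>The point of this form is that \<open>N\<close> does not occur in it: \<open>crit\<close> is determined by the total enthalpy and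
  \<open>L\<close>, and so it is continuous across jumps of \<open>N\<close>.\<close>

lemma crit_alt:
  "crit \<theta> = (\<gamma> - 1) / (\<gamma> + 1) * (2 * ((energy (U \<theta>) + pr \<theta>) / rho \<theta>) - (L \<theta>)\<^sup>2)"
proof -
  let ?w = "pr \<theta> / rho \<theta>"
  have half: "2 * ((n + l) / 2 + g * w) - l = n + 2 * g * w" for n l g w :: real
    by (simp add: field_simps)
  have h: "(energy (U \<theta>) + pr \<theta>) / rho \<theta> = ((N \<theta>)\<^sup>2 + (L \<theta>)\<^sup>2) / 2 + (1 / (\<gamma> - 1) + 1) * ?w"
    unfolding energy_eq using density_bounds(3)[of \<theta>]
    by (simp add: add_divide_distrib ring_distribs)
  have "1 / (\<gamma> - 1) + 1 = \<gamma> / (\<gamma> - 1)"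
    using gamma by (simp add: field_simps)
  then have "2 * ((energy (U \<theta>) + pr \<theta>) / rho \<theta>) - (L \<theta>)\<^sup>2 = (N \<theta>)\<^sup>2 + 2 * \<gamma> / (\<gamma> - 1) * ?w"
    unfolding h using half[of "(N \<theta>)\<^sup>2" "(L \<theta>)\<^sup>2" "\<gamma> / (\<gamma> - 1)" ?w] by simp
  then have "(\<gamma> - 1) * (2 * ((energy (U \<theta>) + pr \<theta>) / rho \<theta>) - (L \<theta>)\<^sup>2)
      = (\<gamma> - 1) * (N \<theta>)\<^sup>2 + 2 * \<gamma> * ?w"
    using gamma by (simp add: distrib_left)
  then show ?thesis unfolding crit_def by (simp only: times_divide_eq_left times_divide_eq_right)
qed

text \<open>Likewise \<open>nsum\<close> is determined by the normal momentum and mass fluxes.\<close>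

lemma nsum_alt:
  assumes "N \<theta> \<noteq> 0"
  shows "nsum \<theta> = 2 * \<gamma> / (\<gamma> + 1) * ((rho \<theta> * (N \<theta>)\<^sup>2 + pr \<theta>) / (rho \<theta> * N \<theta>))"
proof -
  have g: "\<gamma> + 1 \<noteq> 0" and r: "rho \<theta> \<noteq> 0" using gamma density_bounds(3)[of \<theta>] by auto
  have "crit \<theta> / N \<theta> = ((\<gamma> - 1) * N \<theta> + 2 * \<gamma> * pr \<theta> / (rho \<theta> * N \<theta>)) / (\<gamma> + 1)"
    unfolding crit_def using assms g r by (simp add: divide_simps power2_eq_square algebra_simps)
  moreover have "(rho \<theta> * (N \<theta>)\<^sup>2 + pr \<theta>) / (rho \<theta> * N \<theta>) = N \<theta> + pr \<theta> / (rho \<theta> * N \<theta>)"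
    using assms r by (simp add: add_divide_distrib power2_eq_square)
  moreover have "N \<theta> + ((\<gamma> - 1) * N \<theta> + 2 * \<gamma> * pr \<theta> / (rho \<theta> * N \<theta>)) / (\<gamma> + 1)
      = 2 * \<gamma> / (\<gamma> + 1) * (N \<theta> + pr \<theta> / (rho \<theta> * N \<theta>))"
    using g by (simp add: divide_simps) (simp add: algebra_simps)
  ultimately show ?thesis by (simp only: nsum_def)
qed

context
  fixes x y :: real
  assumes N_nonzero: "\<And>\<theta>. \<theta> \<in> {x..y} \<Longrightarrow> N \<theta> \<noteq> 0"
begin

lemma mass_flux_nonzero: "\<theta> \<in> {x..y} \<Longrightarrow> rho \<theta> * N \<theta> \<noteq> 0"
  using N_nonzero[of \<theta>] density_bounds(3)[of \<theta>] by auto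

lemma tangential_velocity_primitive: "bounded_primitive_on x y L (\<lambda>\<theta>. - N \<theta>)"
proof (rule bounded_primitive_on_cong[OF bounded_primitive_on_divide[OF
        tangential_momentum_balance mass_balance mass_flux_nonzero]])
  fix z assume z: "z \<in> {x..y}"
  show "rho z * L z * N z / (rho z * N z) = L z"
    using N_nonzero[OF z] density_bounds(3)[of z] by simp
  have "rho z * ((L z)\<^sup>2 - (N z)\<^sup>2) * (rho z * N z) - rho z * L z * N z * (rho z * L z)
      = - N z * (rho z * N z)\<^sup>2"
    by algebra
  then show "(rho z * ((L z)\<^sup>2 - (N z)\<^sup>2) * (rho z * N z) - rho z * L z * N z * (rho z * L z))
      / (rho z * N z)\<^sup>2 = - N z"
    using mass_flux_nonzero[OF z] by simp
qed

lemma total_enthalpy_primitive: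
  "bounded_primitive_on x y (\<lambda>\<theta>. (energy (U \<theta>) + pr \<theta>) / rho \<theta>) (\<lambda>_. 0)"
proof (rule bounded_primitive_on_cong[OF bounded_primitive_on_divide[OF
        energy_balance mass_balance mass_flux_nonzero]])
  fix z assume z: "z \<in> {x..y}"
  show "N z * (energy (U z) + pr z) / (rho z * N z) = (energy (U z) + pr z) / rho z"
    using N_nonzero[OF z] by simp
  show "(L z * (energy (U z) + pr z) * (rho z * N z) - N z * (energy (U z) + pr z) * (rho z * L z))
      / (rho z * N z)\<^sup>2 = 0"
    by simp
qed

lemma crit_primitive:
  "bounded_primitive_on x y crit (\<lambda>\<theta>. (\<gamma> - 1) / (\<gamma> + 1) * (2 * L \<theta> * N \<theta>))"
  by (rule bounded_primitive_on_cong[OF bounded_primitive_on_cmult[OF bounded_primitive_on_diff[OF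
          bounded_primitive_on_cmult[OF total_enthalpy_primitive, of 2]
          bounded_primitive_on_mult[OF tangential_velocity_primitive tangential_velocity_primitive]],
          of "(\<gamma> - 1) / (\<gamma> + 1)"]])
    (simp_all add: crit_alt power2_eq_square)

lemma nsum_primitive:
  "bounded_primitive_on x y nsum (\<lambda>\<theta>. 4 * \<gamma> / (\<gamma> + 1) * L \<theta> - nsum \<theta> * L \<theta> / N \<theta>)"
proof (rule bounded_primitive_on_cong)
  show "bounded_primitive_on x y
      (\<lambda>\<theta>. 2 * \<gamma> / (\<gamma> + 1) * ((rho \<theta> * (N \<theta>)\<^sup>2 + pr \<theta>) / (rho \<theta> * N \<theta>)))
      (\<lambda>\<theta>. 2 * \<gamma> / (\<gamma> + 1) * ((2 * rho \<theta> * L \<theta> * N \<theta> * (rho \<theta> * N \<theta>)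
        - (rho \<theta> * (N \<theta>)\<^sup>2 + pr \<theta>) * (rho \<theta> * L \<theta>)) / (rho \<theta> * N \<theta>)\<^sup>2))"
    by (intro bounded_primitive_on_cmult bounded_primitive_on_divide normal_momentum_balance
        mass_balance mass_flux_nonzero)
next
  fix z assume z: "z \<in> {x..y}"
  show "2 * \<gamma> / (\<gamma> + 1) * ((rho z * (N z)\<^sup>2 + pr z) / (rho z * N z)) = nsum z"
    using nsum_alt[OF N_nonzero[OF z]] by simp
  let ?q = "rho z * (N z)\<^sup>2 + pr z"
  have distr: "k * (2 * l - r * l / n) = k * (2 * l) - (k * r) * l / n" for k l r n :: real
    by (simp add: algebra_simps)
  have nz: "N z \<noteq> 0" "rho z \<noteq> 0" using N_nonzero[OF z] density_bounds(3)[of z] by auto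
  have "(2 * rho z * L z * N z * (rho z * N z) - ?q * (rho z * L z)) / (rho z * N z)\<^sup>2
      = 2 * L z - ?q / (rho z * N z) * L z / N z"
    using nz by (simp add: diff_divide_distrib power2_eq_square)
  then have "2 * \<gamma> / (\<gamma> + 1) * ((2 * rho z * L z * N z * (rho z * N z) - ?q * (rho z * L z)) / (rho z * N z)\<^sup>2)
      = 2 * \<gamma> / (\<gamma> + 1) * (2 * L z) - (2 * \<gamma> / (\<gamma> + 1) * (?q / (rho z * N z))) * L z / N z"
    using distr[of "2 * \<gamma> / (\<gamma> + 1)" "L z" "?q / (rho z * N z)" "N z"] by (simp only:)
  also have "\<dots> = 4 * \<gamma> / (\<gamma> + 1) * L z - nsum z * L z / N z"
    unfolding nsum_alt[OF nz(1)] by (simp add: algebra_simps)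
  finally show "2 * \<gamma> / (\<gamma> + 1) * ((2 * rho z * L z * N z * (rho z * N z) - ?q * (rho z * L z)) / (rho z * N z)\<^sup>2)
      = 4 * \<gamma> / (\<gamma> + 1) * L z - nsum z * L z / N z" .
qed

end

end

section \<open>The two branches of the normal velocity\<close>

locale forward_flow = steady_flow +
  fixes a b :: real
  assumes a_less_b: "a < b" and N_a: "normal_vel U a = 0" and N_b: "normal_vel U b = 0"
    and N_pos: "\<And>\<theta>. \<theta> \<in> {a<..<b} \<Longrightarrow> normal_vel U \<theta> > 0"
begin

lemma primitive_imp_isCont:
  assumes "\<And>x y. a < x \<Longrightarrow> y < b \<Longrightarrow> bounded_primitive_on x y A f" "\<theta> \<in> {a<..<b}"
  shows "isCont A \<theta>"
proof -
  let ?x = "(a + \<theta>) / 2" and ?y = "(\<theta> + b) / 2"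
  have "continuous_on {?x..?y} A"
    using assms by (intro bounded_primitive_on_continuous[where f = f]) auto
  then show ?thesis
    by (rule continuous_on_interior) (use assms(2) in \<open>auto simp: field_simps\<close>)
qed

lemma primitive_imp_has_real_derivative:
  assumes "\<And>x y. a < x \<Longrightarrow> y < b \<Longrightarrow> bounded_primitive_on x y A f" "\<theta> \<in> {a<..<b}" "isCont f \<theta>"
  shows "(A has_real_derivative f \<theta>) (at \<theta>)"
  by (rule bounded_primitive_on_has_real_derivative[of "(a + \<theta>) / 2" "(\<theta> + b) / 2"])
    (use assms in \<open>auto simp: field_simps\<close>)

lemma inside_nonzero: "a < x \<Longrightarrow> y < b \<Longrightarrow> \<theta> \<in> {x..y} \<Longrightarrow> N \<theta> \<noteq> 0"
  using N_pos[of \<theta>] by auto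

lemmas L_primitive = tangential_velocity_primitive[OF inside_nonzero]
  and crit_primitive' = crit_primitive[OF inside_nonzero]
  and nsum_primitive' = nsum_primitive[OF inside_nonzero]

lemma isCont_L: "\<theta> \<in> {a<..<b} \<Longrightarrow> isCont L \<theta>"
  by (rule primitive_imp_isCont[OF L_primitive])

lemma isCont_crit: "\<theta> \<in> {a<..<b} \<Longrightarrow> isCont crit \<theta>"
  by (rule primitive_imp_isCont[OF crit_primitive'])

lemma isCont_nsum: "\<theta> \<in> {a<..<b} \<Longrightarrow> isCont nsum \<theta>"
  by (rule primitive_imp_isCont[OF nsum_primitive'])

lemma isCont_mass_flux: "isCont (\<lambda>\<theta>. rho \<theta> * N \<theta>) \<theta>"
  using continuous_on_interior[OF bounded_primitive_on_continuous[OF mass_balance[of "\<theta> - 1" "\<theta> + 1"]]]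
  by auto

lemma isCont_normal_momentum: "isCont (\<lambda>\<theta>. rho \<theta> * (N \<theta>)\<^sup>2 + pr \<theta>) \<theta>"
  using continuous_on_interior[OF bounded_primitive_on_continuous[OF
      normal_momentum_balance[of "\<theta> - 1" "\<theta> + 1"]]]
  by auto

text \<open>The discriminant of \<open>N\<^sup>2 - nsum N + crit = 0\<close>, and its smaller (subsonic) and larger
  (supersonic) root.\<close>

definition disc :: "real \<Rightarrow> real" where
  "disc \<theta> = (nsum \<theta>)\<^sup>2 - 4 * crit \<theta>"

definition low :: "real \<Rightarrow> real" where
  "low \<theta> = (nsum \<theta> - sqrt (disc \<theta>)) / 2"

definition high :: "real \<Rightarrow> real" where
  "high \<theta> = (nsum \<theta> + sqrt (disc \<theta>)) / 2"

lemma isCont_disc: "\<theta> \<in> {a<..<b} \<Longrightarrow> isCont disc \<theta>"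
  unfolding disc_def[abs_def] by (intro continuous_intros isCont_nsum isCont_crit)

lemma isCont_low: "\<theta> \<in> {a<..<b} \<Longrightarrow> isCont low \<theta>"
  unfolding low_def[abs_def] by (intro continuous_intros isCont_nsum isCont_disc) auto

lemma isCont_high: "\<theta> \<in> {a<..<b} \<Longrightarrow> isCont high \<theta>"
  unfolding high_def[abs_def] by (intro continuous_intros isCont_nsum isCont_disc) auto

lemma N_root:
  assumes "\<theta> \<in> {a<..<b}"
  shows "(N \<theta>)\<^sup>2 - nsum \<theta> * N \<theta> + crit \<theta> = 0"
  using N_pos[OF assms] by (simp add: nsum_def field_simps power2_eq_square)

lemma disc_eq:
  assumes "\<theta> \<in> {a<..<b}"
  shows "disc \<theta> = (2 * N \<theta> - nsum \<theta>)\<^sup>2" and "disc \<theta> = (((N \<theta>)\<^sup>2 - crit \<theta>) / N \<theta>)\<^sup>2"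
proof -
  show 1: "disc \<theta> = (2 * N \<theta> - nsum \<theta>)\<^sup>2"
    using N_root[OF assms] unfolding disc_def by algebra
  have "2 * N \<theta> - nsum \<theta> = ((N \<theta>)\<^sup>2 - crit \<theta>) / N \<theta>"
    using N_pos[OF assms] by (simp add: nsum_def field_simps power2_eq_square)
  with 1 show "disc \<theta> = (((N \<theta>)\<^sup>2 - crit \<theta>) / N \<theta>)\<^sup>2" by simp
qed

lemma disc_nonneg: "\<theta> \<in> {a<..<b} \<Longrightarrow> disc \<theta> \<ge> 0"
  by (simp add: disc_eq(1))

lemma disc_eq_0_iff: "\<theta> \<in> {a<..<b} \<Longrightarrow> disc \<theta> = 0 \<longleftrightarrow> (N \<theta>)\<^sup>2 = crit \<theta>"
  using N_pos[of \<theta>] by (auto simp: disc_eq(2))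

lemma sqrt_disc: "\<theta> \<in> {a<..<b} \<Longrightarrow> sqrt (disc \<theta>) = \<bar>(N \<theta>)\<^sup>2 - crit \<theta>\<bar> / N \<theta>"
  using N_pos[of \<theta>] by (simp add: disc_eq(2) abs_divide)

lemma N_eq_low: "\<theta> \<in> {a<..<b} \<Longrightarrow> (N \<theta>)\<^sup>2 \<le> crit \<theta> \<Longrightarrow> N \<theta> = low \<theta>"
  using N_pos[of \<theta>] by (simp add: low_def sqrt_disc nsum_def field_simps power2_eq_square)

lemma N_eq_high: "\<theta> \<in> {a<..<b} \<Longrightarrow> (N \<theta>)\<^sup>2 \<ge> crit \<theta> \<Longrightarrow> N \<theta> = high \<theta>"
  using N_pos[of \<theta>] by (simp add: high_def sqrt_disc nsum_def field_simps power2_eq_square)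

lemma low_times_high: "\<theta> \<in> {a<..<b} \<Longrightarrow> low \<theta> * high \<theta> = crit \<theta>"
  using disc_nonneg[of \<theta>] by (simp add: low_def high_def disc_def field_simps power2_eq_square)

lemma DERIV_L:
  assumes "\<theta> \<in> {a<..<b}" "isCont N \<theta>"
  shows "(L has_real_derivative - N \<theta>) (at \<theta>)"
  by (rule primitive_imp_has_real_derivative[OF L_primitive]) (use assms in auto)

lemma DERIV_crit:
  assumes "\<theta> \<in> {a<..<b}" "isCont N \<theta>"
  shows "(crit has_real_derivative (\<gamma> - 1) / (\<gamma> + 1) * (2 * L \<theta> * N \<theta>)) (at \<theta>)"
  by (rule primitive_imp_has_real_derivative[OF crit_primitive'])
    (use assms isCont_L gamma in \<open>auto intro!: continuous_intros\<close>)

lemma DERIV_nsum: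
  assumes "\<theta> \<in> {a<..<b}" "isCont N \<theta>"
  shows "(nsum has_real_derivative 4 * \<gamma> / (\<gamma> + 1) * L \<theta> - nsum \<theta> * L \<theta> / N \<theta>) (at \<theta>)"
  by (rule primitive_imp_has_real_derivative[OF nsum_primitive'])
    (use assms isCont_L isCont_nsum N_pos[of \<theta>] gamma in \<open>auto intro!: continuous_intros\<close>)

text \<open>Subtracting the quadratic equations at \<open>z\<close> and \<open>\<theta>\<close> expresses the difference quotient of \<open>N\<close> by those of its
  coefficients.  The factor \<open>2 N - nsum\<close> that has to be divided by vanishes only at sonic points, and it
  cancels: what remains is \<open>L\<close>.\<close>

lemma DERIV_N:
  assumes \<theta>: "\<theta> \<in> {a<..<b}" and cont: "isCont N \<theta>" and ns: "(N \<theta>)\<^sup>2 \<noteq> crit \<theta>"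
  shows "(N has_real_derivative L \<theta>) (at \<theta>)"
proof -
  let ?M' = "4 * \<gamma> / (\<gamma> + 1) * L \<theta> - nsum \<theta> * L \<theta> / N \<theta>"
  let ?P' = "(\<gamma> - 1) / (\<gamma> + 1) * (2 * L \<theta> * N \<theta>)"
  have nz: "2 * N \<theta> - nsum \<theta> \<noteq> 0"
    using disc_eq_0_iff[OF \<theta>] ns by (auto simp: disc_eq(1)[OF \<theta>])
  have den: "((\<lambda>z. N z + N \<theta> - nsum z) \<longlongrightarrow> N \<theta> + N \<theta> - nsum \<theta>) (at \<theta>)"
    using cont isCont_nsum[OF \<theta>] by (intro tendsto_intros) (auto simp: isCont_def)
  have lim: "((\<lambda>z. ((nsum z - nsum \<theta>) / (z - \<theta>) * N \<theta> - (crit z - crit \<theta>) / (z - \<theta>)) / (N z + N \<theta> - nsum z))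
      \<longlongrightarrow> (?M' * N \<theta> - ?P') / (N \<theta> + N \<theta> - nsum \<theta>)) (at \<theta>)"
    using DERIV_nsum[OF \<theta> cont] DERIV_crit[OF \<theta> cont] nz
    by (intro tendsto_divide tendsto_diff tendsto_mult tendsto_const den)
      (auto simp: has_field_derivative_iff)
  have val: "(?M' * N \<theta> - ?P') / (N \<theta> + N \<theta> - nsum \<theta>) = L \<theta>"
  proof -
    have "4 * \<gamma> / (\<gamma> + 1) - 2 * ((\<gamma> - 1) / (\<gamma> + 1)) = 2"
      unfolding times_divide_eq_right diff_divide_distrib[symmetric] using gamma by (simp add: divide_eq_eq)
    then have "(4 * \<gamma> / (\<gamma> + 1) - 2 * ((\<gamma> - 1) / (\<gamma> + 1))) * (L \<theta> * N \<theta>) = 2 * (L \<theta> * N \<theta>)"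
      by simp
    then have "4 * \<gamma> / (\<gamma> + 1) * L \<theta> * N \<theta> - ?P' = 2 * L \<theta> * N \<theta>"
      by (simp add: algebra_simps)
    moreover have "?M' * N \<theta> = 4 * \<gamma> / (\<gamma> + 1) * L \<theta> * N \<theta> - nsum \<theta> * L \<theta>"
      using N_pos[OF \<theta>] by (simp add: left_diff_distrib)
    ultimately have "?M' * N \<theta> - ?P' = L \<theta> * (N \<theta> + N \<theta> - nsum \<theta>)"
      by (simp add: algebra_simps)
    then show ?thesis using nz by simp
  qed
  have ev: "\<forall>\<^sub>F z in at \<theta>.
      ((nsum z - nsum \<theta>) / (z - \<theta>) * N \<theta> - (crit z - crit \<theta>) / (z - \<theta>)) / (N z + N \<theta> - nsum z)
      = (N z - N \<theta>) / (z - \<theta>)"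
  proof -
    have "\<forall>\<^sub>F z in at \<theta>. N z + N \<theta> - nsum z \<noteq> 0"
      by (rule tendsto_imp_eventually_ne[OF den]) (use nz in simp)
    moreover have "\<forall>\<^sub>F z in at \<theta>. z \<in> {a<..<b}"
      using \<theta> by (intro eventually_at_in_open') auto
    moreover have "\<forall>\<^sub>F z in at \<theta>. z \<noteq> \<theta>"
      by (simp add: eventually_at_filter)
    ultimately show ?thesis
    proof eventually_elim
      case (elim z)
      have "(N z - N \<theta>) * (N z + N \<theta> - nsum z) = (nsum z - nsum \<theta>) * N \<theta> - (crit z - crit \<theta>)"
        using N_root[OF elim(2)] N_root[OF \<theta>] by algebra
      moreover have "(nsum z - nsum \<theta>) / (z - \<theta>) * N \<theta> - (crit z - crit \<theta>) / (z - \<theta>)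
          = ((nsum z - nsum \<theta>) * N \<theta> - (crit z - crit \<theta>)) / (z - \<theta>)"
        by (simp only: times_divide_eq_left diff_divide_distrib[symmetric])
      ultimately have "(nsum z - nsum \<theta>) / (z - \<theta>) * N \<theta> - (crit z - crit \<theta>) / (z - \<theta>)
          = (N z - N \<theta>) / (z - \<theta>) * (N z + N \<theta> - nsum z)"
        by simp
      then show ?case using elim(1) by simp
    qed
  qed
  have "((\<lambda>z. (N z - N \<theta>) / (z - \<theta>)) \<longlongrightarrow> L \<theta>) (at \<theta>)"
    using lim unfolding val tendsto_cong[OF ev] .
  then show ?thesis by (simp add: has_field_derivative_iff)
qed

lemma state_eqI:
  assumes "rho s = rho t" "u s = u t" "v s = v t" "pr s = pr t"
  shows "U s = U t"
proof -
  have "energy (U \<theta>) = pr \<theta> / (\<gamma> - 1) + rho \<theta> * ((u \<theta>)\<^sup>2 + (v \<theta>)\<^sup>2) / 2" for \<theta>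
    by (simp add: energy_eq speed_polar)
  then have "energy (U s) = energy (U t)" using assms by simp
  then have "U s $ 4 = U t $ 4" by (simp add: energy_def)
  moreover have "U s $ 1 = U t $ 1" using assms by (simp add: density_def)
  moreover have "U \<theta> $ 2 = rho \<theta> * u \<theta>" "U \<theta> $ 3 = rho \<theta> * v \<theta>" for \<theta>
    using density_bounds(3)[of \<theta>] by (simp_all add: density_def velx_def vely_def)
  ultimately show ?thesis
    using assms by (simp add: vec_eq_iff forall_4)
qed

text \<open>From \<open>N' = L\<close> and \<open>L' = - N\<close> the Cartesian velocity, and from the mass and normal momentum balance the
  density and the pressure, have derivative zero inside.  Continuity extends this to the end points, which
  may be sonic; this is how a constant state passes a single sonic point.\<close>

lemma constant_between:
  assumes st: "a < s" "s < t" "t < b" and cont: "continuous_on {s..t} N"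
    and ns: "\<And>\<theta>. \<theta> \<in> {s<..<t} \<Longrightarrow> (N \<theta>)\<^sup>2 \<noteq> crit \<theta>"
  shows "U s = U t"
proof -
  have sub: "{s..t} \<subseteq> {a<..<b}" using st by auto
  have nz: "N z \<noteq> 0" if "z \<in> {s..t}" for z using N_pos[of z] that st by auto
  have contL: "continuous_on {s..t} L"
    using isCont_L st by (intro continuous_at_imp_continuous_on) auto
  have contF: "continuous_on {s..t} (\<lambda>z. rho z * N z)"
    using isCont_mass_flux by (intro continuous_at_imp_continuous_on) auto
  have contQ: "continuous_on {s..t} (\<lambda>z. rho z * (N z)\<^sup>2 + pr z)"
    using isCont_normal_momentum by (intro continuous_at_imp_continuous_on) auto
  have rho: "rho z = rho z * N z / N z" if "z \<in> {s..t}" for z using nz[OF that] by simp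
  have pr: "pr z = (rho z * (N z)\<^sup>2 + pr z) - rho z * N z * N z" for z
    by (simp add: power2_eq_square)
  have D: "isCont N z" "(N has_real_derivative L z) (at z)" "(L has_real_derivative - N z) (at z)"
    "((\<lambda>z. rho z * N z) has_real_derivative rho z * L z) (at z)"
    "((\<lambda>z. rho z * (N z)\<^sup>2 + pr z) has_real_derivative 2 * rho z * L z * N z) (at z)"
    if z: "s < z" "z < t" for z
  proof -
    have z': "z \<in> {a<..<b}" using z st by auto
    show c: "isCont N z"
      by (rule continuous_on_interior[OF cont]) (use z in auto)
    show "(N has_real_derivative L z) (at z)"
      by (rule DERIV_N[OF z' c]) (use ns z in auto)
    show "(L has_real_derivative - N z) (at z)"
      by (rule DERIV_L[OF z' c])
    have "continuous_on {s..t} rho"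
      using continuous_on_divide[OF contF cont] nz by (subst continuous_on_cong[OF refl rho]) auto
    then have r: "isCont rho z"
      by (rule continuous_on_interior) (use z in auto)
    show "((\<lambda>z. rho z * N z) has_real_derivative rho z * L z) (at z)"
      by (rule bounded_primitive_on_has_real_derivative[OF mass_balance z]) (intro continuous_intros r isCont_L z')
    show "((\<lambda>z. rho z * (N z)\<^sup>2 + pr z) has_real_derivative 2 * rho z * L z * N z) (at z)"
      by (rule bounded_primitive_on_has_real_derivative[OF normal_momentum_balance z])
        (intro continuous_intros r c isCont_L z')
  qed
  have "(\<lambda>z. rho z * N z / N z) t = (\<lambda>z. rho z * N z / N z) s"
  proof (rule DERIV_isconst_end[OF st(2)])
    show "continuous_on {s..t} (\<lambda>z. rho z * N z / N z)"
      using contF cont nz by (intro continuous_on_divide) auto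
    fix z assume z: "s < z" "z < t"
    have "((\<lambda>z. rho z * N z / N z) has_real_derivative
        (rho z * L z * N z - rho z * N z * L z) / (N z * N z)) (at z)"
      using nz[of z] z by (intro DERIV_divide D) auto
    then show "((\<lambda>z. rho z * N z / N z) has_real_derivative 0) (at z)" by simp
  qed
  then have 1: "rho s = rho t" using nz[of s] nz[of t] st by simp
  have "(\<lambda>z. (rho z * (N z)\<^sup>2 + pr z) - rho z * N z * N z) t = (\<lambda>z. (rho z * (N z)\<^sup>2 + pr z) - rho z * N z * N z) s"
  proof (rule DERIV_isconst_end[OF st(2)])
    show "continuous_on {s..t} (\<lambda>z. (rho z * (N z)\<^sup>2 + pr z) - rho z * N z * N z)"
      by (intro continuous_on_diff continuous_on_mult[OF contF cont] contQ)
    fix z assume z: "s < z" "z < t"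
    have "((\<lambda>z. (rho z * (N z)\<^sup>2 + pr z) - rho z * N z * N z) has_real_derivative
        2 * rho z * L z * N z - (rho z * L z * N z + L z * (rho z * N z))) (at z)"
      by (rule DERIV_diff[OF D(5)[OF z] DERIV_mult[OF D(4)[OF z] D(2)[OF z]]])
    then show "((\<lambda>z. (rho z * (N z)\<^sup>2 + pr z) - rho z * N z * N z) has_real_derivative 0) (at z)" 
      by (simp add: algebra_simps)
  qed
  then have 2: "pr s = pr t" using pr[of s] pr[of t] by simp
  have "(\<lambda>z. N z * sin z + L z * cos z) t = (\<lambda>z. N z * sin z + L z * cos z) s"
  proof (rule DERIV_isconst_end[OF st(2)])
    show "continuous_on {s..t} (\<lambda>z. N z * sin z + L z * cos z)"
      by (intro continuous_intros cont contL)
    fix z assume z: "s < z" "z < t"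
    have "((\<lambda>z. N z * sin z + L z * cos z) has_real_derivative
       (L z * sin z + cos z * N z) + (- N z * cos z + - sin z * L z)) (at z)"
      by (intro DERIV_add DERIV_mult D z DERIV_sin DERIV_cos)
    then show "((\<lambda>z. N z * sin z + L z * cos z) has_real_derivative 0) (at z)"
      by (simp add: algebra_simps)
  qed
  then have 3: "u s = u t" unfolding velocity_polar by simp
  have "(\<lambda>z. L z * sin z - N z * cos z) t = (\<lambda>z. L z * sin z - N z * cos z) s"
  proof (rule DERIV_isconst_end[OF st(2)])
    show "continuous_on {s..t} (\<lambda>z. L z * sin z - N z * cos z)"
      by (intro continuous_intros cont contL)
    fix z assume z: "s < z" "z < t"
    have "((\<lambda>z. L z * sin z - N z * cos z) has_real_derivative
       (- N z * sin z + cos z * L z) - (L z * cos z + - sin z * N z)) (at z)"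
      by (intro DERIV_diff DERIV_mult D z DERIV_sin DERIV_cos)
    then show "((\<lambda>z. L z * sin z - N z * cos z) has_real_derivative 0) (at z)"
      by (simp add: algebra_simps)
  qed
  then have 4: "v s = v t" unfolding velocity_polar by simp
  show ?thesis by (rule state_eqI[OF 1 3 4 2])
qed

text \<open>The derivative is \<open>2 N L - crit' = 4 N L / (\<gamma> + 1)\<close>.  The sign of \<open>N\<^sup>2 - crit\<close> is that of \<open>N - c\<close>.\<close>

lemma excess_increasing:
  assumes st: "a < s" "s < t" "t < b" and cont: "continuous_on {s..t} N"
    and ns: "\<And>\<theta>. \<theta> \<in> {s<..<t} \<Longrightarrow> (N \<theta>)\<^sup>2 \<noteq> crit \<theta>"
    and L: "\<And>\<theta>. \<theta> \<in> {s<..<t} \<Longrightarrow> L \<theta> > 0"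
  shows "(N s)\<^sup>2 - crit s < (N t)\<^sup>2 - crit t"
proof (rule DERIV_pos_imp_increasing_open[OF st(2)])
  fix z assume z: "s < z" "z < t"
  then have z': "z \<in> {a<..<b}" using st by auto
  have c: "isCont N z"
    by (rule continuous_on_interior[OF cont]) (use z in auto)
  have D: "(N has_real_derivative L z) (at z)"
    by (rule DERIV_N[OF z' c]) (use ns z in auto)
  have "((\<lambda>z. (N z)\<^sup>2 - crit z) has_real_derivative
      2 * N z * L z - (\<gamma> - 1) / (\<gamma> + 1) * (2 * L z * N z)) (at z)"
    using DERIV_diff[OF DERIV_power[OF D, of 2] DERIV_crit[OF z' c]] by (simp add: algebra_simps)
  moreover have eq: "2 * N z * L z - (\<gamma> - 1) / (\<gamma> + 1) * (2 * L z * N z) = (1 - (\<gamma> - 1) / (\<gamma> + 1)) * (2 * (N z * L z))"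
    by (simp add: algebra_simps)
  moreover have "(1 - (\<gamma> - 1) / (\<gamma> + 1)) * (2 * (N z * L z)) > 0"
    using gamma N_pos[OF z'] L z by (intro mult_pos_pos) (auto simp: field_simps)
  ultimately show "\<exists>y. ((\<lambda>z. (N z)\<^sup>2 - crit z) has_real_derivative y) (at z) \<and> 0 < y"
    unfolding eq by blast
next
  show "continuous_on {s..t} (\<lambda>z. (N z)\<^sup>2 - crit z)"
    using isCont_crit st by (intro continuous_intros cont continuous_at_imp_continuous_on) auto
qed

lemma continuous_on_N:
  assumes "a < s" "t < b"
    and "(\<forall>\<theta>\<in>{s..t}. (N \<theta>)\<^sup>2 \<le> crit \<theta>) \<or> (\<forall>\<theta>\<in>{s..t}. (N \<theta>)\<^sup>2 \<ge> crit \<theta>)"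
  shows "continuous_on {s..t} N"
proof -
  have "continuous_on {s..t} low" "continuous_on {s..t} high"
    using isCont_low isCont_high assms(1,2) by (auto intro!: continuous_at_imp_continuous_on)
  then show ?thesis
    using assms N_eq_low N_eq_high
    by (elim disjE) (auto cong: continuous_on_cong_simp simp: simp_implies_def)
qed

end

section \<open>Entropy and admissible jumps\<close>

text \<open>Across a normal shock with density ratio \<open>t\<close> the pressure ratio is
  \<open>((\<gamma> + 1) t - (\<gamma> - 1)) / ((\<gamma> + 1) - (\<gamma> - 1) t)\<close>, so this compares the logarithms that make up the entropy
  jump.  Both sides agree at \<open>t = 1\<close>, and their derivatives differ by a positive multiple of \<open>(t - 1)\<^sup>2\<close>.\<close>

lemma log_compression_lt_log_pressure_ratio:
  fixes \<gamma> t :: real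
  assumes \<gamma>: "\<gamma> > 1" and t: "t > 1" "(\<gamma> - 1) * t < \<gamma> + 1"
  shows "\<gamma> * ln t < ln ((\<gamma> + 1) * t - (\<gamma> - 1)) - ln ((\<gamma> + 1) - (\<gamma> - 1) * t)"
proof -
  let ?f = "\<lambda>t. ln ((\<gamma> + 1) * t - (\<gamma> - 1)) - ln ((\<gamma> + 1) - (\<gamma> - 1) * t) - \<gamma> * ln t"
  have pos: "(\<gamma> + 1) * z - (\<gamma> - 1) > 0" "(\<gamma> + 1) - (\<gamma> - 1) * z > 0" if z: "1 \<le> z" "z \<le> t" for z
  proof -
    have "\<gamma> + 1 \<le> (\<gamma> + 1) * z"
      using mult_left_mono[of 1 z "\<gamma> + 1"] z \<gamma> by simp
    then show "(\<gamma> + 1) * z - (\<gamma> - 1) > 0" by simp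
    have "(\<gamma> - 1) * z \<le> (\<gamma> - 1) * t"
      using z \<gamma> by (intro mult_left_mono) auto
    then show "(\<gamma> + 1) - (\<gamma> - 1) * z > 0"
      using t by linarith
  qed
  have "?f 1 < ?f t"
  proof (rule DERIV_pos_imp_increasing_open[OF t(1)])
    fix z assume z: "1 < z" "z < t"
    let ?A = "(\<gamma> + 1) * z - (\<gamma> - 1)" and ?B = "(\<gamma> + 1) - (\<gamma> - 1) * z"
    have AB: "?A > 0" "?B > 0" using pos[of z] z by auto
    have D: "(?f has_real_derivative (\<gamma> + 1) / ?A + (\<gamma> - 1) / ?B - \<gamma> / z) (at z)"
      using AB z by (auto intro!: derivative_eq_intros simp: diff_divide_distrib)
    have eq: "(\<gamma> + 1) / ?A + (\<gamma> - 1) / ?B - \<gamma> / z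
        = (((\<gamma> + 1) * ?B + (\<gamma> - 1) * ?A) * z - \<gamma> * (?A * ?B)) / (?A * ?B * z)"
      using AB z by (simp add: add_frac_eq diff_frac_eq)
    have num: "((\<gamma> + 1) * ?B + (\<gamma> - 1) * ?A) * z - \<gamma> * (?A * ?B) = \<gamma> * (\<gamma>\<^sup>2 - 1) * (z - 1)\<^sup>2"
      by algebra
    have "\<gamma> * (\<gamma>\<^sup>2 - 1) * (z - 1)\<^sup>2 / (?A * ?B * z) > 0"
      using AB z \<gamma> by (intro divide_pos_pos mult_pos_pos) auto
    then show "\<exists>y. (?f has_real_derivative y) (at z) \<and> 0 < y"
      using D unfolding eq num by blast
  next
    show "continuous_on {1..t} ?f"
      using pos by (intro continuous_intros) force+
  qed
  then show ?thesis by simp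
qed

context forward_flow
begin

text \<open>By mass conservation the entropy inequality bounds \<open>\<rho> N\<close> times the increment of \<open>S\<close> by
  \<open>\<integral> \<rho> L (S - S x)\<close>.  Since \<open>S\<close> is bounded, its increments are at most linear in the step; inserting this
  one-sided bound into the same integral, which is possible because \<open>\<rho> L \<ge> 0\<close>, makes them at most quadratic.\<close>

lemma entropy_antimono:
  assumes st: "a < s" "s \<le> t" "t < b" and L: "\<And>\<theta>. \<theta> \<in> {s..t} \<Longrightarrow> L \<theta> \<ge> 0"
  shows "S t \<le> S s"
proof -
  let ?F = "\<lambda>\<theta>. rho \<theta> * N \<theta>"
  obtain B where B': "\<And>\<theta>. \<bar>S \<theta>\<bar> \<le> B"
    using entropy_bounded by (auto simp: bounded_iff)
  note B = order_trans[OF abs_ge_zero B'] B'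
  have "bounded (range (\<lambda>\<theta>. rho \<theta> * L \<theta>))"
    by (intro bounded_times bounded_components)
  then obtain D where D': "\<And>\<theta>. \<bar>rho \<theta> * L \<theta>\<bar> \<le> D"
    by (auto simp: bounded_iff)
  note D = order_trans[OF abs_ge_zero D'] D'
  have "continuous_on {s..t} ?F"
    using isCont_mass_flux by (intro continuous_at_imp_continuous_on) auto
  then obtain k where k: "k \<in> {s..t}" "\<And>z. z \<in> {s..t} \<Longrightarrow> ?F k \<le> ?F z"
    using continuous_attains_inf[of "{s..t}" ?F] st by auto
  have Fk: "?F k > 0" using k(1) st N_pos[of k] density_bounds(3)[of k] by auto
  have jump: "S y - S x \<le> D * C / ?F k * (y - x)"
    if xy: "s \<le> x" "x \<le> y" "y \<le> t" and C: "C \<ge> 0" "\<And>z. z \<in> {x..y} \<Longrightarrow> S z - S x \<le> C" for x y C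
  proof -
    have "((\<lambda>z. rho z * L z * S z - rho z * L z * S x) has_integral
        integral {x..y} (\<lambda>z. rho z * L z * S z) - (?F y - ?F x) * S x) {x..y}"
      using entropy_inequality(1)[OF xy(2)] bounded_primitive_on_has_integral[OF mass_balance _ xy(2), of x y]
      by (intro has_integral_diff has_integral_mult_left integrable_integral) auto
    moreover have "rho z * L z * S z - rho z * L z * S x \<le> D * C" if z: "z \<in> {x..y}" for z
    proof -
      have "0 \<le> rho z * L z"
        using L[of z] z xy density_bounds(3)[of z] by (intro mult_nonneg_nonneg) auto
      then have "rho z * L z * (S z - S x) \<le> rho z * L z * C"
        using C(2)[OF z] by (intro mult_left_mono)
      also have "\<dots> \<le> D * C" using D(2)[of z] C(1) by (intro mult_right_mono) auto
      finally show ?thesis by (simp add: right_diff_distrib)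
    qed
    ultimately have "integral {x..y} (\<lambda>z. rho z * L z * S z) - (?F y - ?F x) * S x \<le> D * C * (y - x)"
      using has_integral_le[OF _ has_integral_const_real[of "D * C" x y]] xy(2) by (auto simp: mult.commute)
    moreover have "?F y * S y - ?F x * S x \<le> integral {x..y} (\<lambda>z. rho z * L z * S z)"
      using entropy_inequality(2)[OF xy(2)] .
    ultimately have *: "?F y * (S y - S x) \<le> D * C * (y - x)"
      by (simp add: algebra_simps)
    show ?thesis
    proof (cases "S y - S x \<le> 0")
      case True
      have "0 \<le> D * C / ?F k * (y - x)" using D C Fk xy by simp
      then show ?thesis using True by linarith
    next
      case False
      then have "?F k * (S y - S x) \<le> ?F y * (S y - S x)"
        using k(2)[of y] xy by (intro mult_right_mono) auto
      with * have "?F k * (S y - S x) \<le> D * C * (y - x)" by linarith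
      then have "(S y - S x) * ?F k \<le> D * C * (y - x)" by (simp only: mult.commute)
      then show ?thesis by (simp only: times_divide_eq_left pos_le_divide_eq[OF Fk])
    qed
  qed
  \<comment> \<open>First pass: the trivial bound \<open>2 B\<close> makes \<open>S\<close> one-sided Lipschitz with constant \<open>C\<close>.\<close>
  define C where "C = D * (2 * B) / ?F k"
  have C: "C \<ge> 0" using B D Fk by (simp add: C_def)
  have lip: "S y - S x \<le> C * (y - x)" if "s \<le> x" "x \<le> y" "y \<le> t" for x y
  proof -
    have "S z - S x \<le> 2 * B" for z using B(2)[of z] B(2)[of x] by linarith
    then show ?thesis using jump[OF that, of "2 * B"] B(1) by (simp add: C_def)
  qed
  \<comment> \<open>Second pass: the Lipschitz bound gives a quadratic one.\<close>
  have "S y - S x \<le> D * C / ?F k * (y - x)\<^sup>2" if xy: "s \<le> x" "x \<le> y" "y \<le> t" for x y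
  proof -
    have "S z - S x \<le> C * (y - x)" if z: "z \<in> {x..y}" for z
    proof -
      have "C * (z - x) \<le> C * (y - x)" using z C by (intro mult_left_mono) auto
      then show ?thesis using lip[of x z] z xy by auto
    qed
    then have "S y - S x \<le> D * (C * (y - x)) / ?F k * (y - x)"
      using jump[OF xy, of "C * (y - x)"] C xy by auto
    then show ?thesis by (simp add: power2_eq_square mult.assoc)
  qed
  then show ?thesis by (rule quadratic_defect_imp_antimono[OF _ st(2)])
qed

abbreviation "massflux \<theta> \<equiv> rho \<theta> * N \<theta>"
abbreviation "normal_momentum \<theta> \<equiv> rho \<theta> * (N \<theta>)\<^sup>2 + pr \<theta>"

text \<open>Up to the constants \<open>c\<^sub>v\<close> and \<open>S\<^sub>0\<close>, the entropy that the state would have if the given fluxes were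
  realised with normal velocity \<open>r \<theta>\<close>: its pressure would be \<open>q - \<rho>N r\<close> with \<open>q\<close> the normal momentum
  flux, and its density \<open>\<rho>N / r\<close>.\<close>

definition branch_entropy :: "(real \<Rightarrow> real) \<Rightarrow> real \<Rightarrow> real" where
  "branch_entropy r \<theta> =
     ln (normal_momentum \<theta> - massflux \<theta> * r \<theta>) - \<gamma> * ln (massflux \<theta> / r \<theta>)"

lemma massflux_pos: "\<theta> \<in> {a<..<b} \<Longrightarrow> massflux \<theta> > 0"
  using N_pos[of \<theta>] density_bounds(3)[of \<theta>] by simp

lemma entropy_eq_branch_entropy:
  assumes "\<theta> \<in> {a<..<b}" "N \<theta> = r \<theta>"
  shows "S \<theta> = c\<^sub>v * branch_entropy r \<theta> + S\<^sub>0"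
  using N_pos[OF assms(1)] density_bounds(3)[of \<theta>] unfolding branch_entropy_def assms(2)[symmetric] entropy_alt
  by (simp add: power2_eq_square algebra_simps)

lemma root_pressure:
  assumes "\<theta> \<in> {a<..<b}" "r + r' = nsum \<theta>"
  shows "normal_momentum \<theta> - massflux \<theta> * r = massflux \<theta> / (2 * \<gamma>) * ((\<gamma> + 1) * r' - (\<gamma> - 1) * r)"
proof -
  have m: "rho \<theta> \<noteq> 0" "N \<theta> \<noteq> 0" using N_pos[OF assms(1)] density_bounds(3)[of \<theta>] by auto
  have "nsum \<theta> = 2 * \<gamma> / (\<gamma> + 1) * (normal_momentum \<theta> / massflux \<theta>)"
    by (rule nsum_alt) (use N_pos[OF assms(1)] in simp)
  then have "normal_momentum \<theta> = massflux \<theta> * ((\<gamma> + 1) / (2 * \<gamma>) * nsum \<theta>)"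
    using m gamma by simp
  also have "\<dots> - massflux \<theta> * r = massflux \<theta> * ((\<gamma> + 1) / (2 * \<gamma>) * (r + r') - r)"
    by (simp add: assms(2) right_diff_distrib)
  also have "(\<gamma> + 1) / (2 * \<gamma>) * (r + r') - r = ((\<gamma> + 1) * r' - (\<gamma> - 1) * r) / (2 * \<gamma>)"
    using gamma by (simp add: field_simps)
  finally show ?thesis by simp
qed

lemma roots_pos_less_sum:
  assumes "\<theta> \<in> {a<..<b}" "disc \<theta> > 0"
  shows "0 < low \<theta>" "low \<theta> < high \<theta>" "low \<theta> + high \<theta> = nsum \<theta>"
proof -
  show 1: "low \<theta> < high \<theta>" and 2: "low \<theta> + high \<theta> = nsum \<theta>"
    using assms(2) by (simp_all add: low_def high_def field_simps)
  have "nsum \<theta> > 0" using N_pos[OF assms(1)] crit_pos[of \<theta>]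
    unfolding nsum_def by (intro add_pos_pos divide_pos_pos)
  then have "high \<theta> > 0" using 1 2 by linarith
  then show "0 < low \<theta>"
    using low_times_high[OF assms(1)] crit_pos[of \<theta>] by (metis zero_less_mult_pos2)
qed

lemma low_pressure_pos:
  assumes "\<theta> \<in> {a<..<b}" "disc \<theta> > 0"
  shows "normal_momentum \<theta> - massflux \<theta> * low \<theta> > 0"
proof -
  note r = roots_pos_less_sum[OF assms]
  have "(\<gamma> - 1) * low \<theta> \<le> (\<gamma> - 1) * high \<theta>" using r gamma by (intro mult_left_mono) auto
  also have "\<dots> < (\<gamma> + 1) * high \<theta>" using r gamma by (intro mult_strict_right_mono) auto
  finally have "(\<gamma> + 1) * high \<theta> - (\<gamma> - 1) * low \<theta> > 0" by simp
  moreover have "massflux \<theta> / (2 * \<gamma>) > 0" using massflux_pos[OF assms(1)] gamma by simp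
  ultimately show ?thesis
    unfolding root_pressure[OF assms(1) r(3)] by (rule mult_pos_pos[rotated])
qed

text \<open>The two roots are related like the two sides of a normal shock with compression ratio
  \<open>high / low\<close>; only the pressure on the supersonic side is not automatically positive.\<close>

lemma branch_entropy_less:
  assumes \<theta>: "\<theta> \<in> {a<..<b}" and d: "disc \<theta> > 0"
    and p: "normal_momentum \<theta> - massflux \<theta> * high \<theta> > 0"
  shows "branch_entropy high \<theta> < branch_entropy low \<theta>"
proof -
  note r = roots_pos_less_sum[OF \<theta> d]
  have r': "high \<theta> > 0" "high \<theta> + low \<theta> = nsum \<theta>" using r by auto
  let ?m = "massflux \<theta>"
  have m: "?m > 0" by (rule massflux_pos[OF \<theta>])
  define t where "t = high \<theta> / low \<theta>"
  have t: "t > 1" using r by (simp add: t_def)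
  define k where "k = ?m / (2 * \<gamma>) * low \<theta>"
  have k: "k > 0" using m gamma r by (simp add: k_def)
  have scale: "x * (A * high \<theta> - B * low \<theta>) = x * low \<theta> * (A * (high \<theta> / low \<theta>) - B)"
    "x * (A * low \<theta> - B * high \<theta>) = x * low \<theta> * (A - B * (high \<theta> / low \<theta>))" for x A B
    using r(1) by (simp_all add: right_diff_distrib)
  have pl: "normal_momentum \<theta> - ?m * low \<theta> = k * ((\<gamma> + 1) * t - (\<gamma> - 1))"
    unfolding root_pressure[OF \<theta> r(3)] k_def t_def by (rule scale)
  have ph: "normal_momentum \<theta> - ?m * high \<theta> = k * ((\<gamma> + 1) - (\<gamma> - 1) * t)"
    unfolding root_pressure[OF \<theta> r'(2)] k_def t_def by (rule scale)
  have A: "(\<gamma> + 1) * t - (\<gamma> - 1) > 0"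
    using low_pressure_pos[OF \<theta> d] k unfolding pl by (simp add: zero_less_mult_iff)
  have B: "(\<gamma> + 1) - (\<gamma> - 1) * t > 0"
    using p k unfolding ph by (simp add: zero_less_mult_iff)
  have "\<gamma> * ln t < ln ((\<gamma> + 1) * t - (\<gamma> - 1)) - ln ((\<gamma> + 1) - (\<gamma> - 1) * t)"
    by (rule log_compression_lt_log_pressure_ratio) (use gamma t B in auto)
  moreover have "ln t = ln (high \<theta>) - ln (low \<theta>)" using r r' by (simp add: t_def ln_div)
  moreover have "branch_entropy low \<theta> = ln k + ln ((\<gamma> + 1) * t - (\<gamma> - 1)) - \<gamma> * (ln ?m - ln (low \<theta>))"
    unfolding branch_entropy_def pl using k A N_pos[OF \<theta>] density_bounds(3)[of \<theta>] r by (simp add: ln_mult ln_div)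
  moreover have "branch_entropy high \<theta> = ln k + ln ((\<gamma> + 1) - (\<gamma> - 1) * t) - \<gamma> * (ln ?m - ln (high \<theta>))"
    unfolding branch_entropy_def ph using k B N_pos[OF \<theta>] density_bounds(3)[of \<theta>] r' by (simp add: ln_mult ln_div)
  ultimately show ?thesis by (simp add: right_diff_distrib)
qed

lemma isCont_branch_entropy:
  assumes "\<theta> \<in> {a<..<b}" "isCont r \<theta>" "r \<theta> > 0" "normal_momentum \<theta> - massflux \<theta> * r \<theta> > 0"
  shows "isCont (branch_entropy r) \<theta>"
proof -
  have p: "isCont (\<lambda>x. normal_momentum x - massflux x * r x) \<theta>"
    by (rule isCont_diff[OF isCont_normal_momentum isCont_mult[OF isCont_mass_flux assms(2)]])
  have \<rho>: "isCont (\<lambda>x. massflux x / r x) \<theta>"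
    by (rule isCont_divide[OF isCont_mass_flux assms(2)]) (use assms(3) in simp)
  have "massflux \<theta> / r \<theta> > 0" using massflux_pos[OF assms(1)] assms(3) by (rule divide_pos_pos)
  then show ?thesis
    unfolding branch_entropy_def[abs_def]
    by (intro isCont_diff isCont_mult[OF continuous_const] isCont_ln'[OF p] isCont_ln'[OF \<rho>])
      (use assms(4) in linarith)+
qed

text \<open>Both branch entropies are continuous, so near \<open>\<tau>\<close> a fixed number separates them, and going from the
  upper to the lower branch would increase the entropy.\<close>

lemma supersonic_stays_locally:
  assumes \<tau>: "\<tau> \<in> {a<..<b}" and d: "disc \<tau> > 0"
    and p: "normal_momentum \<tau> - massflux \<tau> * high \<tau> > 0"
  obtains \<epsilon> where "\<epsilon> > 0"
    "\<And>s t. \<lbrakk>\<bar>s - \<tau>\<bar> < \<epsilon>; \<bar>t - \<tau>\<bar> < \<epsilon>; a < s; s \<le> t; t < b; \<forall>\<theta>\<in>{s..t}. L \<theta> \<ge> 0; (N s)\<^sup>2 > crit s\<rbrakk>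
      \<Longrightarrow> (N t)\<^sup>2 > crit t"
proof -
  note r = roots_pos_less_sum[OF \<tau> d]
  have h: "high \<tau> > 0" using r by linarith
  obtain c where c: "branch_entropy high \<tau> < c" "c < branch_entropy low \<tau>"
    using branch_entropy_less[OF assms] dense by blast
  have "isCont (branch_entropy high) \<tau>"
    by (rule isCont_branch_entropy[OF \<tau> isCont_high[OF \<tau>] h p])
  then have "\<forall>\<^sub>F z in at \<tau>. branch_entropy high z < c"
    using c(1) order_tendstoD(2) unfolding isCont_def by blast
  then have 1: "\<forall>\<^sub>F z in nhds \<tau>. branch_entropy high z < c"
    using c(1) by (auto simp: eventually_at_filter elim: eventually_mono)
  have "isCont (branch_entropy low) \<tau>"
    by (rule isCont_branch_entropy[OF \<tau> isCont_low[OF \<tau>] r(1) low_pressure_pos[OF \<tau> d]])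
  then have "\<forall>\<^sub>F z in at \<tau>. c < branch_entropy low z"
    using c(2) order_tendstoD(1) unfolding isCont_def by blast
  then have 2: "\<forall>\<^sub>F z in nhds \<tau>. c < branch_entropy low z"
    using c(2) by (auto simp: eventually_at_filter elim: eventually_mono)
  have "\<forall>\<^sub>F z in at \<tau>. 0 < disc z"
    using d isCont_disc[OF \<tau>] order_tendstoD(1) unfolding isCont_def by blast
  then have 3: "\<forall>\<^sub>F z in nhds \<tau>. 0 < disc z"
    using d by (auto simp: eventually_at_filter elim: eventually_mono)
  obtain \<epsilon> where \<epsilon>: "\<epsilon> > 0" "\<And>z. \<bar>z - \<tau>\<bar> < \<epsilon> \<Longrightarrow>
      branch_entropy high z < c \<and> c < branch_entropy low z \<and> 0 < disc z"
    using eventually_conj[OF 1 eventually_conj[OF 2 3]]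
    by (auto simp: eventually_nhds_metric dist_real_def)
  show ?thesis
  proof (rule that[OF \<epsilon>(1)], rule ccontr)
    fix s t assume st: "\<bar>s - \<tau>\<bar> < \<epsilon>" "\<bar>t - \<tau>\<bar> < \<epsilon>" "a < s" "s \<le> t" "t < b" "\<forall>\<theta>\<in>{s..t}. L \<theta> \<ge> 0"
      and sup: "(N s)\<^sup>2 > crit s" and "\<not> (N t)\<^sup>2 > crit t"
    have s': "s \<in> {a<..<b}" and t': "t \<in> {a<..<b}" using st by auto
    have "N t = low t" using \<open>\<not> (N t)\<^sup>2 > crit t\<close> N_eq_low[OF t'] by simp
    then have "S t = c\<^sub>v * branch_entropy low t + S\<^sub>0" by (rule entropy_eq_branch_entropy[OF t'])
    moreover have "S s = c\<^sub>v * branch_entropy high s + S\<^sub>0"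
      using sup by (intro entropy_eq_branch_entropy s' N_eq_high[OF s']) simp
    moreover have "branch_entropy high s < branch_entropy low t"
      using \<epsilon>(2)[OF st(1)] \<epsilon>(2)[OF st(2)] by linarith
    moreover have "S t \<le> S s"
      by (rule entropy_antimono) (use st in auto)
    ultimately show False using cv by simp
  qed
qed

end

section \<open>The structure of a forward sector\<close>

lemma constant_onI_less:
  fixes I :: "real set"
  assumes "\<And>s t. s \<in> I \<Longrightarrow> t \<in> I \<Longrightarrow> s < t \<Longrightarrow> f s = f t"
  shows "f constant_on I"
  unfolding constant_on_def
proof (cases "I = {}")
  case False
  then obtain z where "z \<in> I" by auto
  then have "\<forall>x\<in>I. f x = f z" using assms by (metis linorder_less_linear)
  then show "\<exists>y. \<forall>x\<in>I. f x = y" by blast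
qed auto

lemma constant_on_imp_isCont:
  fixes \<theta> :: real
  assumes "f constant_on {s<..<t}" "\<theta> \<in> {s<..<t}"
  shows "isCont f \<theta>"
proof -
  obtain c where "\<And>x. x \<in> {s<..<t} \<Longrightarrow> f x = c" using assms(1) by (auto simp: constant_on_def)
  then have "continuous_on {s<..<t} f"
    by (intro continuous_on_eq[OF continuous_on_const[of _ c]]) simp
  then show ?thesis using assms(2) by (simp add: continuous_on_eq_continuous_at)
qed

lemma exactly_one_Nil [simp]: "\<not> exactly_one []"
  by (auto simp: exactly_one_def Ex1_def)

lemma exactly_one_Cons [simp]:
  "exactly_one (P # Ps) \<longleftrightarrow> (if P then True \<notin> set Ps else exactly_one Ps)"
proof (cases P)
  case True
  have "exactly_one (P # Ps) \<longleftrightarrow> True \<notin> set Ps"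
  proof
    assume "exactly_one (P # Ps)"
    then have "i = j" if "i < length (P # Ps)" "(P # Ps) ! i" "j < length (P # Ps)" "(P # Ps) ! j" for i j
      using that unfolding exactly_one_def by blast
    from this[of 0 "Suc _"] True show "True \<notin> set Ps"
      by (auto simp: in_set_conv_nth)
  next
    assume notin: "True \<notin> set Ps"
    have "i = 0" if "i < length (P # Ps)" "(P # Ps) ! i" for i
      using that notin by (cases i) (auto simp: in_set_conv_nth)
    then show "exactly_one (P # Ps)"
      unfolding exactly_one_def using True by (intro ex1I[of _ 0]) auto
  qed
  with True show ?thesis by simp
next
  case False
  have eq: "i < length (P # Ps) \<and> (P # Ps) ! i \<longleftrightarrow> (\<exists>j. i = Suc j \<and> j < length Ps \<and> Ps ! j)" for i
    using False by (cases i) auto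
  show ?thesis
    unfolding exactly_one_def eq using False by (simp add: Ex1_def) blast
qed

lemma exactly_one_five:
  assumes "P1 \<or> P2 \<or> P3 \<or> P4 \<or> P5"
    and "\<not> (P1 \<and> P2)" "\<not> (P1 \<and> P3)" "\<not> (P1 \<and> P4)" "\<not> (P1 \<and> P5)" "\<not> (P2 \<and> P3)"
    "\<not> (P2 \<and> P4)" "\<not> (P2 \<and> P5)" "\<not> (P3 \<and> P4)" "\<not> (P3 \<and> P5)" "\<not> (P4 \<and> P5)"
  shows "exactly_one [P1, P2, P3, P4, P5]"
  using assms by (cases P1; cases P2; cases P3; cases P4; simp)

text \<open>The last entry excludes a shock at \<open>m\<close>: after a reflection of the \<open>\<theta>\<close>-axis the value at a jump is the
  limit from the left, and then \<open>U\<close> may be constant on \<open>]a, m]\<close> in spite of a shock at \<open>m\<close>.\<close>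

definition forward_alternatives ::
    "real \<Rightarrow> (real \<Rightarrow> state) \<Rightarrow> real \<Rightarrow> real \<Rightarrow> bool list" where
  "forward_alternatives \<gamma> U a b = (let m = theta_bar U a b in
     [\<exists>\<theta>\<^sub>0\<in>{a<..<m}. forward_shock U \<theta>\<^sub>0 \<and>
        U constant_on {a<..<\<theta>\<^sub>0} \<and> U constant_on {\<theta>\<^sub>0<..m},
      \<exists>\<alpha> \<beta>. a < \<alpha> \<and> \<alpha> < \<beta> \<and> \<beta> < m \<and> forward_expansion_wave \<gamma> U a b \<alpha> \<beta> \<and>
        U constant_on {a<..<\<alpha>} \<and> U constant_on {\<beta><..m},
      \<exists>\<alpha>\<in>{a<..<m}. forward_expansion_wave \<gamma> U a b \<alpha> m \<and> U constant_on {a<..<\<alpha>},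
      normal_shock U m \<and> U constant_on {a<..<m},
      \<not> shock U m \<and> U constant_on {a<..m}])"

context forward_flow
begin

lemma L_decreasing:
  assumes st: "a < s" "s < t" "t < b"
  shows "L t < L s"
proof -
  have "continuous_on {s..t} massflux"
    using isCont_mass_flux by (intro continuous_at_imp_continuous_on) auto
  then obtain k where k: "k \<in> {s..t}" "\<And>z. z \<in> {s..t} \<Longrightarrow> massflux k \<le> massflux z"
    using continuous_attains_inf[of "{s..t}" massflux] st by auto
  have Fk: "massflux k > 0" using k(1) st by (intro massflux_pos) auto
  have "((\<lambda>z. - N z) has_integral L t - L s) {s..t}"
    using bounded_primitive_on_has_integral[OF L_primitive[of s t]] st by auto
  moreover have "- N z \<le> - (massflux k / K)" if z: "z \<in> {s..t}" for z
  proof -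
    have "N z > 0" using z st by (intro N_pos) auto
    then have "massflux z \<le> K * N z" using density_bounds(2)[of z] by (intro mult_right_mono) auto
    with k(2)[OF z] have "massflux k \<le> K * N z" by linarith
    then show ?thesis using K by (simp add: field_simps)
  qed
  ultimately have "L t - L s \<le> (t - s) * (- (massflux k / K))"
    using has_integral_le[OF _ has_integral_const_real[of "- (massflux k / K)" s t]] st by auto
  also have "\<dots> < 0" using Fk K st by (intro mult_pos_neg) auto
  finally show ?thesis by simp
qed

text \<open>The mass flux vanishes at \<open>a\<close> and \<open>b\<close> and is positive in between, and its derivative has the sign
  of \<open>L\<close>.\<close>

lemma L_sign_ends:
  obtains s t where "s \<in> {a<..<b}" "t \<in> {a<..<b}" "L s > 0" "L t < 0"
proof -
  \<comment> \<open>The value at an interior point would bound the mass flux near \<open>a\<close>, or near \<open>b\<close>, from below.\<close>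
  define z where "z = (a + b) / 2"
  have z: "z \<in> {a<..<b}" using a_less_b by (auto simp: z_def)
  have *: "((\<lambda>\<theta>. rho \<theta> * L \<theta>) has_integral massflux t - massflux s) {s..t}" if "s \<le> t" for s t
    using bounded_primitive_on_has_integral[OF mass_balance[of s t]] that by auto
  have "\<exists>s\<in>{a<..<b}. L s > 0"
  proof (rule ccontr)
    assume "\<not> ?thesis"
    then have neg: "L \<theta> \<le> 0" if "\<theta> \<in> {a<..<b}" for \<theta> using that by force
    have "massflux y \<le> massflux x" if "a < x" "x \<le> y" "y < b" for x y
      using has_integral_le[OF *[OF that(2)] has_integral_0] neg that density_bounds(3)
      by (auto simp: mult_nonneg_nonpos less_imp_le)
    then have "\<forall>\<^sub>F x in at_right a. massflux z \<le> massflux x"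
      using z by (auto simp: eventually_at_right_field intro!: exI[of _ z])
    moreover have "(massflux \<longlongrightarrow> massflux a) (at_right a)"
      using isCont_mass_flux[of a] by (simp add: isCont_def filterlim_at_split)
    ultimately have "massflux z \<le> massflux a"
      by (intro tendsto_lowerbound[of massflux]) auto
    then show False using massflux_pos[OF z] N_a by simp
  qed
  moreover have "\<exists>t\<in>{a<..<b}. L t < 0"
  proof (rule ccontr)
    assume "\<not> ?thesis"
    then have pos: "L \<theta> \<ge> 0" if "\<theta> \<in> {a<..<b}" for \<theta> using that linorder_not_less by blast
    have "massflux x \<le> massflux y" if "a < x" "x \<le> y" "y < b" for x y
      using has_integral_nonneg[OF *[OF that(2)]] pos that density_bounds(3)
      by (auto simp: less_imp_le)
    then have "\<forall>\<^sub>F y in at_left b. massflux z \<le> massflux y"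
      using z by (auto simp: eventually_at_left_field intro!: exI[of _ z])
    moreover have "(massflux \<longlongrightarrow> massflux b) (at_left b)"
      using isCont_mass_flux[of b] by (simp add: isCont_def filterlim_at_split)
    ultimately have "massflux z \<le> massflux b"
      by (intro tendsto_lowerbound[of massflux]) auto
    then show False using massflux_pos[OF z] N_b by simp
  qed
  ultimately show ?thesis using that by blast
qed

abbreviation "m \<equiv> theta_bar U a b"

lemma theta_bar_props: "m \<in> {a<..<b}" "L m = 0"
proof -
  obtain s t where st: "s \<in> {a<..<b}" "t \<in> {a<..<b}" "L s > 0" "L t < 0"
    by (rule L_sign_ends)
  have "s < t"
  proof (rule ccontr)
    assume "\<not> s < t"
    then have "L s \<le> L t" using L_decreasing[of t s] st by (cases "s = t") auto
    then show False using st by simp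
  qed
  have "\<forall>x. s \<le> x \<and> x \<le> t \<longrightarrow> isCont L x" using isCont_L st by auto
  then obtain z where z: "s \<le> z" "z \<le> t" "L z = 0"
    using IVT2[of L t 0 s] st \<open>s < t\<close> by auto
  have "m = z"
    unfolding theta_bar_def
  proof (rule the_equality)
    show "z \<in> {a<..<b} \<and> L z = 0" using z st by auto
    fix y assume "y \<in> {a<..<b} \<and> L y = 0"
    then show "y = z" using L_decreasing[of y z] L_decreasing[of z y] z st
      by (cases y z rule: linorder_cases) auto
  qed
  then show "m \<in> {a<..<b}" "L m = 0" using z st by auto
qed

lemma theta_bar_unique:
  assumes "y \<in> {a<..<b}" "L y = 0"
  shows "y = m"
  using L_decreasing[of y m] L_decreasing[of m y] theta_bar_props assms
  by (cases y m rule: linorder_cases) auto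

lemma L_pos: "a < \<theta> \<Longrightarrow> \<theta> < m \<Longrightarrow> L \<theta> > 0"
  using L_decreasing[of \<theta> m] theta_bar_props by auto

lemma L_nonneg: "a < \<theta> \<Longrightarrow> \<theta> \<le> m \<Longrightarrow> L \<theta> \<ge> 0"
  using L_pos[of \<theta>] theta_bar_props by (cases "\<theta> = m") auto

lemma inside: "a < \<theta> \<Longrightarrow> \<theta> \<le> m \<Longrightarrow> \<theta> \<in> {a<..<b}"
  using theta_bar_props by auto

text \<open>\<open>N\<close> tends to zero at \<open>a\<close> because the mass flux does and the density is bounded below, whereas
  \<open>crit\<close> has a positive lower bound on the phase space.\<close>

lemma subsonic_near_a: "\<exists>\<theta>\<in>{a<..<m}. (N \<theta>)\<^sup>2 < crit \<theta>"
proof -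
  define c0 where "c0 = 2 * \<gamma> * ((\<gamma> - 1) / K\<^sup>2 / K) / (\<gamma> + 1)"
  have c0: "c0 > 0" unfolding c0_def using gamma K by (intro divide_pos_pos mult_pos_pos) auto
  have crit: "c0 \<le> crit \<theta>" for \<theta>
  proof -
    have "(\<gamma> - 1) / K\<^sup>2 / K \<le> pr \<theta> / rho \<theta>"
      using pressure_bounds[of \<theta>] density_bounds[of \<theta>] gamma K by (intro frac_le) auto
    then have "2 * \<gamma> * ((\<gamma> - 1) / K\<^sup>2 / K) \<le> 2 * \<gamma> * (pr \<theta> / rho \<theta>)"
      using gamma by (intro mult_left_mono) auto
    also have "\<dots> \<le> (\<gamma> - 1) * (N \<theta>)\<^sup>2 + 2 * \<gamma> * pr \<theta> / rho \<theta>" using gamma by simp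
    finally show ?thesis unfolding c0_def crit_def using gamma by (intro divide_right_mono) auto
  qed
  have "(massflux \<longlongrightarrow> 0) (at_right a)"
    using isCont_mass_flux[of a] N_a by (simp add: isCont_def filterlim_at_split)
  then have "\<forall>\<^sub>F \<theta> in at_right a. massflux \<theta> < sqrt c0 / K"
    by (rule order_tendstoD) (use c0 K in simp)
  moreover have "\<forall>\<^sub>F \<theta> in at_right a. \<theta> \<in> {a<..<m}"
    using theta_bar_props by (intro eventually_at_right_real) auto
  ultimately have "\<forall>\<^sub>F \<theta> in at_right a. \<theta> \<in> {a<..<m} \<and> massflux \<theta> < sqrt c0 / K"
    by eventually_elim simp
  then obtain \<theta> where \<theta>: "\<theta> \<in> {a<..<m}" "massflux \<theta> < sqrt c0 / K"
    using eventually_happens'[OF trivial_limit_at_right_real] by blast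
  have n: "N \<theta> > 0" using \<theta>(1) theta_bar_props by (intro N_pos) auto
  have "1 / K * N \<theta> \<le> massflux \<theta>" using density_bounds(1) n by (intro mult_right_mono) auto
  then have "N \<theta> / K < sqrt c0 / K" using \<theta>(2) by simp
  then have "N \<theta> < sqrt c0" using K by (simp add: divide_less_cancel)
  then have "(N \<theta>)\<^sup>2 < (sqrt c0)\<^sup>2" using n by (intro power_strict_mono) auto
  then have "(N \<theta>)\<^sup>2 < crit \<theta>" using crit[of \<theta>] c0 by simp
  with \<theta>(1) show ?thesis by blast
qed

text \<open>Consider the first angle \<open>\<tau>\<close> at which supersonic flow ends.  The excess \<open>N\<^sup>2 - crit\<close> has increased up to
  there, so the two roots differ at \<open>\<tau>\<close> and the pressure of the supersonic one is still positive; then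
  \<open>supersonic_stays_locally\<close> applies.\<close>

lemma supersonic_persists:
  assumes s: "a < s" "(N s)\<^sup>2 > crit s" and t: "s \<le> t" "t \<le> m"
  shows "(N t)\<^sup>2 > crit t"
proof (rule ccontr)
  assume nt: "\<not> (N t)\<^sup>2 > crit t"
  define T where "T = {\<theta>\<in>{s..m}. \<not> (N \<theta>)\<^sup>2 > crit \<theta>}"
  have T: "t \<in> T" "bdd_below T" using nt t by (auto simp: T_def)
  define \<tau> where "\<tau> = Inf T"
  have \<tau>: "s \<le> \<tau>" "\<tau> \<le> t"
    unfolding \<tau>_def using T by (auto intro: cInf_greatest cInf_lower simp: T_def)
  have before: "(N z)\<^sup>2 > crit z" if "s \<le> z" "z < \<tau>" for z
  proof (rule ccontr)
    assume "\<not> (N z)\<^sup>2 > crit z"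
    then have "z \<in> T" using that \<tau> t by (auto simp: T_def)
    then show False using cInf_lower[OF _ T(2), of z] that by (simp add: \<tau>_def)
  qed
  have \<tau>': "\<tau> \<in> {a<..<b}" using \<tau> s t by (intro inside) auto
  have *: "disc \<tau> > 0 \<and> normal_momentum \<tau> - massflux \<tau> * high \<tau> > 0"
  proof (cases "\<tau> = s")
    case True
    have "disc \<tau> \<noteq> 0" using disc_eq_0_iff[OF \<tau>'] s True by auto
    then have "disc \<tau> > 0" using disc_nonneg[OF \<tau>'] by linarith
    moreover have "high \<tau> = N \<tau>" using N_eq_high[OF \<tau>'] s True by simp
    moreover have "normal_momentum \<tau> - massflux \<tau> * N \<tau> = pr \<tau>" by (simp add: power2_eq_square)
    ultimately show ?thesis using pressure_bounds(3)[of \<tau>] by (simp only:)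
  next
    case False
    then have st: "s < \<tau>" using \<tau> by simp
    have ev: "\<forall>\<^sub>F z in at_left \<tau>. z \<in> {s<..<\<tau>}"
      using st by (intro eventually_at_left_real)
    have zin: "z \<in> {a<..<b}" if "z \<in> {s<..<\<tau>}" for z using that s \<tau>' by auto
    have hz: "N z = high z" if "z \<in> {s<..<\<tau>}" for z
      using N_eq_high[OF zin[OF that]] before[of z] that by auto
    define \<delta> where "\<delta> = (N s)\<^sup>2 - crit s"
    have "\<delta> \<le> (high z)\<^sup>2 - crit z" if z: "z \<in> {s<..<\<tau>}" for z
    proof -
      have "\<delta> < (N z)\<^sup>2 - crit z"
        unfolding \<delta>_def
      proof (rule excess_increasing)
        show "continuous_on {s..z} N"
          by (rule continuous_on_N) (use s z \<tau>' before in \<open>auto simp: less_imp_le\<close>)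
        show "(N x)\<^sup>2 \<noteq> crit x" if "x \<in> {s<..<z}" for x using before[of x] that z by auto
        show "L x > 0" if "x \<in> {s<..<z}" for x using L_pos[of x] that z s \<tau> t by auto
      qed (use s z \<tau>' in auto)
      then show ?thesis using hz[OF z] by simp
    qed
    moreover have "((\<lambda>z. (high z)\<^sup>2 - crit z) \<longlongrightarrow> (high \<tau>)\<^sup>2 - crit \<tau>) (at_left \<tau>)"
      using isCont_high[OF \<tau>'] isCont_crit[OF \<tau>']
      by (intro tendsto_intros) (auto simp: isCont_def filterlim_at_split)
    ultimately have "\<delta> \<le> (high \<tau>)\<^sup>2 - crit \<tau>"
      using ev by (intro tendsto_lowerbound[where F = "at_left \<tau>"]) (auto elim: eventually_mono)
    then have h: "(high \<tau>)\<^sup>2 > crit \<tau>" using s by (simp add: \<delta>_def)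
    have "disc \<tau> \<noteq> 0"
    proof
      assume d: "disc \<tau> = 0"
      then have "nsum \<tau> = 2 * high \<tau>" by (simp add: high_def)
      moreover have "(nsum \<tau>)\<^sup>2 = 4 * crit \<tau>" using d by (simp add: disc_def)
      ultimately show False using h by (simp add: power2_eq_square)
    qed
    then have "disc \<tau> > 0" using disc_nonneg[OF \<tau>'] by simp
    moreover have "normal_momentum \<tau> - massflux \<tau> * high \<tau> \<ge> (\<gamma> - 1) / K\<^sup>2"
    proof (rule tendsto_lowerbound[where F = "at_left \<tau>"])
      show "((\<lambda>z. normal_momentum z - massflux z * high z) \<longlongrightarrow>
          normal_momentum \<tau> - massflux \<tau> * high \<tau>) (at_left \<tau>)"
        using isCont_high[OF \<tau>'] isCont_mass_flux[of \<tau>] isCont_normal_momentum[of \<tau>]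
        by (intro tendsto_diff tendsto_mult[of massflux]) (auto simp: isCont_def filterlim_at_split)
      have "normal_momentum z - massflux z * high z = pr z" if "z \<in> {s<..<\<tau>}" for z
        unfolding hz[OF that, symmetric] by (simp add: power2_eq_square)
      note eq = this
      show "\<forall>\<^sub>F z in at_left \<tau>. (\<gamma> - 1) / K\<^sup>2 \<le> normal_momentum z - massflux z * high z"
        using ev
      proof eventually_elim
        case (elim z)
        show ?case unfolding eq[OF elim] by (rule pressure_bounds(1))
      qed
    qed simp
    moreover have "(\<gamma> - 1) / K\<^sup>2 > 0" using gamma K by simp
    ultimately show ?thesis by linarith
  qed
  obtain \<epsilon> where \<epsilon>: "\<epsilon> > 0"
    "\<And>s t. \<lbrakk>\<bar>s - \<tau>\<bar> < \<epsilon>; \<bar>t - \<tau>\<bar> < \<epsilon>; a < s; s \<le> t; t < b; \<forall>\<theta>\<in>{s..t}. L \<theta> \<ge> 0; (N s)\<^sup>2 > crit s\<rbrakk>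
      \<Longrightarrow> (N t)\<^sup>2 > crit t"
    using supersonic_stays_locally[OF \<tau>'] * by blast
  obtain z where z: "z \<in> T" "z < \<tau> + \<epsilon>"
    using cInf_lessD[of T "\<tau> + \<epsilon>"] T \<epsilon>(1) by (auto simp: \<tau>_def)
  have z': "\<tau> \<le> z" using cInf_lower[OF z(1) T(2)] by (simp add: \<tau>_def)
  \<comment> \<open>A supersonic angle close to \<open>\<tau>\<close>; \<open>\<tau>\<close> itself is only known to be one if it equals \<open>s\<close>.\<close>
  define y where "y = (if \<tau> = s then s else max s (\<tau> - \<epsilon> / 2))"
  have y: "s \<le> y" "y \<le> \<tau>" "\<bar>y - \<tau>\<bar> < \<epsilon>" "\<tau> = s \<or> y < \<tau>"
    using \<tau> \<epsilon>(1) by (auto simp: y_def max_def)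
  have "(N y)\<^sup>2 > crit y" using y before[of y] s(2) by (auto simp: y_def)
  moreover have "\<forall>\<theta>\<in>{y..z}. L \<theta> \<ge> 0" using L_nonneg y(1) s(1) z(1) by (auto simp: T_def)
  ultimately have "(N z)\<^sup>2 > crit z"
    using y z z' s(1) \<epsilon>(1) theta_bar_props by (intro \<epsilon>(2)[of y z]) (auto simp: T_def)
  then show False using z(1) by (simp add: T_def)
qed

text \<open>Otherwise let \<open>\<tau>\<close> be the last sonic angle before \<open>t\<close>.  From there to \<open>t\<close> the flow is subsonic, hence continuous, and
  its excess would increase from zero to a negative value.\<close>

lemma subsonic_before:
  assumes s: "a < s" "s \<le> t" and t: "t \<le> m" "(N t)\<^sup>2 < crit t"
  shows "(N s)\<^sup>2 < crit s"
proof (rule ccontr)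
  assume ns: "\<not> (N s)\<^sup>2 < crit s"
  have le: "(N z)\<^sup>2 \<le> crit z" if "a < z" "z \<le> t" for z
    using supersonic_persists[of z t] that t by force
  define T where "T = {z\<in>{s..t}. disc z = 0}"
  have "disc s = 0" using disc_eq_0_iff[OF inside[of s]] ns le[of s] s t by auto
  then have "s \<in> T" using s by (simp add: T_def)
  moreover have "compact T"
  proof -
    have "continuous_on {s..t} disc"
      using isCont_disc inside s t by (intro continuous_at_imp_continuous_on) auto
    then have "closed T" unfolding T_def by (intro continuous_closed_preimage_constant) auto
    moreover have "bounded T" by (rule bounded_subset[of "{s..t}"]) (auto simp: T_def)
    ultimately show ?thesis by (simp add: compact_eq_bounded_closed)
  qed
  ultimately obtain \<tau> where \<tau>: "\<tau> \<in> T" "\<And>z. z \<in> T \<Longrightarrow> z \<le> \<tau>"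
    using compact_attains_sup[of T] by blast
  have \<tau>': "a < \<tau>" "\<tau> \<le> t" "disc \<tau> = 0" using \<tau>(1) s by (auto simp: T_def)
  then have eq: "(N \<tau>)\<^sup>2 = crit \<tau>" using disc_eq_0_iff[OF inside[of \<tau>]] t by auto
  then have "\<tau> < t" using t \<tau>' by (cases "\<tau> = t") auto
  have "(N \<tau>)\<^sup>2 - crit \<tau> < (N t)\<^sup>2 - crit t"
  proof (rule excess_increasing)
    show "continuous_on {\<tau>..t} N"
      using le \<tau>' t theta_bar_props by (intro continuous_on_N) auto
    fix z assume z: "z \<in> {\<tau><..<t}"
    show "L z > 0" using L_pos[of z] z \<tau>' t by auto
    have "z \<in> {a<..<b}" using z \<tau>' t by (intro inside) auto
    moreover have "disc z \<noteq> 0"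
    proof
      assume "disc z = 0"
      then have "z \<in> T" using z \<tau>(1) by (auto simp: T_def)
      then show False using \<tau>(2) z by force
    qed
    ultimately show "(N z)\<^sup>2 \<noteq> crit z" using disc_eq_0_iff by blast
  qed (use \<tau>' \<open>\<tau> < t\<close> t theta_bar_props in auto)
  then show False using eq t by simp
qed

lemma sonic_iff:
  assumes "\<theta> \<in> {a<..<b}"
  shows "N \<theta> = sound_speed \<gamma> (U \<theta>) \<longleftrightarrow> (N \<theta>)\<^sup>2 = crit \<theta>"
proof -
  have n: "N \<theta> > 0" by (rule N_pos[OF assms])
  let ?w = "\<gamma> * pr \<theta> / rho \<theta>"
  have balance: "n = w \<longleftrightarrow> (\<gamma> + 1) * n = (\<gamma> - 1) * n + 2 * w" for n w :: real
    by (auto simp: algebra_simps)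
  have w: "?w > 0" using gamma pressure_bounds(3)[of \<theta>] density_bounds(3)[of \<theta>] by simp
  have "N \<theta> = sqrt ?w \<longleftrightarrow> (N \<theta>)\<^sup>2 = ?w"
    using n w by (metis less_imp_le real_sqrt_pow2 real_sqrt_unique)
  also have "\<dots> \<longleftrightarrow> (\<gamma> + 1) * (N \<theta>)\<^sup>2 = (\<gamma> - 1) * (N \<theta>)\<^sup>2 + 2 * ?w"
    by (rule balance)
  also have "\<dots> \<longleftrightarrow> (N \<theta>)\<^sup>2 = crit \<theta>"
    unfolding crit_def using gamma by (subst eq_divide_eq) (auto simp: mult.commute mult.assoc)
  finally show ?thesis by (simp add: sound_speed_def)
qed

text \<open>In a constant state \<open>N' = L > 0\<close>, whereas the sound speed does not change.\<close>

lemma wave_not_constant: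
  assumes wave: "forward_expansion_wave \<gamma> U a b \<alpha> \<beta>"
    and st: "a < s" "\<alpha> \<le> s" "s < t" "t \<le> \<beta>"
    and const: "U constant_on I" "{s<..<t} \<subseteq> I"
  shows False
proof -
  define z where "z = (s + t) / 2"
  have z: "z \<in> {s<..<t}" using st by (auto simp: z_def)
  obtain w where w: "\<And>x. x \<in> {s<..<t} \<Longrightarrow> U x = w"
    using const unfolding constant_on_def by blast
  have "((\<lambda>x. velx w * sin x - vely w * cos x) has_real_derivative velx w * cos z + vely w * sin z) (at z)"
    by (auto intro!: derivative_eq_intros)
  moreover have c: "velx w * sin x - vely w * cos x = sound_speed \<gamma> w" if x: "x \<in> {s<..<t}" for x
  proof -
    have "N x = sound_speed \<gamma> (U x)"
      using wave x st by (auto simp: forward_expansion_wave_def)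
    then show ?thesis using w[OF x] by (simp add: normal_vel_def)
  qed
  have "\<forall>x. \<bar>z - x\<bar> < min (z - s) (t - z) \<longrightarrow>
      velx w * sin z - vely w * cos z = velx w * sin x - vely w * cos x"
  proof (intro allI impI)
    fix x assume "\<bar>z - x\<bar> < min (z - s) (t - z)"
    then have "x \<in> {s<..<t}" by (auto simp: abs_if split: if_splits)
    then show "velx w * sin z - vely w * cos z = velx w * sin x - vely w * cos x"
      using c z by simp
  qed
  ultimately have "velx w * cos z + vely w * sin z = 0"
    using z by (intro DERIV_local_const[where d = "min (z - s) (t - z)"]) auto
  then have "L z = 0" using w[OF z] by (simp add: tang_vel_def)
  moreover have "\<beta> \<le> m" using wave by (simp add: forward_expansion_wave_def)
  then have "L z > 0" using z st by (intro L_pos) auto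
  ultimately show False by simp
qed

lemma wave_not_constant_around:
  assumes wave: "forward_expansion_wave \<gamma> U a b \<alpha> \<beta>" and "a < \<alpha>"
    and const: "U constant_on {a<..<\<theta>}" "U constant_on {\<theta><..m}"
  shows False
proof (cases "\<alpha> < \<theta>")
  case True
  show False
    by (rule wave_not_constant[OF wave _ _ _ _ const(1), of \<alpha> "min \<theta> \<beta>"])
      (use True assms(2) wave in \<open>auto simp: forward_expansion_wave_def\<close>)
next
  case False
  show False
    by (rule wave_not_constant[OF wave _ _ _ _ const(2), of \<alpha> \<beta>])
      (use False assms(2) wave in \<open>auto simp: forward_expansion_wave_def\<close>)
qed

lemma isCont_U_imp_isCont_N:
  assumes "isCont U \<theta>"
  shows "isCont N \<theta>"
proof -
  have "rho \<theta> \<noteq> 0" using density_bounds(3)[of \<theta>] by simp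
  then show ?thesis
    using assms unfolding normal_vel_def[abs_def] velx_def vely_def density_def
    by (intro continuous_intros) auto
qed

lemma left_branch_value:
  assumes "isCont N \<theta>" "\<theta> \<in> {a<..<b}" "s < \<theta>" "isCont r \<theta>" "\<And>z. z \<in> {s<..<\<theta>} \<Longrightarrow> N z = r z"
  shows "N \<theta> = r \<theta>"
proof (rule tendsto_unique[OF trivial_limit_at_left_real])
  show "(N \<longlongrightarrow> N \<theta>) (at_left \<theta>)" using assms(1) by (simp add: isCont_def filterlim_at_split)
  have "(r \<longlongrightarrow> r \<theta>) (at_left \<theta>)" using assms(4) by (simp add: isCont_def filterlim_at_split)
  moreover have "\<forall>\<^sub>F z in at_left \<theta>. r z = N z"
    using eventually_at_left_real[OF assms(3)] by eventually_elim (use assms(5) in simp)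
  ultimately show "(N \<longlongrightarrow> r \<theta>) (at_left \<theta>)" by (rule Lim_transform_eventually)
qed

lemma right_branch_value:
  assumes "isCont N \<theta>" "\<theta> \<in> {a<..<b}" "\<theta> < t" "isCont r \<theta>" "\<And>z. z \<in> {\<theta><..<t} \<Longrightarrow> N z = r z"
  shows "N \<theta> = r \<theta>"
proof (rule tendsto_unique[OF trivial_limit_at_right_real])
  show "(N \<longlongrightarrow> N \<theta>) (at_right \<theta>)" using assms(1) by (simp add: isCont_def filterlim_at_split)
  have "(r \<longlongrightarrow> r \<theta>) (at_right \<theta>)" using assms(4) by (simp add: isCont_def filterlim_at_split)
  moreover have "\<forall>\<^sub>F z in at_right \<theta>. r z = N z"
    using eventually_at_right_real[OF assms(3)] by eventually_elim (use assms(5) in simp)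
  ultimately show "(N \<longlongrightarrow> r \<theta>) (at_right \<theta>)" by (rule Lim_transform_eventually)
qed

lemma forward_shockI:
  assumes "\<theta> \<in> {a<..<b}" "\<not> isCont U \<theta>"
  shows "forward_shock U \<theta>"
proof -
  have "\<forall>\<^sub>F z in nhds \<theta>. z \<in> {a<..<b}"
    using assms(1) by (intro eventually_nhds_in_open) auto
  then have "\<forall>\<^sub>F z in nhds \<theta>. N z > 0" by eventually_elim (rule N_pos)
  with assms(2) show ?thesis by (simp add: forward_shock_def)
qed

lemma constant_on_states:
  assumes "I \<subseteq> {a<..m}"
    and cont: "\<And>s t. s \<in> I \<Longrightarrow> t \<in> I \<Longrightarrow> s < t \<Longrightarrow>
      continuous_on {s..t} N \<and> (\<forall>\<theta>\<in>{s<..<t}. (N \<theta>)\<^sup>2 \<noteq> crit \<theta>)"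
  shows "U constant_on I"
proof (rule constant_onI_less)
  fix s t assume st: "s \<in> I" "t \<in> I" "s < t"
  then have "s \<in> {a<..m}" "t \<in> {a<..m}" using assms(1) by auto
  then show "U s = U t"
    using cont[OF st] st theta_bar_props by (intro constant_between) auto
qed

lemma subsonic_constant:
  assumes "I \<subseteq> {a<..m}" "is_interval I" "\<And>\<theta>. \<theta> \<in> I \<Longrightarrow> (N \<theta>)\<^sup>2 < crit \<theta>"
  shows "U constant_on I"
proof (rule constant_on_states[OF assms(1)])
  fix s t assume st: "s \<in> I" "t \<in> I" "s < t"
  have sub: "{s..t} \<subseteq> I" using st assms(2) by (meson atLeastAtMost_iff mem_is_interval_1_I subsetI)
  have "s \<in> {a<..m}" "t \<in> {a<..m}" using st assms(1) by auto
  then have "continuous_on {s..t} N"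
    using assms(3) sub theta_bar_props by (intro continuous_on_N) (auto intro!: less_imp_le)
  moreover have "(N \<theta>)\<^sup>2 \<noteq> crit \<theta>" if "\<theta> \<in> {s<..<t}" for \<theta>
    using assms(3)[of \<theta>] subsetD[OF sub, of \<theta>] that by auto
  ultimately show "continuous_on {s..t} N \<and> (\<forall>\<theta>\<in>{s<..<t}. (N \<theta>)\<^sup>2 \<noteq> crit \<theta>)" by blast
qed

lemma supersonic_constant:
  assumes "I \<subseteq> {a<..m}" "is_interval I" "\<And>\<theta>. \<theta> \<in> I \<Longrightarrow> (N \<theta>)\<^sup>2 > crit \<theta>"
  shows "U constant_on I"
proof (rule constant_on_states[OF assms(1)])
  fix s t assume st: "s \<in> I" "t \<in> I" "s < t"
  have sub: "{s..t} \<subseteq> I" using st assms(2) by (meson atLeastAtMost_iff mem_is_interval_1_I subsetI)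
  have "s \<in> {a<..m}" "t \<in> {a<..m}" using st assms(1) by auto
  then have "continuous_on {s..t} N"
    using assms(3) sub theta_bar_props by (intro continuous_on_N) (auto intro!: less_imp_le)
  moreover have "(N \<theta>)\<^sup>2 \<noteq> crit \<theta>" if "\<theta> \<in> {s<..<t}" for \<theta>
    using assms(3)[of \<theta>] subsetD[OF sub, of \<theta>] that by auto
  ultimately show "continuous_on {s..t} N \<and> (\<forall>\<theta>\<in>{s<..<t}. (N \<theta>)\<^sup>2 \<noteq> crit \<theta>)" by blast
qed

lemma constant_across_sonic_point:
  assumes \<alpha>: "a < \<alpha>" "\<alpha> \<le> m" "(N \<alpha>)\<^sup>2 = crit \<alpha>"
    and left: "\<And>\<theta>. a < \<theta> \<Longrightarrow> \<theta> < \<alpha> \<Longrightarrow> (N \<theta>)\<^sup>2 < crit \<theta>"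
    and right: "\<And>\<theta>. \<alpha> < \<theta> \<Longrightarrow> \<theta> \<le> m \<Longrightarrow> (N \<theta>)\<^sup>2 > crit \<theta>"
  shows "U constant_on {a<..m}"
proof -
  have mb: "m < b" using theta_bar_props by simp
  have "U \<theta> = U \<alpha>" if \<theta>: "\<theta> \<in> {a<..m}" for \<theta>
  proof (cases \<theta> \<alpha> rule: linorder_cases)
    case less
    have "\<forall>z\<in>{\<theta>..\<alpha>}. (N z)\<^sup>2 \<le> crit z" using left \<alpha>(3) \<theta> by (force simp: le_less)
    then show ?thesis
      using less \<theta> \<alpha> left mb by (intro constant_between continuous_on_N) (auto simp: less_imp_neq)
  next
    case greater
    have "\<forall>z\<in>{\<alpha>..\<theta>}. (N z)\<^sup>2 \<ge> crit z" using right \<alpha>(3) \<theta> by (force simp: le_less)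
    moreover have "(N z)\<^sup>2 \<noteq> crit z" if "z \<in> {\<alpha><..<\<theta>}" for z using right[of z] that \<theta> by auto
    ultimately have "U \<alpha> = U \<theta>"
      using greater \<theta> \<alpha> mb by (intro constant_between continuous_on_N) auto
    then show ?thesis by simp
  qed simp
  then show ?thesis unfolding constant_on_def by blast
qed

lemma disc_pos_nearby:
  assumes "\<theta> \<in> {a<..<b}" "disc \<theta> > 0"
  obtains \<epsilon> where "\<epsilon> > 0" "\<And>z. \<bar>z - \<theta>\<bar> < \<epsilon> \<Longrightarrow> disc z > 0"
proof -
  have "\<forall>\<^sub>F z in at \<theta>. 0 < disc z"
    using assms(2) isCont_disc[OF assms(1)] order_tendstoD(1) unfolding isCont_def by blast
  then have "\<forall>\<^sub>F z in nhds \<theta>. 0 < disc z"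
    using assms(2) by (auto simp: eventually_at_filter elim: eventually_mono)
  then show ?thesis using that by (auto simp: eventually_nhds_metric dist_real_def)
qed

text \<open>Here \<open>\<alpha>\<close> is where the subsonic segment ends and \<open>\<beta>\<close> where the supersonic one begins.  Which alternative holds
  depends on whether the two roots differ at \<open>\<alpha>\<close> (then there is a jump, since the flow cannot be sonic
  right after \<open>\<alpha>\<close>), and otherwise on how \<open>\<alpha>\<close>, \<open>\<beta>\<close> and \<open>m\<close> are situated.\<close>

lemma alternatives_exhaustive:
  "(\<exists>\<theta>\<^sub>0\<in>{a<..<m}. forward_shock U \<theta>\<^sub>0 \<and> U constant_on {a<..<\<theta>\<^sub>0} \<and> U constant_on {\<theta>\<^sub>0<..m}) \<or>
   (\<exists>\<alpha> \<beta>. a < \<alpha> \<and> \<alpha> < \<beta> \<and> \<beta> < m \<and> forward_expansion_wave \<gamma> U a b \<alpha> \<beta> \<and>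
      U constant_on {a<..<\<alpha>} \<and> U constant_on {\<beta><..m}) \<or>
   (\<exists>\<alpha>\<in>{a<..<m}. forward_expansion_wave \<gamma> U a b \<alpha> m \<and> U constant_on {a<..<\<alpha>}) \<or>
   (normal_shock U m \<and> U constant_on {a<..<m}) \<or>
   U constant_on {a<..m}"
  (is "?shock \<or> ?wave \<or> ?wave_to_m \<or> ?normal_shock \<or> ?constant")
proof -
  have mb: "m < b" "a < m" using theta_bar_props by auto
  define A where "A = {\<theta>\<in>{a<..m}. (N \<theta>)\<^sup>2 < crit \<theta>}"
  define \<alpha> where "\<alpha> = Sup A"
  obtain \<theta>1 where "\<theta>1 \<in> {a<..<m}" "(N \<theta>1)\<^sup>2 < crit \<theta>1" using subsonic_near_a by blast
  then have \<theta>1: "\<theta>1 \<in> A" by (simp add: A_def)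
  have bdd: "bdd_above A" by (rule bdd_aboveI[of _ m]) (auto simp: A_def)
  have "\<theta>1 \<le> \<alpha>" unfolding \<alpha>_def by (rule cSup_upper[OF \<theta>1 bdd])
  then have \<alpha>1: "a < \<alpha>" using \<theta>1 unfolding A_def by simp
  have \<alpha>2: "\<alpha> \<le> m" unfolding \<alpha>_def by (rule cSup_least) (use \<theta>1 in \<open>auto simp: A_def\<close>)
  note \<alpha> = \<alpha>1 \<alpha>2
  have sub: "(N \<theta>)\<^sup>2 < crit \<theta>" if "a < \<theta>" "\<theta> < \<alpha>" for \<theta>
  proof -
    have "\<theta> < Sup A" "A \<noteq> {}" using that \<theta>1 by (auto simp: \<alpha>_def)
    then obtain t where t: "t \<in> A" "\<theta> < t" using less_cSupD by blast
    then have "t \<le> m" "(N t)\<^sup>2 < crit t" by (simp_all add: A_def)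
    then show ?thesis using subsonic_before[of \<theta> t] t that by simp
  qed
  have nsub: "(N \<theta>)\<^sup>2 \<ge> crit \<theta>" if "\<alpha> < \<theta>" "\<theta> \<le> m" for \<theta>
  proof (rule ccontr)
    assume "\<not> (N \<theta>)\<^sup>2 \<ge> crit \<theta>"
    then have "\<theta> \<in> A" using that \<alpha> by (simp add: A_def)
    then have "\<theta> \<le> \<alpha>" unfolding \<alpha>_def by (rule cSup_upper[OF _ bdd])
    then show False using that by simp
  qed
  have const_left: "U constant_on {a<..<\<alpha>}"
    by (rule subsonic_constant) (use \<alpha> sub in \<open>auto simp: is_interval_1\<close>)
  have \<alpha>': "\<alpha> \<in> {a<..<b}" by (rule inside[OF \<alpha>])
  have low_left: "N z = low z" if "z \<in> {a<..<\<alpha>}" for z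
    using N_eq_low[OF inside] sub that \<alpha> by (simp add: less_imp_le)
  show ?thesis
  proof (cases "(N m)\<^sup>2 < crit m")
    case True
    then have "U constant_on {a<..m}"
      using subsonic_before[OF _ _ order_refl True]
      by (intro subsonic_constant) (auto simp: is_interval_1)
    then show ?thesis by blast
  next
    case nsub_m: False
    show ?thesis
    proof (cases "disc \<alpha> > 0")
      case True
      then obtain \<epsilon> where \<epsilon>: "\<epsilon> > 0" "\<And>z. \<bar>z - \<alpha>\<bar> < \<epsilon> \<Longrightarrow> disc z > 0"
        using disc_pos_nearby[OF \<alpha>'] by blast
      have low_high: "low \<alpha> < high \<alpha>" by (rule roots_pos_less_sum[OF \<alpha>' True])
      show ?thesis
      proof (cases "\<alpha> = m")
        case eq: True
        have "\<not> isCont U \<alpha>"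
        proof
          assume "isCont U \<alpha>"
          then have "N \<alpha> = low \<alpha>"
            by (intro left_branch_value[OF isCont_U_imp_isCont_N \<alpha>' \<alpha>(1) isCont_low[OF \<alpha>'] low_left])
          moreover have "N \<alpha> = high \<alpha>" using N_eq_high[OF \<alpha>'] nsub_m eq by simp
          ultimately show False using low_high by simp
        qed
        then have "normal_shock U m"
          using forward_shockI[OF \<alpha>'] eq theta_bar_props by (simp add: normal_shock_def shock_def)
        then show ?thesis using const_left eq by blast
      next
        case False
        then have \<alpha>m: "\<alpha> < m" using \<alpha> by simp
        have super: "(N \<theta>)\<^sup>2 > crit \<theta>" if \<theta>: "\<alpha> < \<theta>" "\<theta> \<le> m" for \<theta>
        proof -
          \<comment> \<open>Just after \<open>\<alpha>\<close> the flow is neither subsonic nor sonic; then it stays supersonic.\<close>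
          define s where "s = min \<theta> (\<alpha> + \<epsilon> / 2)"
          have s: "\<alpha> < s" "s \<le> \<theta>" "\<bar>s - \<alpha>\<bar> < \<epsilon>" using \<theta> \<epsilon>(1) by (auto simp: s_def)
          have "disc s \<noteq> 0" using \<epsilon>(2)[OF s(3)] by simp
          then have "(N s)\<^sup>2 \<noteq> crit s" using disc_eq_0_iff[OF inside[of s]] s \<theta> \<alpha> by auto
          then have "(N s)\<^sup>2 > crit s" using nsub[of s] s \<theta> by auto
          then show ?thesis using supersonic_persists[of s \<theta>] s \<theta> \<alpha> by auto
        qed
        have "\<not> isCont U \<alpha>"
        proof
          assume c: "isCont U \<alpha>"
          then have "N \<alpha> = low \<alpha>"
            by (intro left_branch_value[OF isCont_U_imp_isCont_N \<alpha>' \<alpha>(1) isCont_low[OF \<alpha>'] low_left])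
          moreover have "N z = high z" if "z \<in> {\<alpha><..<m}" for z
            using N_eq_high[OF inside[of z]] super[of z] that \<alpha> by (simp add: less_imp_le)
          then have "N \<alpha> = high \<alpha>"
            by (intro right_branch_value[OF isCont_U_imp_isCont_N[OF c] \<alpha>' \<alpha>m isCont_high[OF \<alpha>']])
          ultimately show False using low_high by simp
        qed
        then have "forward_shock U \<alpha>" by (rule forward_shockI[OF \<alpha>'])
        moreover have "U constant_on {\<alpha><..m}"
          by (rule supersonic_constant) (use \<alpha> super in \<open>auto simp: is_interval_1\<close>)
        ultimately show ?thesis using const_left \<alpha> \<alpha>m by auto
      qed
    next
      case False
      then have sonic: "(N \<alpha>)\<^sup>2 = crit \<alpha>"
        using disc_nonneg[OF \<alpha>'] disc_eq_0_iff[OF \<alpha>'] by auto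
      define B where "B = {\<theta>\<in>{\<alpha>..m}. (N \<theta>)\<^sup>2 > crit \<theta>}"
      show ?thesis
      proof (cases "B = {}")
        case True
        then have sonic': "(N \<theta>)\<^sup>2 = crit \<theta>" if "\<theta> \<in> {\<alpha>..m}" for \<theta>
        proof -
          have "(N \<theta>)\<^sup>2 \<le> crit \<theta>" using True that by (auto simp: B_def)
          moreover have "(N \<theta>)\<^sup>2 \<ge> crit \<theta>" using nsub[of \<theta>] sonic that by (cases "\<theta> = \<alpha>") auto
          ultimately show ?thesis by simp
        qed
        show ?thesis
        proof (cases "\<alpha> = m")
          case True
          have ?constant
            by (rule constant_across_sonic_point[OF \<alpha> sonic sub]) (use True in auto)
          then show ?thesis by blast
        next
          case False
          then have "\<alpha> < m" using \<alpha> by simp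
          moreover have "forward_expansion_wave \<gamma> U a b \<alpha> m"
            unfolding forward_expansion_wave_def
            using \<alpha> \<open>\<alpha> < m\<close> sonic' sonic_iff[OF inside] L_nonneg by auto
          ultimately have ?wave_to_m using \<alpha> const_left by auto
          then show ?thesis by blast
        qed
      next
        case False
        define \<beta> where "\<beta> = Inf B"
        have bddB: "bdd_below B" by (rule bdd_belowI[of _ \<alpha>]) (auto simp: B_def)
        have \<beta>: "\<alpha> \<le> \<beta>" unfolding \<beta>_def using False by (intro cInf_greatest) (auto simp: B_def)
        have super: "(N \<theta>)\<^sup>2 > crit \<theta>" if "\<beta> < \<theta>" "\<theta> \<le> m" for \<theta>
        proof -
          have "Inf B < \<theta>" using that by (simp add: \<beta>_def)
          then obtain s where s: "s \<in> B" "s < \<theta>" using cInf_lessD[OF False] by blast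
          then have "a < s" "(N s)\<^sup>2 > crit s" using \<alpha> by (simp_all add: B_def)
          then show ?thesis using supersonic_persists[of s \<theta>] s that by simp
        qed
        obtain s0 where s0: "s0 \<in> B" using False by blast
        have "\<beta> \<le> s0" unfolding \<beta>_def by (rule cInf_lower[OF s0 bddB])
        moreover have "s0 \<le> m" using s0 by (simp add: B_def)
        ultimately have "\<beta> \<le> m" by simp
        then have \<beta>': "\<beta> \<in> {a<..<b}" using \<alpha> \<beta> by (intro inside) auto
        have before: "(N \<theta>)\<^sup>2 = crit \<theta>" if "\<alpha> \<le> \<theta>" "\<theta> < \<beta>" for \<theta>
        proof -
          have "\<theta> \<notin> B" using cInf_lower[OF _ bddB, of \<theta>] that by (auto simp: \<beta>_def)
          then have "(N \<theta>)\<^sup>2 \<le> crit \<theta>" using that \<open>\<beta> \<le> m\<close> by (simp add: B_def)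
          moreover have "(N \<theta>)\<^sup>2 \<ge> crit \<theta>"
            using nsub[of \<theta>] sonic that \<open>\<beta> \<le> m\<close> by (cases "\<theta> = \<alpha>") auto
          ultimately show ?thesis by simp
        qed
        have "disc \<beta> = 0"
        proof (rule ccontr)
          assume "disc \<beta> \<noteq> 0"
          then obtain \<epsilon> where \<epsilon>: "\<epsilon> > 0" "\<And>z. \<bar>z - \<beta>\<bar> < \<epsilon> \<Longrightarrow> disc z > 0"
            using disc_pos_nearby[OF \<beta>'] disc_nonneg[OF \<beta>'] by (metis less_le)
          have "\<alpha> \<noteq> \<beta>" using \<open>disc \<beta> \<noteq> 0\<close> disc_eq_0_iff[OF \<alpha>'] sonic by auto
          \<comment> \<open>A sonic angle so close to \<open>\<beta>\<close> that the roots would have to differ there.\<close>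
          define z where "z = max \<alpha> (\<beta> - \<epsilon> / 2)"
          have z: "\<alpha> \<le> z" "z < \<beta>" "\<bar>z - \<beta>\<bar> < \<epsilon>"
            using \<beta> \<open>\<alpha> \<noteq> \<beta>\<close> \<epsilon>(1) by (auto simp: z_def)
          have "z \<in> {a<..<b}" using z \<alpha> \<open>\<beta> \<le> m\<close> by (intro inside) auto
          then show False using before[OF z(1,2)] \<epsilon>(2)[OF z(3)] disc_eq_0_iff[of z] by auto
        qed
        then have sonic_\<beta>: "(N \<beta>)\<^sup>2 = crit \<beta>" using disc_eq_0_iff[OF \<beta>'] by simp
        have "\<beta> < m"
        proof (rule ccontr)
          assume "\<not> \<beta> < m"
          then have "\<beta> = m" using \<open>\<beta> \<le> m\<close> by simp
          have "a < s0" "(N s0)\<^sup>2 > crit s0" using s0 \<alpha> by (simp_all add: B_def)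
          then have "(N m)\<^sup>2 > crit m" using supersonic_persists[of s0 m] \<open>s0 \<le> m\<close> by simp
          then show False using sonic_\<beta> \<open>\<beta> = m\<close> by simp
        qed
        have const_right: "U constant_on {\<beta><..m}"
          by (rule supersonic_constant) (use \<alpha> \<beta> super in \<open>auto simp: is_interval_1\<close>)
        show ?thesis
        proof (cases "\<alpha> = \<beta>")
          case True
          have ?constant
            by (rule constant_across_sonic_point[OF \<alpha> sonic sub]) (use True super in auto)
          then show ?thesis by blast
        next
          case False
          then have "\<alpha> < \<beta>" using \<beta> by simp
          have "(N \<theta>)\<^sup>2 = crit \<theta>" if "\<theta> \<in> {\<alpha>..\<beta>}" for \<theta>
            using before[of \<theta>] sonic_\<beta> that by (cases "\<theta> = \<beta>") auto
          then have "forward_expansion_wave \<gamma> U a b \<alpha> \<beta>"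
            unfolding forward_expansion_wave_def
            using \<alpha> \<open>\<alpha> < \<beta>\<close> \<open>\<beta> < m\<close> sonic_iff[OF inside] L_nonneg by auto
          then have ?wave using \<alpha> \<open>\<alpha> < \<beta>\<close> \<open>\<beta> < m\<close> const_left const_right by blast
          then show ?thesis by blast
        qed
      qed
    qed
  qed
qed

theorem exactly_one_forward_alternative: "exactly_one (forward_alternatives \<gamma> U a b)"
proof -
  define shock_inside where "shock_inside \<longleftrightarrow> (\<exists>\<theta>\<^sub>0\<in>{a<..<m}. forward_shock U \<theta>\<^sub>0 \<and>
    U constant_on {a<..<\<theta>\<^sub>0} \<and> U constant_on {\<theta>\<^sub>0<..m})"
  define wave_inside where "wave_inside \<longleftrightarrow> (\<exists>\<alpha> \<beta>. a < \<alpha> \<and> \<alpha> < \<beta> \<and> \<beta> < m \<and>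
    forward_expansion_wave \<gamma> U a b \<alpha> \<beta> \<and> U constant_on {a<..<\<alpha>} \<and> U constant_on {\<beta><..m})"
  define wave_to_m where "wave_to_m \<longleftrightarrow>
    (\<exists>\<alpha>\<in>{a<..<m}. forward_expansion_wave \<gamma> U a b \<alpha> m \<and> U constant_on {a<..<\<alpha>})"
  define uniform where "uniform \<longleftrightarrow> U constant_on {a<..<m}"
  have some: "shock_inside \<or> wave_inside \<or> wave_to_m \<or> normal_shock U m \<and> uniform \<or> U constant_on {a<..m}"
    using alternatives_exhaustive
    unfolding shock_inside_def wave_inside_def wave_to_m_def uniform_def .
  have closed_const: "uniform" if "U constant_on {a<..m}"
    using that unfolding uniform_def by (rule constant_on_subset) auto
  have normal: "normal_shock U m" if "shock U m"
    using that theta_bar_props by (simp add: normal_shock_def)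
  have no_wave: False if "forward_expansion_wave \<gamma> U a b \<alpha> \<beta>" "a < \<alpha>" uniform for \<alpha> \<beta>
    by (rule wave_not_constant[OF that(1), of \<alpha> \<beta> "{a<..<m}"])
      (use that in \<open>auto simp: forward_expansion_wave_def uniform_def\<close>)
  have d1: "\<not> (shock_inside \<and> uniform)"
  proof
    assume "shock_inside \<and> uniform"
    then obtain \<theta> where "\<theta> \<in> {a<..<m}" "forward_shock U \<theta>" uniform
      by (auto simp: shock_inside_def)
    then show False
      using constant_on_imp_isCont[of U a m \<theta>] by (auto simp: uniform_def forward_shock_def)
  qed
  have d2: "\<not> (wave_inside \<and> uniform)" "\<not> (wave_to_m \<and> uniform)"
    using no_wave by (auto simp: wave_inside_def wave_to_m_def)
  have d3: "\<not> (shock_inside \<and> wave_inside)" "\<not> (shock_inside \<and> wave_to_m)"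
    unfolding shock_inside_def wave_inside_def wave_to_m_def Bex_def greaterThanLessThan_iff
    using wave_not_constant_around by blast+
  have d4: "\<not> (wave_inside \<and> wave_to_m)"
  proof
    assume "wave_inside \<and> wave_to_m"
    then have "wave_inside" "wave_to_m" by auto
    from \<open>wave_inside\<close> obtain \<beta> where \<beta>: "a < \<beta>" "\<beta> < m" "U constant_on {\<beta><..m}"
      unfolding wave_inside_def by (meson less_trans)
    from \<open>wave_to_m\<close> obtain \<alpha> where \<alpha>: "a < \<alpha>" "\<alpha> < m" "forward_expansion_wave \<gamma> U a b \<alpha> m"
      unfolding wave_to_m_def by auto
    show False
      by (rule wave_not_constant[OF \<alpha>(3), of "max \<alpha> \<beta>" m "{\<beta><..m}"]) (use \<alpha> \<beta> in auto)
  qed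
  have eq: "forward_alternatives \<gamma> U a b = [shock_inside, wave_inside, wave_to_m,
      normal_shock U m \<and> uniform, \<not> shock U m \<and> U constant_on {a<..m}]"
    by (simp add: forward_alternatives_def Let_def shock_inside_def wave_inside_def wave_to_m_def uniform_def)
  have shock: "shock U m" if "normal_shock U m" using that by (simp add: normal_shock_def)
  show ?thesis
    unfolding eq
    by (rule exactly_one_five) (use some d1 d2 d3 d4 closed_const normal shock in blast)+
qed

end

section \<open>Reflection in the horizontal axis\<close>

definition reflect_vec :: "real ^ 4 \<Rightarrow> real ^ 4" where
  "reflect_vec w = vector [w $ 1, w $ 2, - (w $ 3), w $ 4]"

text \<open>The reflection reverses the second velocity component and the polar angle, so it maps \<open>N\<close> to \<open>- N\<close> and
  preserves \<open>L\<close>.\<close>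

definition reflect_solution :: "(real \<Rightarrow> state) \<Rightarrow> real \<Rightarrow> state" where
  "reflect_solution U \<theta> = reflect_vec (U (- \<theta>))"

lemma reflect_vec_nth [simp]:
  "reflect_vec w $ 1 = w $ 1" "reflect_vec w $ 2 = w $ 2"
  "reflect_vec w $ 3 = - (w $ 3)" "reflect_vec w $ 4 = w $ 4"
  by (simp_all add: reflect_vec_def)

lemma reflect_vec_involution [simp]: "reflect_vec (reflect_vec w) = w"
  by (simp add: vec_eq_iff forall_4)

lemma bounded_linear_reflect_vec: "bounded_linear reflect_vec"
  by (intro linear_conv_bounded_linear[THEN iffD1] linearI) (simp_all add: vec_eq_iff forall_4)

lemma reflect_state [simp]:
  "density (reflect_vec w) = density w" "velx (reflect_vec w) = velx w"
  "vely (reflect_vec w) = - vely w" "energy (reflect_vec w) = energy w"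
  "internal_energy (reflect_vec w) = internal_energy w"
  "pressure \<gamma> (reflect_vec w) = pressure \<gamma> w"
  "sound_speed \<gamma> (reflect_vec w) = sound_speed \<gamma> w"
  "entropy \<gamma> c\<^sub>v S\<^sub>0 (reflect_vec w) = entropy \<gamma> c\<^sub>v S\<^sub>0 w"
  by (simp_all add: density_def velx_def vely_def energy_def internal_energy_def pressure_def
      sound_speed_def entropy_def)

lemma reflect_flux:
  "flux_x \<gamma> (reflect_vec w) = reflect_vec (flux_x \<gamma> w)"
  "flux_y \<gamma> (reflect_vec w) = - reflect_vec (flux_y \<gamma> w)"
  by (simp_all add: vec_eq_iff forall_4 flux_x_def flux_y_def Let_def)

lemma reflect_in_phase_space: "w \<in> phase_space K \<Longrightarrow> reflect_vec w \<in> phase_space K"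
  by (simp add: phase_space_def norm_vec_def L2_set_def sum_4)

lemma reflect_velocities [simp]:
  "normal_vel (reflect_solution U) \<theta> = - normal_vel U (- \<theta>)"
  "tang_vel (reflect_solution U) \<theta> = tang_vel U (- \<theta>)"
  by (simp_all add: normal_vel_def tang_vel_def reflect_solution_def)

lemma set_lebesgue_integral_reflect:
  fixes f :: "real \<Rightarrow> 'a :: euclidean_space"
  shows "(LINT \<eta>:{s..t}|lebesgue. f (- \<eta>)) = (LINT \<eta>:{-t..-s}|lebesgue. f \<eta>)"
proof -
  have "indicator {s..t} \<eta> = (indicator {-t..-s} (- \<eta>) :: real)" for \<eta>
    by (auto simp: indicator_def)
  then show ?thesis
    unfolding set_lebesgue_integral_def
    using lebesgue_integral_real_affine[of "-1" "\<lambda>\<eta>. indicator {-t..-s} \<eta> *\<^sub>R f \<eta>" 0] by simp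
qed

text \<open>The flux through the ray changes sign and its two end angles are interchanged, so the equation and also
  the direction of the entropy inequality are preserved.\<close>

lemma steady_entropy_solution_reflect:
  assumes "steady_entropy_solution \<gamma> c\<^sub>v S\<^sub>0 K U"
  shows "steady_entropy_solution \<gamma> c\<^sub>v S\<^sub>0 K (reflect_solution U)"
  unfolding steady_entropy_solution_def
proof (intro conjI allI impI)
  let ?V = "reflect_solution U"
  interpret reflect: bounded_linear reflect_vec by (rule bounded_linear_reflect_vec)
  have "(\<lambda>\<theta>. - \<theta>) \<in> lebesgue \<rightarrow>\<^sub>M (lebesgue :: real measure)"
    using lebesgue_measurable_scaling[of "-1 :: real"] by (simp add: scaleR_minus_left[abs_def])
  moreover have "U \<in> borel_measurable lebesgue" using assms by (simp add: steady_entropy_solution_def)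
  moreover have "reflect_vec \<in> borel_measurable borel"
    by (intro borel_measurable_continuous_onI linear_continuous_on bounded_linear_reflect_vec)
  ultimately show "?V \<in> borel_measurable lebesgue"
    unfolding reflect_solution_def[abs_def] by measurable
  show "?V (\<theta> + 2 * pi) = ?V \<theta>" for \<theta>
  proof -
    have "U (- \<theta> - 2 * pi + 2 * pi) = U (- \<theta> - 2 * pi)"
      using assms unfolding steady_entropy_solution_def by blast
    then show ?thesis by (simp add: reflect_solution_def)
  qed
  show "?V \<theta> \<in> phase_space K" for \<theta>
    using assms by (auto simp: steady_entropy_solution_def reflect_solution_def intro: reflect_in_phase_space)
next
  fix t1 t2 :: real assume "t1 < t2"
  then have less: "- t2 < - t1" by simp
  let ?V = "reflect_solution U"
  interpret reflect: bounded_linear reflect_vec by (rule bounded_linear_reflect_vec)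
  let ?F = "\<lambda>U \<theta>. sin \<theta> *\<^sub>R flux_x \<gamma> (U \<theta>) - cos \<theta> *\<^sub>R flux_y \<gamma> (U \<theta>)"
  let ?G = "\<lambda>U \<theta>. cos \<theta> *\<^sub>R flux_x \<gamma> (U \<theta>) + sin \<theta> *\<^sub>R flux_y \<gamma> (U \<theta>)"
  have F: "?F ?V \<theta> = - reflect_vec (?F U (- \<theta>))" for \<theta>
    by (simp add: reflect_solution_def reflect_flux reflect.diff reflect.scaleR reflect.neg)
  have G: "?G ?V \<theta> = reflect_vec (?G U (- \<theta>))" for \<theta>
    by (simp add: reflect_solution_def reflect_flux reflect.diff reflect.add reflect.scaleR reflect.neg)
  have "(LINT \<eta>:{t1..t2}|lebesgue. ?G ?V \<eta>) = (LINT \<eta>:{-t2..-t1}|lebesgue. reflect_vec (?G U \<eta>))"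
    unfolding G by (rule set_lebesgue_integral_reflect)
  also have "\<dots> = reflect_vec (LINT \<eta>:{-t2..-t1}|lebesgue. ?G U \<eta>)"
    unfolding set_lebesgue_integral_def reflect.scaleR[symmetric]
    by (rule integral_bounded_linear'[OF bounded_linear_reflect_vec bounded_linear_reflect_vec]) simp
  also have "(LINT \<eta>:{-t2..-t1}|lebesgue. ?G U \<eta>) = ?F U (- t1) - ?F U (- t2)"
    using assms less unfolding steady_entropy_solution_def by (blast intro: sym)
  finally show "?F ?V t2 - ?F ?V t1 = (LINT \<eta>:{t1..t2}|lebesgue. ?G ?V \<eta>)"
    unfolding F by (simp only: reflect.diff) simp
next
  fix t1 t2 :: real assume "t1 < t2"
  then have less: "- t2 < - t1" by simp
  let ?V = "reflect_solution U"
  let ?F = "\<lambda>U \<theta>. sin \<theta> * entropy_flux_x \<gamma> c\<^sub>v S\<^sub>0 (U \<theta>) - cos \<theta> * entropy_flux_y \<gamma> c\<^sub>v S\<^sub>0 (U \<theta>)"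
  let ?G = "\<lambda>U \<theta>. cos \<theta> * entropy_flux_x \<gamma> c\<^sub>v S\<^sub>0 (U \<theta>) + sin \<theta> * entropy_flux_y \<gamma> c\<^sub>v S\<^sub>0 (U \<theta>)"
  have F: "?F ?V \<theta> = - ?F U (- \<theta>)" and G: "?G ?V \<theta> = ?G U (- \<theta>)" for \<theta>
    by (simp_all add: reflect_solution_def entropy_flux_x_def entropy_flux_y_def)
  have "?F U (- t1) - ?F U (- t2) \<le> (LINT \<eta>:{-t2..-t1}|lebesgue. ?G U \<eta>)"
    using assms less unfolding steady_entropy_solution_def by blast
  also have "\<dots> = (LINT \<eta>:{t1..t2}|lebesgue. ?G ?V \<eta>)"
    unfolding G by (rule set_lebesgue_integral_reflect[symmetric])
  finally show "?F ?V t2 - ?F ?V t1 \<le> (LINT \<eta>:{t1..t2}|lebesgue. ?G ?V \<eta>)"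
    unfolding F by simp
qed

lemma isCont_reflect: "isCont (reflect_solution U) \<theta> \<longleftrightarrow> isCont U (- \<theta>)"
proof -
  have cont: "isCont reflect_vec w" for w
    by (rule linear_continuous_at[OF bounded_linear_reflect_vec])
  have *: "isCont (reflect_solution V) \<theta>" if "isCont V (- \<theta>)" for V and \<theta> :: real
  proof -
    have "isCont (\<lambda>\<theta>. V (- \<theta>)) \<theta>"
      by (rule isCont_o2[where g = V]) (use that in \<open>auto intro!: continuous_intros\<close>)
    then show ?thesis
      unfolding reflect_solution_def[abs_def] by (rule isCont_o2[OF _ cont])
  qed
  have "reflect_solution (reflect_solution U) = U" by (simp add: reflect_solution_def fun_eq_iff)
  then show ?thesis using *[where V = U and \<theta> = \<theta>] *[where V = "reflect_solution U" and \<theta> = "- \<theta>"] by auto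
qed

lemma eventually_nhds_minus: "(\<forall>\<^sub>F x in nhds \<theta>. P (- x)) \<longleftrightarrow> (\<forall>\<^sub>F x in nhds (- \<theta> :: real). P x)"
proof -
  have *: "\<forall>\<^sub>F x in nhds \<theta>. P (- x)" if "\<forall>\<^sub>F x in nhds (- \<theta>). P x" for P and \<theta> :: real
  proof -
    have "filterlim uminus (nhds (- \<theta>)) (nhds \<theta>)" by (intro tendsto_minus filterlim_ident)
    with that show ?thesis by (rule eventually_compose_filterlim)
  qed
  show ?thesis using *[where P = P] *[where P = "\<lambda>x. P (- x)" and \<theta> = "- \<theta>"] by auto
qed


lemma reflect_shocks [simp]:
  "forward_shock (reflect_solution U) \<theta> \<longleftrightarrow> backward_shock U (- \<theta>)"
  "backward_shock (reflect_solution U) \<theta> \<longleftrightarrow> forward_shock U (- \<theta>)"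
  using eventually_nhds_minus[of "\<lambda>x. normal_vel U x < 0" \<theta>] eventually_nhds_minus[of "\<lambda>x. 0 < normal_vel U x" \<theta>]
  by (simp_all add: forward_shock_def backward_shock_def isCont_reflect)

lemma reflect_normal_shock [simp]:
  "shock (reflect_solution U) \<theta> \<longleftrightarrow> shock U (- \<theta>)"
  "normal_shock (reflect_solution U) \<theta> \<longleftrightarrow> normal_shock U (- \<theta>)"
  by (auto simp: shock_def normal_shock_def)

lemma reflect_constant_on: "reflect_solution U constant_on I \<longleftrightarrow> U constant_on (uminus ` I)"
  unfolding constant_on_def reflect_solution_def by (auto, metis reflect_vec_involution)

lemma ex_minus: "(\<exists>x :: real. P x) \<longleftrightarrow> (\<exists>x. P (- x))"
  by (metis minus_minus)

lemma all_minus: "(\<forall>x :: real. P x) \<longleftrightarrow> (\<forall>x. P (- x))"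
  by (metis minus_minus)

lemma reflect_expansion_wave:
  assumes "theta_bar (reflect_solution U) (- b) (- a) = - theta_bar U a b"
  shows "forward_expansion_wave \<gamma> (reflect_solution U) (- b) (- a) (- \<beta>) (- \<alpha>)
    \<longleftrightarrow> backward_expansion_wave \<gamma> U a b \<alpha> \<beta>"
proof -
  have "sound_speed \<gamma> (reflect_solution U \<theta>) = sound_speed \<gamma> (U (- \<theta>))" for \<theta>
    by (simp add: reflect_solution_def)
  then show ?thesis
    unfolding forward_expansion_wave_def backward_expansion_wave_def assms Ball_def
    by (subst all_minus) (auto simp: minus_equation_iff)
qed

lemma forward_flow_of_sector:
  assumes "steady_flow \<gamma> c\<^sub>v S\<^sub>0 K U" "forward_sector U a b"
  shows "forward_flow \<gamma> c\<^sub>v S\<^sub>0 K U a b"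
proof -
  interpret steady_flow \<gamma> c\<^sub>v S\<^sub>0 K U by (rule assms(1))
  show ?thesis
    by unfold_locales
      (use assms(2) in \<open>force simp: forward_sector_def sector_def order.order_iff_strict\<close>)+
qed

lemma steady_flow_reflect:
  assumes "steady_flow \<gamma> c\<^sub>v S\<^sub>0 K U"
  shows "steady_flow \<gamma> c\<^sub>v S\<^sub>0 K (reflect_solution U)"
proof -
  interpret steady_flow \<gamma> c\<^sub>v S\<^sub>0 K U by (rule assms)
  show ?thesis
    by unfold_locales (use gamma cv K steady_entropy_solution_reflect[OF solution] in auto)
qed

lemma forward_flow_of_backward_sector:
  assumes "steady_flow \<gamma> c\<^sub>v S\<^sub>0 K U" "backward_sector U a b"
  shows "forward_flow \<gamma> c\<^sub>v S\<^sub>0 K (reflect_solution U) (- b) (- a)"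
proof -
  interpret steady_flow \<gamma> c\<^sub>v S\<^sub>0 K "reflect_solution U" by (rule steady_flow_reflect[OF assms(1)])
  show ?thesis
  proof
    fix \<theta> assume "\<theta> \<in> {- b<..<- a}"
    then have "- \<theta> \<in> {a<..<b}" by auto
    then have "normal_vel U (- \<theta>) \<noteq> 0" "normal_vel U (- \<theta>) \<le> 0"
      using assms(2) by (auto simp: backward_sector_def sector_def)
    then show "normal_vel (reflect_solution U) \<theta> > 0" by simp
  qed (use assms(2) in \<open>auto simp: backward_sector_def sector_def\<close>)
qed

lemma reflect_forward_alternatives:
  assumes "forward_flow \<gamma> c\<^sub>v S\<^sub>0 K (reflect_solution U) (- b) (- a)"
  shows "forward_alternatives \<gamma> (reflect_solution U) (- b) (- a) = (let m = theta_bar U a b in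
    [\<exists>\<theta>\<^sub>0\<in>{m<..<b}. backward_shock U \<theta>\<^sub>0 \<and>
       U constant_on {m..<\<theta>\<^sub>0} \<and> U constant_on {\<theta>\<^sub>0<..<b},
     \<exists>\<alpha> \<beta>. m < \<alpha> \<and> \<alpha> < \<beta> \<and> \<beta> < b \<and> backward_expansion_wave \<gamma> U a b \<alpha> \<beta> \<and>
       U constant_on {m..<\<alpha>} \<and> U constant_on {\<beta><..<b},
     \<exists>\<beta>\<in>{m<..<b}. backward_expansion_wave \<gamma> U a b m \<beta> \<and> U constant_on {\<beta><..<b},
     normal_shock U m \<and> U constant_on {m<..<b},
     \<not> shock U m \<and> U constant_on {m..<b}])"
proof -
  interpret R: forward_flow \<gamma> c\<^sub>v S\<^sub>0 K "reflect_solution U" "- b" "- a" by (rule assms)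
  define m where "m = theta_bar U a b"
  have m: "theta_bar (reflect_solution U) (- b) (- a) = - theta_bar U a b"
  proof -
    have "theta_bar U a b = - theta_bar (reflect_solution U) (- b) (- a)"
      unfolding theta_bar_def[of U]
    proof (rule the_equality)
      show "- R.m \<in> {a<..<b} \<and> tang_vel U (- R.m) = 0"
        using R.theta_bar_props by auto
      fix y assume "y \<in> {a<..<b} \<and> tang_vel U y = 0"
      then show "y = - R.m" using R.theta_bar_unique[of "- y"] by auto
    qed
    then show ?thesis by simp
  qed
  note wave = reflect_expansion_wave[OF m]
  have "(\<exists>\<theta>\<^sub>0\<in>{- b<..<- m}. forward_shock (reflect_solution U) \<theta>\<^sub>0 \<and>
      reflect_solution U constant_on {- b<..<\<theta>\<^sub>0} \<and> reflect_solution U constant_on {\<theta>\<^sub>0<..- m}) \<longleftrightarrow>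
    (\<exists>\<theta>\<^sub>0\<in>{m<..<b}. backward_shock U \<theta>\<^sub>0 \<and> U constant_on {m..<\<theta>\<^sub>0} \<and> U constant_on {\<theta>\<^sub>0<..<b})"
    unfolding Bex_def by (subst ex_minus) (auto simp: reflect_constant_on)
  moreover have "(\<exists>\<alpha> \<beta>. - b < \<alpha> \<and> \<alpha> < \<beta> \<and> \<beta> < - m \<and>
      forward_expansion_wave \<gamma> (reflect_solution U) (- b) (- a) \<alpha> \<beta> \<and>
      reflect_solution U constant_on {- b<..<\<alpha>} \<and> reflect_solution U constant_on {\<beta><..- m}) \<longleftrightarrow>
    (\<exists>\<alpha> \<beta>. m < \<alpha> \<and> \<alpha> < \<beta> \<and> \<beta> < b \<and> backward_expansion_wave \<gamma> U a b \<alpha> \<beta> \<and>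
      U constant_on {m..<\<alpha>} \<and> U constant_on {\<beta><..<b})"
    (is "?l \<longleftrightarrow> ?r")
  proof -
    have "?l \<longleftrightarrow> (\<exists>\<beta> \<alpha>. - b < - \<beta> \<and> - \<beta> < - \<alpha> \<and> - \<alpha> < - m \<and>
      forward_expansion_wave \<gamma> (reflect_solution U) (- b) (- a) (- \<beta>) (- \<alpha>) \<and>
      reflect_solution U constant_on {- b<..<- \<beta>} \<and> reflect_solution U constant_on {- \<alpha><..- m})"
      by (subst ex_minus, subst (2) ex_minus) (rule refl)
    also have "\<dots> \<longleftrightarrow> ?r"
      unfolding wave reflect_constant_on by auto
    finally show ?thesis .
  qed
  moreover have "(\<exists>\<alpha>\<in>{- b<..<- m}. forward_expansion_wave \<gamma> (reflect_solution U) (- b) (- a) \<alpha> (- m) \<and>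
      reflect_solution U constant_on {- b<..<\<alpha>}) \<longleftrightarrow>
    (\<exists>\<beta>\<in>{m<..<b}. backward_expansion_wave \<gamma> U a b m \<beta> \<and> U constant_on {\<beta><..<b})"
    unfolding Bex_def by (subst ex_minus) (auto simp: reflect_constant_on wave)
  ultimately show ?thesis
    unfolding forward_alternatives_def Let_def m m_def[symmetric]
    by (simp only: reflect_normal_shock reflect_constant_on image_uminus_greaterThanAtMost
        image_uminus_greaterThanLessThan minus_minus)
qed

text \<open>A constant state on the left that includes its right end point supplies the limit from the left.\<close>

lemma right_continuous_constant_imp_isCont:
  assumes "right_continuous U" "U constant_on {s<..t}" "s < t"
  shows "isCont U t"
proof -
  obtain c where c: "\<And>x. x \<in> {s<..t} \<Longrightarrow> U x = c" using assms(2) by (auto simp: constant_on_def)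
  have "((\<lambda>_. c) \<longlongrightarrow> U t) (at_left t)" using c[of t] assms(3) by simp
  moreover have "\<forall>\<^sub>F x in at_left t. c = U x"
    using eventually_at_left_real[OF assms(3)] by eventually_elim (use c in simp)
  ultimately have "(U \<longlongrightarrow> U t) (at_left t)" by (rule Lim_transform_eventually)
  moreover have "(U \<longlongrightarrow> U t) (at_right t)"
    using assms(1) by (simp add: right_continuous_def continuous_within)
  ultimately show ?thesis by (simp add: isCont_def filterlim_at_split)
qed

section \<open>The structure of forward and backward sectors\<close>

theorem theorem8:
  fixes \<gamma> c\<^sub>v S\<^sub>0 K :: real and U :: "real \<Rightarrow> state"
  assumes "\<gamma> > 1" and "c\<^sub>v > 0" and "K > 1"
    and "steady_entropy_solution \<gamma> c\<^sub>v S\<^sub>0 K U"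
    and "no_stagnation_points U"
    and "right_continuous U"
  shows
    "(\<forall>a b. forward_sector U a b \<longrightarrow>
       (let m = theta_bar U a b in exactly_one
         [\<exists>\<theta>\<^sub>0\<in>{a<..<m}. forward_shock U \<theta>\<^sub>0 \<and>
            U constant_on {a<..<\<theta>\<^sub>0} \<and> U constant_on {\<theta>\<^sub>0<..m},
          \<exists>\<alpha> \<beta>. a < \<alpha> \<and> \<alpha> < \<beta> \<and> \<beta> < m \<and> forward_expansion_wave \<gamma> U a b \<alpha> \<beta> \<and>
            U constant_on {a<..<\<alpha>} \<and> U constant_on {\<beta><..m},
          \<exists>\<alpha>\<in>{a<..<m}. forward_expansion_wave \<gamma> U a b \<alpha> m \<and> U constant_on {a<..<\<alpha>},
          normal_shock U m \<and> U constant_on {a<..<m},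
          U constant_on {a<..m}])) \<and>
     (\<forall>a b. backward_sector U a b \<longrightarrow>
       (let m = theta_bar U a b in exactly_one
         [\<exists>\<theta>\<^sub>0\<in>{m<..<b}. backward_shock U \<theta>\<^sub>0 \<and>
            U constant_on {m..<\<theta>\<^sub>0} \<and> U constant_on {\<theta>\<^sub>0<..<b},
          \<exists>\<alpha> \<beta>. m < \<alpha> \<and> \<alpha> < \<beta> \<and> \<beta> < b \<and> backward_expansion_wave \<gamma> U a b \<alpha> \<beta> \<and>
            U constant_on {m..<\<alpha>} \<and> U constant_on {\<beta><..<b},
          \<exists>\<beta>\<in>{m<..<b}. backward_expansion_wave \<gamma> U a b m \<beta> \<and> U constant_on {\<beta><..<b},
          normal_shock U m \<and> U constant_on {m<..<b},
          \<not> shock U m \<and> U constant_on {m..<b}]))"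
proof (intro conjI allI impI)
  have flow: "steady_flow \<gamma> c\<^sub>v S\<^sub>0 K U"
    using assms(1-4) by unfold_locales
  fix a b
  {
    assume "forward_sector U a b"
    then interpret forward_flow \<gamma> c\<^sub>v S\<^sub>0 K U a b by (rule forward_flow_of_sector[OF flow])
    have "U constant_on {a<..m} \<Longrightarrow> \<not> shock U m"
      using right_continuous_constant_imp_isCont[OF assms(6)] theta_bar_props
      by (auto simp: shock_def forward_shock_def backward_shock_def)
    then have "(\<not> shock U m \<and> U constant_on {a<..m}) \<longleftrightarrow> U constant_on {a<..m}" by blast
    then show "let m = theta_bar U a b in exactly_one
       [\<exists>\<theta>\<^sub>0\<in>{a<..<m}. forward_shock U \<theta>\<^sub>0 \<and>
          U constant_on {a<..<\<theta>\<^sub>0} \<and> U constant_on {\<theta>\<^sub>0<..m},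
        \<exists>\<alpha> \<beta>. a < \<alpha> \<and> \<alpha> < \<beta> \<and> \<beta> < m \<and> forward_expansion_wave \<gamma> U a b \<alpha> \<beta> \<and>
          U constant_on {a<..<\<alpha>} \<and> U constant_on {\<beta><..m},
        \<exists>\<alpha>\<in>{a<..<m}. forward_expansion_wave \<gamma> U a b \<alpha> m \<and> U constant_on {a<..<\<alpha>},
        normal_shock U m \<and> U constant_on {a<..<m},
        U constant_on {a<..m}]"
      using exactly_one_forward_alternative unfolding forward_alternatives_def Let_def by (simp only:)
  next
    assume "backward_sector U a b"
    then have R: "forward_flow \<gamma> c\<^sub>v S\<^sub>0 K (reflect_solution U) (- b) (- a)"
      by (rule forward_flow_of_backward_sector[OF flow])
    show "let m = theta_bar U a b in exactly_one
       [\<exists>\<theta>\<^sub>0\<in>{m<..<b}. backward_shock U \<theta>\<^sub>0 \<and>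
          U constant_on {m..<\<theta>\<^sub>0} \<and> U constant_on {\<theta>\<^sub>0<..<b},
        \<exists>\<alpha> \<beta>. m < \<alpha> \<and> \<alpha> < \<beta> \<and> \<beta> < b \<and> backward_expansion_wave \<gamma> U a b \<alpha> \<beta> \<and>
          U constant_on {m..<\<alpha>} \<and> U constant_on {\<beta><..<b},
        \<exists>\<beta>\<in>{m<..<b}. backward_expansion_wave \<gamma> U a b m \<beta> \<and> U constant_on {\<beta><..<b},
        normal_shock U m \<and> U constant_on {m<..<b},
        \<not> shock U m \<and> U constant_on {m..<b}]"
      using forward_flow.exactly_one_forward_alternative[OF R]
      unfolding reflect_forward_alternatives[OF R] Let_def .
  }
qed

end
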